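(* Let $d\ge 1$, let $r,s>0$, and put $\theta_i:=\sqrt{\lambda_i}$, $i=1,\dots,d$. Let $f:[0,\infty)^d\to[0,\infty]$ be measurable, not a.e. zero, with $F(z,t)<\infty$ for all $z\in\mathbb{N}^d$, $t>0$ ($F$ is defined in the context). 1) Suppose that for every $z\in\mathbb{N}^d$ and every $t>0$, $$\sum_{i=1}^d z_i\bigl(F(z,t)-F(z-\delta_i,t)\bigr)+\sum_{i=1}^d (z_i+1/2)\bigl(F(z,t)-F(z+\delta_i,t)\bigr)\ge 0, \qquad ( * )$$ where $\delta_i$ is the $d$-dimensional vector whose $i$th element is $1$ and whose other elements are $0$, and $F(z-\delta_i,t):=1$ if $z_i=0$. Then the Bayesian predictive distribution $p_{f,\mathrm{J}}(y\mid x)$ weakly dominates the Bayesian predictive distribution $p_{\mathrm{J}}(y\mid x)$. Furthermore, if $F(z,r)$ is not a constant function of $z$ on $\mathbb{N}^d$, then $p_{f,\mathrm{J}}(y\mid x)$ dominates $p_{\mathrm{J}}(y\mid x)$. 2) Condition $( * )$ (for every $z\in\mathbb{N}^d$, $t>0$) is satisfied if $f\in\mathcal{C}^2([0,\infty)^d)$ satisfies, for every $z\in\mathbb{N}^d$, $t>0$ and $i\in\{1,\dots,d\}$, the regularity conditions $$\int f(\theta)\prod_{j=1}^d\theta_j^{2z_j}e^{-t\theta_j^2}\,\mathrm{d}\theta<\infty,\quad \int\Bigl|\frac{\partial f}{\partial\theta_i}(\theta)\Bigr|\prod_{j=1}^d\theta_j^{2z_j}e^{-t\theta_j^2}\,\mathrm{d}\theta<\infty,\quad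 \int\Bigl|\frac{\partial^2 f}{\partial\theta_i^2}(\theta)\Bigr|\prod_{j=1}^d\theta_j^{2z_j}e^{-t\theta_j^2}\,\mathrm{d}\theta<\infty$$ (integrals over $[0,\infty)^d$), and in addition $$\sum_{i=1}^d\frac{\partial^2 f}{\partial\theta_i^2}(\theta)\le 0\quad\text{for all }\theta,\qquad\text{and}\qquad \frac{\partial f}{\partial\theta_i}(\theta)\Big|_{\theta_i=0}\le 0\quad\text{for every } i.$$
   Context: $\mathbb{N}=\{0,1,2,\dots\}$. Model: for unknown $\lambda\in(0,\infty)^d$ and known $r,s>0$, $x=(x_1,\dots,x_d)$ and $y=(y_1,\dots,y_d)$ are independent with $p(x\mid\lambda)=\prod_{i=1}^d (r\lambda_i)^{x_i}e^{-r\lambda_i}/x_i!$ and $p(y\mid\lambda)=\prod_{i=1}^d (s\lambda_i)^{y_i}e^{-s\lambda_i}/y_i!$, $x,y\in\mathbb{N}^d$. For a (possibly improper) prior density $\pi(\lambda)$, the Bayesian predictive distribution is $p_\pi(y\mid x)=\int p(x\mid\lambda)p(y\mid\lambda)\pi(\lambda)\,\mathrm{d}\lambda\big/\int p(x\mid\lambda)\pi(\lambda)\,\mathrm{d}\lambda$. The Jeffreys prior is $\pi_{\mathrm J}(\lambda)\propto\prod_{i=1}^d\lambda_i^{-1/2}$, and $p_{\mathrm J}$ is the corresponding predictive distribution. For a nonnegative function $f$ on $[0,\infty)^d$, $\pi_{f,\mathrm J}(\lambda)\propto f(\sqrt{\lambda_1},\dots,\sqrt{\lambda_d})\prod_{i=1}^d\lambda_i^{-1/2}$,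 and $p_{f,\mathrm J}$ is the corresponding predictive distribution. The Kullback–Leibler (K-L) risk of a predictive distribution $q(y\mid x)$ at $\lambda$ is $\sum_x p(x\mid\lambda)\sum_y p(y\mid\lambda)\log\frac{p(y\mid\lambda)}{q(y\mid x)}$. $q_1$ weakly dominates $q_2$ if the K-L risk of $q_1$ is at most that of $q_2$ at every $\lambda$; $q_1$ dominates $q_2$ if moreover the inequality is strict for some $\lambda$. For $z\in\mathbb{N}^d$, $t>0$, $$F(z,t)=\int_{(0,\infty)^d} f(\sqrt{\lambda_1},\dots,\sqrt{\lambda_d})\prod_{i=1}^d\frac{t^{z_i+1/2}\lambda_i^{z_i-1/2}e^{-t\lambda_i}}{\Gamma(z_i+1/2)}\,\mathrm{d}\lambda .$$ *)

theory Defs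
  imports "HOL-Analysis.Analysis"
begin

definition pos_orthant :: "(real ^ 'n) set" where
  "pos_orthant = {l. \<forall>i. 0 < l $ i}"

definition nonneg_orthant :: "(real ^ 'n) set" where
  "nonneg_orthant = {l. \<forall>i. 0 \<le> l $ i}"

definition vsqrt :: "real ^ 'n \<Rightarrow> real ^ 'n" where
  "vsqrt l = (\<chi> i. sqrt (l $ i))"

definition poisson_lik :: "real \<Rightarrow> nat ^ 'n \<Rightarrow> real ^ 'n \<Rightarrow> real" where
  "poisson_lik t x l =
     (\<Prod>i\<in>UNIV. (t * l $ i) ^ (x $ i) * exp (- t * l $ i) / fact (x $ i))"

(* The predictive distribution does not change when the prior is multiplied by a positive
   constant, so priors given only up to proportionality are represented with constant 1. *)
definition bayes_pred ::
  "real \<Rightarrow> real \<Rightarrow> (real ^ 'n \<Rightarrow> ennreal) \<Rightarrow> nat ^ 'n \<Rightarrow> nat ^ 'n \<Rightarrow> real" where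
  "bayes_pred r s prior x y =
     enn2real ((\<integral>\<^sup>+l\<in>pos_orthant.
                   ennreal (poisson_lik r x l) * ennreal (poisson_lik s y l) * prior l \<partial>lebesgue)
             / (\<integral>\<^sup>+l\<in>pos_orthant. ennreal (poisson_lik r x l) * prior l \<partial>lebesgue))"

definition jeffreys_prior :: "real ^ 'n \<Rightarrow> ennreal" where
  "jeffreys_prior l = ennreal (\<Prod>i\<in>UNIV. (l $ i) powr (- 1 / 2))"

definition f_jeffreys_prior :: "(real ^ 'n \<Rightarrow> ennreal) \<Rightarrow> real ^ 'n \<Rightarrow> ennreal" where
  "f_jeffreys_prior f l = f (vsqrt l) * jeffreys_prior l"

definition pred_J :: "real \<Rightarrow> real \<Rightarrow> nat ^ 'n \<Rightarrow> nat ^ 'n \<Rightarrow> real" where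
  "pred_J r s = bayes_pred r s jeffreys_prior"

definition pred_fJ ::
  "(real ^ 'n \<Rightarrow> ennreal) \<Rightarrow> real \<Rightarrow> real \<Rightarrow> nat ^ 'n \<Rightarrow> nat ^ 'n \<Rightarrow> real" where
  "pred_fJ f r s = bayes_pred r s (f_jeffreys_prior f)"

(* Sum of a signed family, as positive part minus negative part.  The values are extended reals,
   so that a divergent Kullback-Leibler sum has the value infinity and not a default real value.
   For a predictive distribution the negative part of the inner Kullback-Leibler sum is finite
   and the outer summands are nonnegative, so the case infinity minus infinity does not arise. *)
definition ext_sum :: "('a \<Rightarrow> ereal) \<Rightarrow> ereal" where
  "ext_sum g =
     enn2ereal (\<integral>\<^sup>+a. e2ennreal (g a) \<partial>count_space UNIV)
   - enn2ereal (\<integral>\<^sup>+a. e2ennreal (- g a) \<partial>count_space UNIV)"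

(* log (p / q) for p > 0 *)
definition log_ratio :: "real \<Rightarrow> real \<Rightarrow> ereal" where
  "log_ratio p q = (if q \<le> 0 then \<infinity> else ereal (ln (p / q)))"

definition KL_risk ::
  "real \<Rightarrow> real \<Rightarrow> (nat ^ 'n \<Rightarrow> nat ^ 'n \<Rightarrow> real) \<Rightarrow> real ^ 'n \<Rightarrow> ereal" where
  "KL_risk r s q l =
     ext_sum (\<lambda>x. ereal (poisson_lik r x l) *
       ext_sum (\<lambda>y. ereal (poisson_lik s y l) * log_ratio (poisson_lik s y l) (q x y)))"

definition weakly_dominates ::
  "real \<Rightarrow> real \<Rightarrow> (nat ^ 'n \<Rightarrow> nat ^ 'n \<Rightarrow> real) \<Rightarrow> (nat ^ 'n \<Rightarrow> nat ^ 'n \<Rightarrow> real) \<Rightarrow> bool" where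
  "weakly_dominates r s q1 q2 \<longleftrightarrow> (\<forall>l\<in>pos_orthant. KL_risk r s q1 l \<le> KL_risk r s q2 l)"

definition dominates ::
  "real \<Rightarrow> real \<Rightarrow> (nat ^ 'n \<Rightarrow> nat ^ 'n \<Rightarrow> real) \<Rightarrow> (nat ^ 'n \<Rightarrow> nat ^ 'n \<Rightarrow> real) \<Rightarrow> bool" where
  "dominates r s q1 q2 \<longleftrightarrow>
     weakly_dominates r s q1 q2 \<and> (\<exists>l\<in>pos_orthant. KL_risk r s q1 l < KL_risk r s q2 l)"

definition F_fun :: "(real ^ 'n \<Rightarrow> ennreal) \<Rightarrow> nat ^ 'n \<Rightarrow> real \<Rightarrow> ennreal" where
  "F_fun f z t =
     (\<integral>\<^sup>+l\<in>pos_orthant. f (vsqrt l) *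
        ennreal (\<Prod>i\<in>UNIV. t powr (real (z $ i) + 1 / 2) * (l $ i) powr (real (z $ i) - 1 / 2)
                           * exp (- t * l $ i) / Gamma (real (z $ i) + 1 / 2)) \<partial>lebesgue)"

definition F_minus :: "(real ^ 'n \<Rightarrow> ennreal) \<Rightarrow> nat ^ 'n \<Rightarrow> 'n \<Rightarrow> real \<Rightarrow> ennreal" where
  "F_minus f z i t = (if z $ i = 0 then 1 else F_fun f (z - axis i 1) t)"

(* Only used where all values of F_fun are finite, so enn2real loses nothing. *)
definition star_condition :: "(real ^ 'n \<Rightarrow> ennreal) \<Rightarrow> bool" where
  "star_condition f \<longleftrightarrow> (\<forall>z t. 0 < t \<longrightarrow>
     0 \<le> (\<Sum>i\<in>UNIV. real (z $ i) * (enn2real (F_fun f z t) - enn2real (F_minus f z i t)))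
       + (\<Sum>i\<in>UNIV. (real (z $ i) + 1 / 2)
              * (enn2real (F_fun f z t) - enn2real (F_fun f (z + axis i 1) t))))"

(* Partial derivatives relative to the closed orthant: one-sided where the i-th coordinate
   vanishes, two-sided elsewhere. *)
definition orthant_line :: "'n \<Rightarrow> real ^ 'n \<Rightarrow> real set" where
  "orthant_line i v = {h. v + h *\<^sub>R axis i 1 \<in> nonneg_orthant}"

definition has_pderiv_at :: "(real ^ 'n \<Rightarrow> real) \<Rightarrow> 'n \<Rightarrow> real ^ 'n \<Rightarrow> bool" where
  "has_pderiv_at g i v \<longleftrightarrow>
     (\<lambda>h. g (v + h *\<^sub>R axis i 1)) differentiable (at 0 within orthant_line i v)"

definition partial_deriv :: "'n \<Rightarrow> (real ^ 'n \<Rightarrow> real) \<Rightarrow> real ^ 'n \<Rightarrow> real" where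
  "partial_deriv i g v =
     vector_derivative (\<lambda>h. g (v + h *\<^sub>R axis i 1)) (at 0 within orthant_line i v)"

(* All partial derivatives up to order k, mixed ones included, exist on the closed orthant
   and are continuous there. *)
fun Ck_orthant :: "nat \<Rightarrow> (real ^ 'n \<Rightarrow> real) \<Rightarrow> bool" where
  "Ck_orthant 0 g \<longleftrightarrow> continuous_on nonneg_orthant g"
| "Ck_orthant (Suc k) g \<longleftrightarrow> continuous_on nonneg_orthant g \<and>
     (\<forall>i. (\<forall>v\<in>nonneg_orthant. has_pderiv_at g i v) \<and> Ck_orthant k (partial_deriv i g))"

definition weighted_integral :: "(real ^ 'n \<Rightarrow> real) \<Rightarrow> nat ^ 'n \<Rightarrow> real \<Rightarrow> ennreal" where
  "weighted_integral g z t =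
     (\<integral>\<^sup>+v\<in>nonneg_orthant.
        ennreal (\<bar>g v\<bar> * (\<Prod>j\<in>UNIV. (v $ j) ^ (2 * z $ j) * exp (- t * (v $ j)\<^sup>2))) \<partial>lebesgue)"

definition regularity_conditions :: "(real ^ 'n \<Rightarrow> real) \<Rightarrow> bool" where
  "regularity_conditions g \<longleftrightarrow> (\<forall>z t i. 0 < t \<longrightarrow>
     weighted_integral g z t < \<infinity> \<and>
     weighted_integral (partial_deriv i g) z t < \<infinity> \<and>
     weighted_integral (partial_deriv i (partial_deriv i g)) z t < \<infinity>)"

end

theory Submission
  imports Defs
begin

text \<open>Since \<open>p_fJ(y | x) = p_J(y | x) F(x + y, r + s) / F(x, r)\<close> and sums of independent Poisson variables are
  Poisson, the difference of the two risks at \<open>\<lambda>\<close> is \<open>E log F(Z, r + s) - E log F(Z, r)\<close>, where \<open>Z\<close> in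
  \<open>E log F(Z, t)\<close> is Poisson with mean \<open>t \<lambda>\<close>.  As
  \<open>t dF/dt = \<Sum>(z_i + 1/2) (F(z, t) - F(z + \<delta>_i, t))\<close>, the derivative in \<open>t\<close> of \<open>E log F(Z, t)\<close> is
  \<open>1/t\<close> times the mean of \<open>\<Sum>Z_i log (F(Z) / F(Z - \<delta>_i)) + \<Sum>(Z_i + 1/2) (1 - F(Z + \<delta>_i) / F(Z))\<close>.
  By \<open>log q \<ge> 1 - 1/q\<close> this dominates the left-hand side of condition (*) divided by \<open>F(Z)\<close>,
  strictly where \<open>F(Z)\<close> and \<open>F(Z - \<delta>_i)\<close> differ.

  In the coordinates \<open>\<theta>\<close> the weight \<open>w\<close> of \<open>F(z, t)\<close> satisfies a differential equation which turns the left-hand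
  side of (*) into \<open>-1/(4t) \<integral> f \<Delta>w\<close>.  Two integrations by parts move the Laplacian to \<open>f\<close>,
  and the sign conditions on \<open>\<Delta>f\<close> and on the boundary derivatives give (*).\<close>

no_notation Infinite_Set_Sum.abs_summable_on (infix "abs'_summable'_on" 50)

section \<open>Sums over multi-indices\<close>

lemma infsum_diff:
  fixes f g :: "'a \<Rightarrow> real"
  assumes "f summable_on A" "g summable_on A"
  shows "(\<Sum>\<^sub>\<infinity>x\<in>A. f x - g x) = infsum f A - infsum g A"
  using infsum_add[OF assms(1) summable_on_uminus[THEN iffD2, OF assms(2)]] by (simp add: infsum_uminus)

lemma infsum_sum_finite:
  fixes f :: "'b \<Rightarrow> 'a \<Rightarrow> real"
  assumes "\<And>i. i \<in> I \<Longrightarrow> f i summable_on A"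
  shows "(\<lambda>x. \<Sum>i\<in>I. f i x) summable_on A"
    and "(\<Sum>\<^sub>\<infinity>x\<in>A. \<Sum>i\<in>I. f i x) = (\<Sum>i\<in>I. infsum (f i) A)"
proof -
  have "(\<lambda>x. \<Sum>i\<in>I. f i x) summable_on A \<and> (\<Sum>\<^sub>\<infinity>x\<in>A. \<Sum>i\<in>I. f i x) = (\<Sum>i\<in>I. infsum (f i) A)"
    using assms by (induction I rule: infinite_finite_induct)
      (auto simp: infsum_add intro: summable_on_add)
  then show "(\<lambda>x. \<Sum>i\<in>I. f i x) summable_on A"
    and "(\<Sum>\<^sub>\<infinity>x\<in>A. \<Sum>i\<in>I. f i x) = (\<Sum>i\<in>I. infsum (f i) A)" by auto
qed

definition vsum :: "nat ^ 'n \<Rightarrow> nat" where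
  "vsum z = (\<Sum>i\<in>UNIV. z $ i)"

lemma vsum_add [simp]: "vsum (x + y) = vsum x + vsum y"
  by (simp add: vsum_def sum.distrib)

lemma vsum_axis [simp]: "vsum (axis i k) = k"
  by (simp add: vsum_def axis_def)

lemma le_vsum: "z $ i \<le> vsum z"
  unfolding vsum_def by (rule member_le_sum) auto

lemma vsum_eq_0_iff: "vsum z = 0 \<longleftrightarrow> z = 0"
  by (auto simp: vsum_def vec_eq_iff)

lemma diff_add_axis:
  fixes z :: "nat ^ 'n"
  assumes "z $ i \<noteq> 0"
  shows "z - axis i 1 + axis i 1 = z"
  using assms by (auto simp: vec_eq_iff axis_def)

lemma nat_vec_induct [case_names zero add_axis]:
  fixes z :: "nat ^ 'n"
  assumes "P 0" and "\<And>z i. P z \<Longrightarrow> P (z + axis i 1)"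
  shows "P z"
proof (induction "vsum z" arbitrary: z)
  case 0
  then show ?case using vsum_eq_0_iff assms(1) by metis
next
  case (Suc n)
  then have "\<exists>i. z $ i \<noteq> 0" unfolding vsum_def by (metis nat.distinct(1) sum.neutral)
  then obtain i where z: "z - axis i 1 + axis i 1 = z" using diff_add_axis by blast
  then have "vsum (z - axis i 1) + 1 = vsum z" by (metis vsum_add vsum_axis)
  then have "P (z - axis i 1)" using Suc by simp
  then show ?case using assms(2) z by metis
qed

lemma bij_betw_vec_lambda_PiE:
  "bij_betw vec_lambda (PiE UNIV B) {v. \<forall>i. v $ i \<in> B i}"
  by (rule bij_betwI[where g = vec_nth]) auto

lemma sum_prod_vec:
  fixes a :: "'n::finite \<Rightarrow> nat \<Rightarrow> real"
  shows "(\<Sum>y | \<forall>i. y $ i \<le> z $ i. \<Prod>i\<in>UNIV. a i (y $ i)) = (\<Prod>i\<in>UNIV. \<Sum>k\<le>z $ i. a i k)"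
proof -
  have "(\<Sum>y | \<forall>i. y $ i \<le> z $ i. \<Prod>i\<in>UNIV. a i (y $ i))
      = (\<Sum>g\<in>PiE UNIV (\<lambda>i. {..z $ i}). \<Prod>i\<in>UNIV. a i (g i))"
    using bij_betw_vec_lambda_PiE[of "\<lambda>i. {..z $ i}"]
    by (subst sum.reindex_bij_betw[symmetric, where h = vec_lambda]) auto
  also have "\<dots> = (\<Prod>i\<in>UNIV. \<Sum>k\<le>z $ i. a i k)"
    by (rule prod_sum_PiE[symmetric]) auto
  finally show ?thesis .
qed

lemma exp_series_vec_summable:
  fixes c :: "'n::finite \<Rightarrow> real"
  shows "(\<lambda>z::nat ^ 'n. \<Prod>i\<in>UNIV. c i ^ (z $ i) / fact (z $ i)) abs_summable_on UNIV"
proof -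
  let ?e = "\<lambda>i n. c i ^ n / fact n :: real"
  have "?e i abs_summable_on UNIV" for i
  proof -
    have "summable (\<lambda>n. norm (?e i n))"
      using summable_norm_exp[of "c i"] by (simp add: divide_inverse mult.commute)
    then show ?thesis
      by (subst summable_on_UNIV_nonneg_real_iff) auto
  qed
  then have "Infinite_Set_Sum.abs_summable_on (\<lambda>g. \<Prod>i\<in>UNIV. ?e i (g i)) (PiE UNIV (\<lambda>_. UNIV))"
    by (intro abs_summable_on_prod_PiE) (auto simp flip: abs_summable_equivalent)
  then have "(\<lambda>g. norm (\<Prod>i\<in>UNIV. ?e i (g i))) summable_on (PiE UNIV (\<lambda>_. UNIV))"
    by (simp add: abs_summable_equivalent[symmetric])
  then have "(\<lambda>g. norm (\<Prod>i\<in>UNIV. ?e i (vec_lambda g $ i))) summable_on (PiE UNIV (\<lambda>_. UNIV))"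
    by simp
  then show ?thesis
    using summable_on_reindex_bij_betw[OF bij_betw_vec_lambda_PiE[of "\<lambda>_. UNIV"],
      of "\<lambda>z. norm (\<Prod>i\<in>UNIV. ?e i (z $ i))"] by simp
qed

definition poly_growth :: "(nat ^ 'n \<Rightarrow> real) \<Rightarrow> bool" where
  "poly_growth q \<longleftrightarrow> (\<exists>C k. \<forall>z. \<bar>q z\<bar> \<le> C * (1 + real (vsum z)) ^ k)"

lemma poly_growthE:
  assumes "poly_growth q"
  obtains C k where "0 \<le> C" "\<And>z. \<bar>q z\<bar> \<le> C * (1 + real (vsum z)) ^ k"
proof -
  obtain C k where *: "\<And>z. \<bar>q z\<bar> \<le> C * (1 + real (vsum z)) ^ k"
    using assms unfolding poly_growth_def by auto
  from *[of 0] have "0 \<le> C" by (simp add: vsum_def)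
  with * that show ?thesis by blast
qed

lemma poly_growth_mono:
  assumes "poly_growth q" "\<And>z. \<bar>p z\<bar> \<le> \<bar>q z\<bar>"
  shows "poly_growth p"
  using assms unfolding poly_growth_def by (meson order_trans)

lemma poly_growth_const: "poly_growth (\<lambda>_. c)"
  unfolding poly_growth_def by (rule exI[of _ "\<bar>c\<bar>"], rule exI[of _ 0]) auto

lemma poly_growth_vsum: "poly_growth (\<lambda>z. real (vsum z))"
  unfolding poly_growth_def by (rule exI[of _ 1], rule exI[of _ 1]) auto

lemma poly_growth_nth: "poly_growth (\<lambda>z. real (z $ i))"
  by (rule poly_growth_mono[OF poly_growth_vsum]) (simp add: le_vsum)

lemma poly_growth_add:
  assumes "poly_growth p" "poly_growth q"
  shows "poly_growth (\<lambda>z. p z + q z)"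
proof -
  obtain C k where C: "0 \<le> C" "\<And>z. \<bar>p z\<bar> \<le> C * (1 + real (vsum z)) ^ k"
    using poly_growthE[OF assms(1)] by blast
  obtain D m where D: "0 \<le> D" "\<And>z. \<bar>q z\<bar> \<le> D * (1 + real (vsum z)) ^ m"
    using poly_growthE[OF assms(2)] by blast
  have "\<bar>p z + q z\<bar> \<le> (C + D) * (1 + real (vsum z)) ^ (k + m)" for z
  proof -
    have "\<bar>p z\<bar> \<le> C * (1 + real (vsum z)) ^ (k + m)"
      by (rule order_trans[OF C(2) mult_left_mono]) (auto intro: power_increasing C(1))
    moreover have "\<bar>q z\<bar> \<le> D * (1 + real (vsum z)) ^ (k + m)"
      by (rule order_trans[OF D(2) mult_left_mono]) (auto intro: power_increasing D(1))
    ultimately show ?thesis by (simp add: distrib_right)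
  qed
  then show ?thesis unfolding poly_growth_def by blast
qed

lemma poly_growth_mult:
  assumes "poly_growth p" "poly_growth q"
  shows "poly_growth (\<lambda>z. p z * q z)"
proof -
  obtain C k where C: "0 \<le> C" "\<And>z. \<bar>p z\<bar> \<le> C * (1 + real (vsum z)) ^ k"
    using poly_growthE[OF assms(1)] by blast
  obtain D m where D: "0 \<le> D" "\<And>z. \<bar>q z\<bar> \<le> D * (1 + real (vsum z)) ^ m"
    using poly_growthE[OF assms(2)] by blast
  have "\<bar>p z * q z\<bar> \<le> (C * D) * (1 + real (vsum z)) ^ (k + m)" for z
    using mult_mono[OF C(2)[of z] D(2)[of z]] C(1)
    by (simp add: abs_mult power_add mult_ac)
  then show ?thesis unfolding poly_growth_def by blast
qed

lemma poly_growth_uminus: "poly_growth q \<Longrightarrow> poly_growth (\<lambda>z. - q z)"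
  by (rule poly_growth_mono) auto

lemma poly_growth_diff:
  "poly_growth p \<Longrightarrow> poly_growth q \<Longrightarrow> poly_growth (\<lambda>z. p z - q z)"
  using poly_growth_add[of p "\<lambda>z. - q z"] by (simp add: poly_growth_uminus)

lemma poly_growth_sum:
  "(\<And>i. i \<in> I \<Longrightarrow> poly_growth (q i)) \<Longrightarrow> poly_growth (\<lambda>z. \<Sum>i\<in>I. q i z)"
  by (induction I rule: infinite_finite_induct)
     (auto intro: poly_growth_add poly_growth_const)

lemmas poly_growth_intros = poly_growth_const poly_growth_vsum poly_growth_nth poly_growth_add
  poly_growth_mult poly_growth_diff poly_growth_sum

lemma poly_growth_shift:
  assumes "poly_growth q"
  shows "poly_growth (\<lambda>z. q (z + x))"
proof -
  obtain C k where C: "0 \<le> C" "\<And>z. \<bar>q z\<bar> \<le> C * (1 + real (vsum z)) ^ k"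
    using poly_growthE[OF assms] by blast
  have "\<bar>q (z + x)\<bar> \<le> (C * (1 + real (vsum x)) ^ k) * (1 + real (vsum z)) ^ k" for z
  proof -
    have "\<bar>q (z + x)\<bar> \<le> C * (1 + real (vsum z) + real (vsum x)) ^ k"
      using C(2)[of "z + x"] by (simp add: add_ac)
    also have "\<dots> \<le> C * ((1 + real (vsum x)) * (1 + real (vsum z))) ^ k"
      using C(1) by (intro mult_left_mono power_mono) (auto simp: algebra_simps)
    finally show ?thesis by (simp add: power_mult_distrib mult_ac)
  qed
  then show ?thesis unfolding poly_growth_def by blast
qed

section \<open>Poisson expectations\<close>

lemma poisson_lik_eq:
  "poisson_lik t z l = t ^ vsum z * exp (- t * (\<Sum>i\<in>UNIV. l $ i))
     * (\<Prod>i\<in>UNIV. (l $ i) ^ (z $ i) / fact (z $ i))"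
  by (simp add: poisson_lik_def vsum_def power_mult_distrib prod.distrib power_sum exp_sum
      sum_distrib_left prod_dividef sum_negf flip: sum_negf)

lemma poisson_lik_pos: "0 < t \<Longrightarrow> l \<in> pos_orthant \<Longrightarrow> 0 < poisson_lik t z l"
  by (auto simp: poisson_lik_def pos_orthant_def intro!: prod_pos)

lemma poisson_lik_nonneg: "0 \<le> t \<Longrightarrow> l \<in> pos_orthant \<Longrightarrow> 0 \<le> poisson_lik t z l"
  by (auto simp: poisson_lik_def pos_orthant_def less_imp_le intro!: prod_nonneg)

lemma poly_le_exp:
  fixes x :: real
  assumes "0 \<le> x"
  shows "x ^ k \<le> fact k * exp x"
proof -
  have "(\<Sum>n\<in>{k}. x ^ n /\<^sub>R fact n) \<le> (\<Sum>n. x ^ n /\<^sub>R fact n)"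
    using assms by (intro sum_le_suminf summable_exp_generic) auto
  then show ?thesis by (simp add: exp_def field_simps)
qed

lemma poisson_abs_summable:
  fixes l :: "real ^ 'n"
  assumes "0 \<le> t" "l \<in> pos_orthant" "poly_growth q"
  shows "(\<lambda>z. poisson_lik t z l * q z) abs_summable_on UNIV"
proof -
  obtain C k where C: "0 \<le> C" "\<And>z. \<bar>q z\<bar> \<le> C * (1 + real (vsum z)) ^ k"
    using poly_growthE[OF assms(3)] by blast
  let ?c = "\<lambda>i. exp 1 * t * l $ i"
  let ?K = "C * fact k * exp 1 * exp (- t * (\<Sum>i\<in>UNIV. l $ i))"
  have "norm (poisson_lik t z l * q z) \<le> ?K * norm (\<Prod>i\<in>UNIV. ?c i ^ (z $ i) / fact (z $ i))" for z
  proof -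
    have l0: "0 \<le> l $ i" for i using assms(2) by (auto simp: pos_orthant_def less_imp_le)
    have "\<bar>q z\<bar> \<le> C * (1 + real (vsum z)) ^ k" by (rule C)
    also have "\<dots> \<le> C * (fact k * exp (1 + real (vsum z)))"
      using C(1) by (intro mult_left_mono poly_le_exp) auto
    also have "\<dots> = C * fact k * exp 1 * exp 1 ^ vsum z"
      by (simp add: exp_add exp_of_nat_mult[symmetric])
    finally have "\<bar>q z\<bar> \<le> C * fact k * exp 1 * exp 1 ^ vsum z" .
    then have "norm (poisson_lik t z l * q z)
        \<le> poisson_lik t z l * (C * fact k * exp 1 * exp 1 ^ vsum z)"
      using poisson_lik_nonneg[OF assms(1,2), of z] by (simp add: abs_mult mult_left_mono)
    also have "\<dots> = ?K * (\<Prod>i\<in>UNIV. ?c i ^ (z $ i) / fact (z $ i))"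
      by (simp add: poisson_lik_eq vsum_def power_mult_distrib prod.distrib power_sum prod_dividef)
    also have "\<dots> = ?K * norm (\<Prod>i\<in>UNIV. ?c i ^ (z $ i) / fact (z $ i))"
      using l0 assms(1) by (subst real_norm_def, subst abs_of_nonneg) (auto intro!: prod_nonneg)
    finally show ?thesis .
  qed
  moreover have "(\<lambda>z::nat^'n. ?K * norm (\<Prod>i\<in>UNIV. ?c i ^ (z $ i) / fact (z $ i))) summable_on UNIV"
    by (intro summable_on_cmult_right exp_series_vec_summable)
  ultimately show ?thesis
    by (intro Infinite_Sum.abs_summable_on_comparison_test'[where g = "\<lambda>z. ?K * norm (\<Prod>i\<in>UNIV. ?c i ^ (z $ i) / fact (z $ i))"]) auto
qed

lemmas poisson_summable = poisson_abs_summable[THEN abs_summable_summable]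

definition poisson_mean :: "real \<Rightarrow> real ^ 'n \<Rightarrow> (nat ^ 'n \<Rightarrow> real) \<Rightarrow> real" where
  "poisson_mean t l q = (\<Sum>\<^sub>\<infinity>z. poisson_lik t z l * q z)"

lemma poisson_lik_convolution:
  "(\<Sum>y | \<forall>i. y $ i \<le> z $ i. poisson_lik r (z - y) l * poisson_lik s y l)
     = poisson_lik (r + s) z l"
proof -
  let ?a = "\<lambda>i k. ((r * l $ i) ^ (z $ i - k) * exp (- r * l $ i) / fact (z $ i - k))
             * ((s * l $ i) ^ k * exp (- s * l $ i) / fact k)"
  have "(\<Sum>k\<le>z $ i. ?a i k) = ((r + s) * l $ i) ^ (z $ i) * exp (- (r + s) * l $ i) / fact (z $ i)" for i
  proof -
    have "(\<Sum>k\<le>z $ i. ?a i k) = (\<Sum>k\<le>z $ i. of_nat (z $ i choose k) * (s * l $ i) ^ k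
            * (r * l $ i) ^ (z $ i - k)) * (exp (- r * l $ i) * exp (- s * l $ i) / fact (z $ i))"
      unfolding sum_distrib_right
      by (rule sum.cong) (auto simp: binomial_fact field_simps)
    also have "\<dots> = ((r + s) * l $ i) ^ (z $ i) * exp (- (r + s) * l $ i) / fact (z $ i)"
      using binomial_ring[of "s * l $ i" "r * l $ i" "z $ i"]
      by (simp add: algebra_simps flip: exp_add)
    finally show ?thesis .
  qed
  moreover have "(\<Sum>y | \<forall>i. y $ i \<le> z $ i. poisson_lik r (z - y) l * poisson_lik s y l)
     = (\<Sum>y | \<forall>i. y $ i \<le> z $ i. \<Prod>i\<in>UNIV. ?a i (y $ i))"
    by (simp add: poisson_lik_def prod.distrib[symmetric])
  ultimately show ?thesis
    unfolding sum_prod_vec[of ?a z] by (simp add: poisson_lik_def)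
qed

lemma poisson_mean_poisson_mean:
  fixes l :: "real ^ 'n"
  assumes r: "0 < r" and s: "0 < s" and l: "l \<in> pos_orthant" and q: "poly_growth q"
  shows "poisson_mean r l (\<lambda>x. poisson_mean s l (\<lambda>y. q (x + y))) = poisson_mean (r + s) l q"
    and "(\<lambda>x. poisson_lik r x l * poisson_mean s l (\<lambda>y. q (x + y))) abs_summable_on UNIV"
proof -
  obtain C k where C: "0 \<le> C" "\<And>z. \<bar>q z\<bar> \<le> C * (1 + real (vsum z)) ^ k"
    using poly_growthE[OF q] by blast
  let ?w = "\<lambda>z::nat^'n. (1 + real (vsum z)) ^ k"
  let ?h = "\<lambda>(x, y). poisson_lik r x l * poisson_lik s y l * q (x + y)"
  let ?m = "\<lambda>(x, y). C * ((poisson_lik r x l * ?w x) * (poisson_lik s y l * ?w y))"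
  note nn = poisson_lik_nonneg[OF less_imp_le[OF r] l] poisson_lik_nonneg[OF less_imp_le[OF s] l]
  have pw: "poly_growth ?w"
    unfolding poly_growth_def by (rule exI[of _ 1], rule exI[of _ k]) auto
  have "?m summable_on (UNIV \<times> UNIV)"
  proof (rule summable_on_SigmaI)
    fix x :: "nat ^ 'n"
    show "((\<lambda>y. ?m (x, y)) has_sum C * (poisson_lik r x l * ?w x) * (\<Sum>\<^sub>\<infinity>y. poisson_lik s y l * ?w y)) UNIV"
      using has_sum_cmult_right[OF has_sum_infsum[OF poisson_summable[OF less_imp_le[OF s] l pw]],
        of "C * (poisson_lik r x l * ?w x)"]
      by (simp add: mult_ac)
  next
    show "(\<lambda>x. C * (poisson_lik r x l * ?w x) * (\<Sum>\<^sub>\<infinity>y. poisson_lik s y l * ?w y)) summable_on UNIV"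
      by (intro summable_on_cmult_left summable_on_cmult_right poisson_summable[OF less_imp_le[OF r] l pw])
  qed (use C nn in auto)
  then have habs: "?h abs_summable_on (UNIV \<times> UNIV)"
  proof (rule Infinite_Sum.abs_summable_on_comparison_test')
    fix p :: "(nat ^ 'n) \<times> (nat ^ 'n)"
    obtain x y where [simp]: "p = (x, y)" by force
    have "\<bar>q (x + y)\<bar> \<le> C * (1 + real (vsum x) + real (vsum y)) ^ k"
      using C(2)[of "x + y"] by (simp add: add_ac)
    also have "\<dots> \<le> C * ((1 + real (vsum x)) * (1 + real (vsum y))) ^ k"
      using C(1) by (intro mult_left_mono power_mono) (auto simp: algebra_simps)
    finally have "\<bar>q (x + y)\<bar> \<le> C * (?w x * ?w y)" by (simp add: power_mult_distrib)
    then have "poisson_lik r x l * poisson_lik s y l * \<bar>q (x + y)\<bar>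
       \<le> poisson_lik r x l * poisson_lik s y l * (C * (?w x * ?w y))"
      using nn by (intro mult_left_mono) auto
    then show "norm (?h p) \<le> ?m p"
      using nn[of x] nn[of y] by (simp add: abs_mult mult_ac)
  qed
  have inner: "poisson_lik r x l * poisson_mean s l (\<lambda>y. q (x + y)) = (\<Sum>\<^sub>\<infinity>y. ?h (x, y))" for x
    by (simp add: poisson_mean_def mult.assoc infsum_cmult_right')
  show "(\<lambda>x. poisson_lik r x l * poisson_mean s l (\<lambda>y. q (x + y))) abs_summable_on UNIV"
  proof (rule Infinite_Sum.abs_summable_on_comparison_test)
    show "(\<lambda>x. \<Sum>\<^sub>\<infinity>y. norm (?h (x, y))) abs_summable_on UNIV"
      using habs unfolding Infinite_Sum.abs_summable_on_Sigma_iff by blast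
    fix x
    have "norm (\<Sum>\<^sub>\<infinity>y. ?h (x, y)) \<le> (\<Sum>\<^sub>\<infinity>y. norm (?h (x, y)))"
      using habs unfolding Infinite_Sum.abs_summable_on_Sigma_iff by (intro norm_infsum_bound) blast
    also have "\<dots> \<le> norm (\<Sum>\<^sub>\<infinity>y. norm (?h (x, y)))" by simp
    finally show "norm (poisson_lik r x l * poisson_mean s l (\<lambda>y. q (x + y))) \<le> \<dots>"
      by (simp only: inner)
  qed
  have bij: "bij_betw (\<lambda>(z, y). (z - y, y)) (SIGMA z:UNIV. {y. \<forall>i. y $ i \<le> z $ i})
      (UNIV \<times> (UNIV :: (nat ^ 'n) set))"
    by (rule bij_betwI[where g = "\<lambda>(x, y). (x + y, y)"]) (auto simp: vec_eq_iff)
  let ?k = "\<lambda>(z, y). poisson_lik r (z - y) l * poisson_lik s y l * q z"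
  have keq: "?h ((\<lambda>(z, y). (z - y, y)) p) = ?k p"
    if "p \<in> (SIGMA z:UNIV. {y. \<forall>i. y $ i \<le> z $ i})" for p
  proof -
    obtain z y where [simp]: "p = (z, y)" by force
    have "z - y + y = z" using that by (auto simp: vec_eq_iff)
    then show ?thesis by simp
  qed
  have ksum: "?k summable_on (SIGMA z:UNIV. {y. \<forall>i. y $ i \<le> z $ i})"
    using abs_summable_summable[OF habs] summable_on_reindex_bij_betw[OF bij, of ?h]
    by (subst summable_on_cong[OF keq, symmetric]) simp_all
  have "poisson_mean r l (\<lambda>x. poisson_mean s l (\<lambda>y. q (x + y))) = (\<Sum>\<^sub>\<infinity>x. \<Sum>\<^sub>\<infinity>y. ?h (x, y))"
    by (subst poisson_mean_def) (simp only: inner)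
  also have "\<dots> = infsum ?h (UNIV \<times> UNIV)"
    by (rule infsum_Sigma_banach[OF abs_summable_summable[OF habs]])
  also have "\<dots> = infsum ?k (SIGMA z:UNIV. {y. \<forall>i. y $ i \<le> z $ i})"
    using infsum_reindex_bij_betw[OF bij, of ?h] by (subst infsum_cong[OF keq, symmetric]) simp_all
  also have "\<dots> = (\<Sum>\<^sub>\<infinity>z. \<Sum>\<^sub>\<infinity>y\<in>{y. \<forall>i. y $ i \<le> z $ i}. ?k (z, y))"
    by (rule infsum_Sigma_banach[OF ksum, symmetric])
  also have "\<dots> = (\<Sum>\<^sub>\<infinity>z. poisson_lik (r + s) z l * q z)"
  proof (rule infsum_cong)
    fix z :: "nat ^ 'n"
    have "finite {y. \<forall>i. y $ i \<le> z $ i}"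
      using bij_betw_finite[OF bij_betw_vec_lambda_PiE[of "\<lambda>i. {..z $ i}"]]
      by (simp add: finite_PiE)
    then show "(\<Sum>\<^sub>\<infinity>y\<in>{y. \<forall>i. y $ i \<le> z $ i}. ?k (z, y)) = poisson_lik (r + s) z l * q z"
      by (simp add: poisson_lik_convolution[symmetric] sum_distrib_right)
  qed
  finally show "poisson_mean r l (\<lambda>x. poisson_mean s l (\<lambda>y. q (x + y))) = poisson_mean (r + s) l q"
    by (simp add: poisson_mean_def)
qed

lemma poisson_mean_size_bias:
  fixes l :: "real ^ 'n"
  assumes t: "0 < t" and l: "l \<in> pos_orthant"
  shows "poisson_mean t l (\<lambda>z. real (z $ i) * q (z - axis i 1)) = t * l $ i * poisson_mean t l q"
proof -
  have bij: "bij_betw (\<lambda>z. z + axis i 1) UNIV {z::nat^'n. z $ i \<noteq> 0}"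
    by (rule bij_betwI[where g = "\<lambda>z. z - axis i 1"]) (auto simp: diff_add_axis simp del: One_nat_def)
  have *: "poisson_lik t (z + axis i 1) l * real ((z + axis i 1) $ i) = t * l $ i * poisson_lik t z l" for z
  proof -
    let ?g = "\<lambda>z j. (t * l $ j) ^ (z $ j) * exp (- t * l $ j) / fact (z $ j)"
    have "poisson_lik t (z + axis i 1) l * real ((z + axis i 1) $ i)
       = (?g (z + axis i 1) i * real ((z + axis i 1) $ i)) * (\<Prod>j\<in>UNIV - {i}. ?g (z + axis i 1) j)"
      unfolding poisson_lik_def by (subst prod.remove[of _ i]) auto
    also have "?g (z + axis i 1) i * real ((z + axis i 1) $ i) = t * l $ i * ?g z i"
      by (simp add: divide_simps)
    also have "(\<Prod>j\<in>UNIV - {i}. ?g (z + axis i 1) j) = (\<Prod>j\<in>UNIV - {i}. ?g z j)"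
      by (rule prod.cong) (auto simp: axis_def)
    also have "t * l $ i * ?g z i * (\<Prod>j\<in>UNIV - {i}. ?g z j) = t * l $ i * poisson_lik t z l"
      unfolding poisson_lik_def by (subst (2) prod.remove[of _ i]) auto
    finally show ?thesis .
  qed
  have "poisson_mean t l (\<lambda>z. real (z $ i) * q (z - axis i 1))
     = (\<Sum>\<^sub>\<infinity>z\<in>{z. z $ i \<noteq> 0}. poisson_lik t z l * (real (z $ i) * q (z - axis i 1)))"
    unfolding poisson_mean_def by (rule infsum_cong_neutral) auto
  also have "\<dots> = (\<Sum>\<^sub>\<infinity>z. poisson_lik t (z + axis i 1) l * (real ((z + axis i 1) $ i) * q (z + axis i 1 - axis i 1)))"
    by (rule infsum_reindex_bij_betw[OF bij, symmetric])
  also have "\<dots> = (\<Sum>\<^sub>\<infinity>z. t * l $ i * (poisson_lik t z l * q z))"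
    by (simp only: mult.assoc[symmetric] *) simp
  finally show ?thesis by (simp add: poisson_mean_def infsum_cmult_right')
qed

lemma DERIV_infsum:
  fixes f :: "'a \<Rightarrow> real \<Rightarrow> real"
  assumes e: "bij_betw e (UNIV :: nat set) (UNIV :: 'a set)"
  assumes f: "\<And>z x. x \<in> {a..b} \<Longrightarrow> (f z has_real_derivative f' z x) (at x within {a..b})"
    and f': "\<And>z x. x \<in> {a..b} \<Longrightarrow> \<bar>f' z x\<bar> \<le> M z" and M: "M summable_on UNIV"
    and s: "\<And>x. x \<in> {a..b} \<Longrightarrow> (\<lambda>z. f z x) abs_summable_on UNIV"
    and x: "a < x" "x < b"
  shows "((\<lambda>x. \<Sum>\<^sub>\<infinity>z. f z x) has_real_derivative (\<Sum>\<^sub>\<infinity>z. f' z x)) (at x)"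
proof -
  have eq: "(\<Sum>n. q (e n)) = (\<Sum>\<^sub>\<infinity>z. q z)" if "q abs_summable_on UNIV" for q :: "'a \<Rightarrow> real"
  proof -
    have "(\<lambda>n. q (e n)) summable_on UNIV"
      using abs_summable_summable[OF that] summable_on_reindex_bij_betw[OF e, of q] by simp
    then have "(\<Sum>n. q (e n)) = (\<Sum>\<^sub>\<infinity>n. q (e n))"
      using has_sum_imp_sums has_sum_infsum sums_unique by metis
    then show ?thesis using infsum_reindex_bij_betw[OF e, of q] by simp
  qed
  have "summable (\<lambda>n. M (e n))"
    using M summable_on_reindex_bij_betw[OF e, of M] by (simp add: summable_on_imp_summable)
  then have u: "uniformly_convergent_on {a..b} (\<lambda>n x. \<Sum>i<n. f' (e i) x)"
    by (intro Weierstrass_m_test'[where M = "\<lambda>n. M (e n)"]) (use f' in auto)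
  have "summable (\<lambda>n. f (e n) x)"
    using abs_summable_summable[OF s] summable_on_reindex_bij_betw[OF e, of "\<lambda>z. f z x"] x
    by (simp add: summable_on_imp_summable)
  then have "((\<lambda>x. \<Sum>n. f (e n) x) has_real_derivative (\<Sum>n. f' (e n) x)) (at x)"
    using x by (intro has_field_derivative_series'(2)[OF _ f u, of x]) auto
  also have "(\<Sum>n. f' (e n) x) = (\<Sum>\<^sub>\<infinity>z. f' z x)"
    by (rule eq, rule Infinite_Sum.abs_summable_on_comparison_test'[OF M]) (use f' x in auto)
  also have "((\<lambda>x. \<Sum>n. f (e n) x) has_real_derivative (\<Sum>\<^sub>\<infinity>z. f' z x)) (at x) \<longleftrightarrow> ?thesis"
  proof (rule DERIV_cong_ev)
    show "\<forall>\<^sub>F x in nhds x. (\<Sum>n. f (e n) x) = (\<Sum>\<^sub>\<infinity>z. f z x)"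
      using eventually_nhds_in_open[of "{a<..<b}" x] x
      by (auto elim!: eventually_mono intro!: eq s)
  qed auto
  finally show ?thesis .
qed

lemma ex_bij_nat_vec: "\<exists>e. bij_betw e (UNIV :: nat set) (UNIV :: (nat ^ 'n) set)"
proof -
  have "inj (\<lambda>k::nat. axis undefined k :: nat ^ 'n)"
    by (auto simp: inj_def axis_eq_axis)
  then have "infinite (UNIV :: (nat ^ 'n) set)"
    using finite_imageD[of "\<lambda>k::nat. axis undefined k :: nat ^ 'n" UNIV]
    by (meson finite_subset infinite_UNIV_nat top_greatest)
  then show ?thesis
    using bij_betw_from_nat_into[of "UNIV :: (nat ^ 'n) set"] by auto
qed

section \<open>Monotonicity of the mean of the logarithm\<close>

text \<open>In \<open>z - axis i 1\<close> the subtraction is truncated; where this matters, its coefficient \<open>z $ i\<close> vanishes.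
  Besides giving the sign of the derivative, \<open>star\<close> bounds the quotients of neighbouring values of
  \<open>\<Phi>\<close> polynomially, uniformly in \<open>t\<close>, which makes all the Poisson sums converge.\<close>

locale star_family =
  fixes \<Phi> :: "nat ^ 'n \<Rightarrow> real \<Rightarrow> real"
  assumes pos: "0 < t \<Longrightarrow> 0 < \<Phi> z t"
    and deriv: "0 < t \<Longrightarrow> (\<Phi> z has_real_derivative
      (1 / t) * (\<Sum>i\<in>UNIV. (real (z $ i) + 1 / 2) * (\<Phi> z t - \<Phi> (z + axis i 1) t))) (at t)"
    and star: "0 < t \<Longrightarrow> 0 \<le> (\<Sum>i\<in>UNIV. real (z $ i) * (\<Phi> z t - \<Phi> (z - axis i 1) t))
      + (\<Sum>i\<in>UNIV. (real (z $ i) + 1 / 2) * (\<Phi> z t - \<Phi> (z + axis i 1) t))"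
begin

lemma star_le:
  assumes "0 < t"
  shows "(\<Sum>i\<in>UNIV. real (z $ i) * \<Phi> (z - axis i 1) t)
     + (\<Sum>i\<in>UNIV. (real (z $ i) + 1 / 2) * \<Phi> (z + axis i 1) t) \<le> (2 * real (vsum z) + real CARD('n) / 2) * \<Phi> z t"
proof -
  have "(\<Sum>i\<in>UNIV. real (z $ i) * \<Phi> z t) = real (vsum z) * \<Phi> z t"
    by (simp add: vsum_def sum_distrib_right)
  moreover have "(\<Sum>i\<in>UNIV. (real (z $ i) + 1 / 2) * \<Phi> z t) = (real (vsum z) + real CARD('n) / 2) * \<Phi> z t"
    by (simp add: vsum_def sum_distrib_right[symmetric] sum.distrib)
  ultimately show ?thesis
    using star[OF assms, of z] by (simp add: right_diff_distrib sum_subtractf algebra_simps)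
qed

lemma up_le:
  assumes t: "0 < t"
  shows "\<Phi> (z + axis i 1) t \<le> (4 * real (vsum z) + 4 + real CARD('n)) * \<Phi> z t"
proof -
  note p = less_imp_le[OF pos[OF t]]
  have "(1 / 2) * \<Phi> (z + axis i 1) t \<le> (real (z $ i) + 1 / 2) * \<Phi> (z + axis i 1) t"
    using p by (intro mult_right_mono) auto
  also have "\<dots> \<le> (\<Sum>i\<in>UNIV. (real (z $ i) + 1 / 2) * \<Phi> (z + axis i 1) t)"
    by (rule member_le_sum[where f = "\<lambda>i. (real (z $ i) + 1 / 2) * \<Phi> (z + axis i 1) t"]) (auto simp: p)
  also have "\<dots> \<le> (2 * real (vsum z) + real CARD('n) / 2) * \<Phi> z t"
    using star_le[OF t, of z] sum_nonneg[of UNIV "\<lambda>i. real (z $ i) * \<Phi> (z - axis i 1) t"] p by auto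
  finally show ?thesis using p[of z] by (simp add: algebra_simps)
qed

lemma down_le:
  assumes t: "0 < t"
  shows "\<Phi> z t \<le> (4 * real (vsum z) + 4 + real CARD('n)) * \<Phi> (z + axis i 1) t"
proof -
  note p = less_imp_le[OF pos[OF t]]
  let ?w = "z + axis i 1"
  have "\<Phi> z t \<le> real (?w $ i) * \<Phi> (?w - axis i 1) t"
    using p[of z] by (simp add: algebra_simps)
  also have "\<dots> \<le> (\<Sum>i\<in>UNIV. real (?w $ i) * \<Phi> (?w - axis i 1) t)"
    by (rule member_le_sum[where f = "\<lambda>i. real (?w $ i) * \<Phi> (?w - axis i 1) t"]) (auto simp: p)
  also have "\<dots> \<le> (2 * real (vsum ?w) + real CARD('n) / 2) * \<Phi> ?w t"
    using star_le[OF t, of ?w] sum_nonneg[of UNIV "\<lambda>i. (real (?w $ i) + 1 / 2) * \<Phi> (?w + axis i 1) t"] p by auto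
  also have "\<dots> \<le> (4 * real (vsum z) + 4 + real CARD('n)) * \<Phi> ?w t"
    by (intro mult_right_mono p) auto
  finally show ?thesis .
qed

lemma ln_step:
  assumes t: "0 < t"
  shows "\<bar>ln (\<Phi> (z + axis i 1) t) - ln (\<Phi> z t)\<bar> \<le> 4 * real (vsum z) + 4 + real CARD('n)"
proof -
  let ?K = "4 * real (vsum z) + 4 + real CARD('n)"
  have K: "0 < ?K" by (simp add: add_pos_nonneg)
  have lnK: "ln ?K \<le> ?K" using ln_le_minus_one[OF K] by simp
  have "ln (\<Phi> (z + axis i 1) t) \<le> ln (?K * \<Phi> z t)"
    using up_le[OF t] pos[OF t] K by (subst ln_le_cancel_iff) auto
  moreover have "ln (\<Phi> z t) \<le> ln (?K * \<Phi> (z + axis i 1) t)"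
    using down_le[OF t] pos[OF t] K by (subst ln_le_cancel_iff) auto
  moreover note ln_mult_pos[OF K pos[OF t], of z] ln_mult_pos[OF K pos[OF t], of "z + axis i 1"]
  ultimately show ?thesis using lnK by linarith
qed

lemma ln_bound:
  assumes t: "0 < t"
  shows "\<bar>ln (\<Phi> z t)\<bar> \<le> \<bar>ln (\<Phi> 0 t)\<bar> + real (vsum z) * (4 * real (vsum z) + 4 + real CARD('n))"
proof (induction z rule: nat_vec_induct)
  case zero
  then show ?case by (simp add: vsum_def)
next
  case (add_axis w i)
  have "\<bar>ln (\<Phi> (w + axis i 1) t)\<bar> \<le> \<bar>ln (\<Phi> w t)\<bar> + (4 * real (vsum w) + 4 + real CARD('n))"
    using ln_step[OF t, of w i] by linarith
  also have "\<dots> \<le> \<bar>ln (\<Phi> 0 t)\<bar> + real (vsum w) * (4 * real (vsum w) + 4 + real CARD('n))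
      + (4 * real (vsum w) + 4 + real CARD('n))"
    using add_axis by simp
  also have "\<dots> \<le> \<bar>ln (\<Phi> 0 t)\<bar> + real (vsum (w + axis i 1)) * (4 * real (vsum (w + axis i 1)) + 4 + real CARD('n))"
    by (simp add: algebra_simps)
  finally show ?case .
qed

lemma poly_growth_ln: "0 < t \<Longrightarrow> poly_growth (\<lambda>z. ln (\<Phi> z t))"
  by (rule poly_growth_mono[where q = "\<lambda>z. \<bar>ln (\<Phi> 0 t)\<bar> + real (vsum z) * (4 * real (vsum z) + 4 + real CARD('n))"])
    (use ln_bound in \<open>auto intro!: poly_growth_intros order_trans[OF _ abs_ge_self]\<close>)

definition log_deriv :: "nat ^ 'n \<Rightarrow> real \<Rightarrow> real" where
  "log_deriv z t = (1 / t) * (\<Sum>i\<in>UNIV. (real (z $ i) + 1 / 2) * (1 - \<Phi> (z + axis i 1) t / \<Phi> z t))"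

lemma ln_deriv:
  assumes t: "0 < t"
  shows "((\<lambda>t. ln (\<Phi> z t)) has_real_derivative log_deriv z t) (at t)"
proof -
  have "((\<lambda>t. ln (\<Phi> z t)) has_real_derivative (1 / \<Phi> z t) *
    ((1 / t) * (\<Sum>i\<in>UNIV. (real (z $ i) + 1 / 2) * (\<Phi> z t - \<Phi> (z + axis i 1) t)))) (at t)"
    by (rule DERIV_chain2[OF DERIV_ln_divide[OF pos[OF t]] deriv[OF t]])
  also have "(1 / \<Phi> z t) *
    ((1 / t) * (\<Sum>i\<in>UNIV. (real (z $ i) + 1 / 2) * (\<Phi> z t - \<Phi> (z + axis i 1) t))) = log_deriv z t"
    using pos[OF t, of z] by (simp add: log_deriv_def sum_divide_distrib diff_divide_distrib[symmetric] field_simps)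
  finally show ?thesis .
qed

lemma log_deriv_bound:
  assumes t: "0 < t"
  shows "\<bar>log_deriv z t\<bar> \<le> (1 / t) * ((real (vsum z) + real CARD('n) / 2) * (4 * real (vsum z) + 5 + real CARD('n)))"
proof -
  let ?K = "4 * real (vsum z) + 5 + real CARD('n)"
  have "\<bar>\<Sum>i\<in>UNIV. (real (z $ i) + 1 / 2) * (1 - \<Phi> (z + axis i 1) t / \<Phi> z t)\<bar>
    \<le> (\<Sum>i\<in>UNIV. (real (z $ i) + 1 / 2) * ?K)"
  proof (rule order_trans[OF sum_abs sum_mono])
    fix i
    have "\<Phi> (z + axis i 1) t / \<Phi> z t \<le> 4 * real (vsum z) + 4 + real CARD('n)"
      using up_le[OF t, of z i] pos[OF t, of z] by (simp add: pos_divide_le_eq)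
    moreover have "0 \<le> \<Phi> (z + axis i 1) t / \<Phi> z t"
      using pos[OF t] by (simp add: less_imp_le)
    ultimately have "\<bar>1 - \<Phi> (z + axis i 1) t / \<Phi> z t\<bar> \<le> ?K" by linarith
    then show "\<bar>(real (z $ i) + 1 / 2) * (1 - \<Phi> (z + axis i 1) t / \<Phi> z t)\<bar> \<le> (real (z $ i) + 1 / 2) * ?K"
      unfolding abs_mult by (simp add: mult_left_mono)
  qed
  also have "\<dots> = (real (vsum z) + real CARD('n) / 2) * ?K"
    by (simp add: vsum_def sum_distrib_right[symmetric] sum.distrib)
  finally show ?thesis
    using t by (simp add: log_deriv_def abs_mult divide_right_mono)
qed

definition mean_log :: "real ^ 'n \<Rightarrow> real \<Rightarrow> real" where
  "mean_log l t = poisson_mean t l (\<lambda>z. ln (\<Phi> z t))"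

definition slack :: "nat ^ 'n \<Rightarrow> real \<Rightarrow> real" where
  "slack z t = (\<Sum>i\<in>UNIV. real (z $ i) * (ln (\<Phi> z t) - ln (\<Phi> (z - axis i 1) t))) + t * log_deriv z t"

lemma slack_ge:
  assumes t: "0 < t"
  shows "(\<Sum>i\<in>UNIV. real (z $ i) * (ln (\<Phi> z t) - ln (\<Phi> (z - axis i 1) t) - (1 - \<Phi> (z - axis i 1) t / \<Phi> z t)))
      \<le> slack z t"
    and "0 \<le> real (z $ i) * (ln (\<Phi> z t) - ln (\<Phi> (z - axis i 1) t) - (1 - \<Phi> (z - axis i 1) t / \<Phi> z t))"
    and "\<Phi> (z - axis i 1) t \<noteq> \<Phi> z t \<Longrightarrow> z $ i \<noteq> 0 \<Longrightarrow>
      0 < real (z $ i) * (ln (\<Phi> z t) - ln (\<Phi> (z - axis i 1) t) - (1 - \<Phi> (z - axis i 1) t / \<Phi> z t))"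
proof -
  let ?q = "\<lambda>i. \<Phi> (z - axis i 1) t / \<Phi> z t"
  note p = pos[OF t]
  have q: "ln (\<Phi> z t) - ln (\<Phi> (z - axis i 1) t) = - ln (?q i)" "0 < ?q i" for i
    using p by (auto simp: ln_div less_imp_neq[OF p, symmetric])
  show "0 \<le> real (z $ i) * (ln (\<Phi> z t) - ln (\<Phi> (z - axis i 1) t) - (1 - ?q i))"
    using ln_le_minus_one[OF q(2)[of i]] unfolding q(1) by (intro mult_nonneg_nonneg) auto
  show "0 < real (z $ i) * (ln (\<Phi> z t) - ln (\<Phi> (z - axis i 1) t) - (1 - ?q i))"
    if "\<Phi> (z - axis i 1) t \<noteq> \<Phi> z t" "z $ i \<noteq> 0"
  proof -
    have "?q i \<noteq> 1" using that p[of z] by (auto simp: divide_eq_1_iff)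
    then have "ln (?q i) < ?q i - 1"
      using ln_le_minus_one[OF q(2)[of i]] ln_eq_minus_one[OF q(2)[of i]] by linarith
    then show ?thesis using that unfolding q(1) by (intro mult_pos_pos) auto
  qed
  have "0 \<le> (1 / \<Phi> z t) * ((\<Sum>i\<in>UNIV. real (z $ i) * (\<Phi> z t - \<Phi> (z - axis i 1) t))
      + (\<Sum>i\<in>UNIV. (real (z $ i) + 1 / 2) * (\<Phi> z t - \<Phi> (z + axis i 1) t)))"
    by (intro mult_nonneg_nonneg star t) (simp add: p less_imp_le)
  also have "\<dots> = (\<Sum>i\<in>UNIV. real (z $ i) * (1 - ?q i)) + t * log_deriv z t"
    using t p[of z] by (simp add: log_deriv_def distrib_left sum_distrib_left
        diff_divide_distrib right_diff_distrib)
  finally show "(\<Sum>i\<in>UNIV. real (z $ i) * (ln (\<Phi> z t) - ln (\<Phi> (z - axis i 1) t) - (1 - ?q i))) \<le> slack z t"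
    by (simp add: slack_def right_diff_distrib sum_subtractf)
qed

lemma slack_nonneg: "0 < t \<Longrightarrow> 0 \<le> slack z t"
  by (rule order_trans[OF sum_nonneg slack_ge(1)]) (rule slack_ge(2))

lemma slack_pos:
  assumes "0 < t" "\<Phi> (z + axis i 1) t \<noteq> \<Phi> z t"
  shows "0 < slack (z + axis i 1) t"
proof -
  let ?w = "z + axis i 1"
  let ?g = "\<lambda>i. real (?w $ i) * (ln (\<Phi> ?w t) - ln (\<Phi> (?w - axis i 1) t) - (1 - \<Phi> (?w - axis i 1) t / \<Phi> ?w t))"
  have "0 < ?g i" using slack_ge(3)[OF assms(1), of ?w i] assms(2) by auto
  also have "?g i \<le> (\<Sum>i\<in>UNIV. ?g i)"
    by (rule member_le_sum[where f = ?g]) (use slack_ge(2)[OF assms(1), of ?w] in \<open>blast, simp_all\<close>)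
  also have "\<dots> \<le> slack ?w t" by (rule slack_ge(1)[OF assms(1)])
  finally show ?thesis .
qed

lemma poly_growth_log_deriv: "0 < t \<Longrightarrow> poly_growth (\<lambda>z. log_deriv z t)"
  by (rule poly_growth_mono[where q = "\<lambda>z. (1 / t) * ((real (vsum z) + real CARD('n) / 2) * (4 * real (vsum z) + 5 + real CARD('n)))"])
    (intro poly_growth_intros, rule order_trans[OF log_deriv_bound abs_ge_self])

lemma poly_growth_pred_ln:
  assumes "0 < t"
  shows "poly_growth (\<lambda>z. real (z $ i) * ln (\<Phi> (z - axis i 1) t))"
proof (rule poly_growth_mono)
  show "poly_growth (\<lambda>z. real (z $ i) * (\<bar>ln (\<Phi> 0 t)\<bar> + real (vsum z) * (4 * real (vsum z) + 4 + real CARD('n))))"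
    by (intro poly_growth_intros)
  fix z :: "nat ^ 'n"
  have "vsum (z - axis i 1) \<le> vsum z"
    unfolding vsum_def by (rule sum_mono) simp
  then have "real (vsum (z - axis i 1)) * (4 * real (vsum (z - axis i 1)) + 4 + real CARD('n))
      \<le> real (vsum z) * (4 * real (vsum z) + 4 + real CARD('n))"
    by (intro mult_mono add_mono) auto
  with ln_bound[OF assms, of "z - axis i 1"]
  have "\<bar>ln (\<Phi> (z - axis i 1) t)\<bar> \<le> \<bar>ln (\<Phi> 0 t)\<bar> + real (vsum z) * (4 * real (vsum z) + 4 + real CARD('n))"
    by linarith
  then show "\<bar>real (z $ i) * ln (\<Phi> (z - axis i 1) t)\<bar>
      \<le> \<bar>real (z $ i) * (\<bar>ln (\<Phi> 0 t)\<bar> + real (vsum z) * (4 * real (vsum z) + 4 + real CARD('n)))\<bar>"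
    unfolding abs_mult by (intro mult_left_mono) auto
qed

lemma poly_growth_slack: "0 < t \<Longrightarrow> poly_growth (\<lambda>z. slack z t)"
  unfolding slack_def right_diff_distrib
  by (intro poly_growth_intros poly_growth_ln poly_growth_pred_ln poly_growth_log_deriv)

lemma mean_log_deriv:
  assumes t: "0 < t" and l: "l \<in> pos_orthant"
  shows "(mean_log l has_real_derivative (1 / t) * poisson_mean t l (\<lambda>z. slack z t)) (at t)"
proof -
  let ?L = "\<lambda>z t. ln (\<Phi> z t)"
  let ?\<Lambda> = "\<Sum>i\<in>UNIV. l $ i"
  let ?f' = "\<lambda>z t. poisson_lik t z l * ((real (vsum z) / t - ?\<Lambda>) * ?L z t + log_deriv z t)"
  define a b where "a = t / 2" and "b = 2 * t"
  have ab: "0 < a" "a < t" "t < b" "0 < b" using t by (auto simp: a_def b_def)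
  obtain e where e: "bij_betw e (UNIV :: nat set) (UNIV :: (nat ^ 'n) set)"
    using ex_bij_nat_vec by blast
  have "continuous_on {a..b} (\<lambda>t. \<bar>?L 0 t\<bar>)"
  proof (rule continuous_on_rabs)
    show "continuous_on {a..b} (?L 0)"
      using ab by (intro DERIV_continuous_on[OF DERIV_subset[OF ln_deriv]]) auto
  qed
  then have "\<exists>x\<in>{a..b}. \<forall>y\<in>{a..b}. \<bar>?L 0 y\<bar> \<le> \<bar>?L 0 x\<bar>"
    using ab by (intro continuous_attains_sup) auto
  then obtain B where B: "\<And>y. y \<in> {a..b} \<Longrightarrow> \<bar>?L 0 y\<bar> \<le> B" by blast
  have B0: "0 \<le> B" using B[of t] ab by simp
  let ?R = "\<lambda>z::nat^'n. (real (vsum z) / a + ?\<Lambda>) * (B + real (vsum z) * (4 * real (vsum z) + 4 + real CARD('n)))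
      + (1 / a) * ((real (vsum z) + real CARD('n) / 2) * (4 * real (vsum z) + 5 + real CARD('n)))"
  have \<Lambda>: "0 \<le> ?\<Lambda>" using l by (intro sum_nonneg) (auto simp: pos_orthant_def less_imp_le)
  have "((\<lambda>t. \<Sum>\<^sub>\<infinity>z. poisson_lik t z l * ?L z t) has_real_derivative (\<Sum>\<^sub>\<infinity>z. ?f' z t)) (at t)"
  proof (rule DERIV_infsum[OF e, where a = a and b = b
        and M = "\<lambda>z. exp (b * ?\<Lambda>) * (poisson_lik b z l * ?R z)"])
    fix z :: "nat ^ 'n" and x assume x: "x \<in> {a..b}"
    then have x0: "0 < x" using ab by auto
    have "((\<lambda>x. x ^ vsum z * exp (- x * ?\<Lambda>)) has_real_derivative
       x ^ vsum z * exp (- x * ?\<Lambda>) * (real (vsum z) / x - ?\<Lambda>)) (at x)"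
    proof -
      have "real n * x ^ (n - Suc 0) = x ^ n * (real n / x)" for n
        using x0 by (cases n) auto
      moreover have "((\<lambda>x. exp (- x * ?\<Lambda>)) has_real_derivative exp (- x * ?\<Lambda>) * (- ?\<Lambda>)) (at x)"
        by (auto intro!: derivative_eq_intros)
      ultimately show ?thesis
        by (intro DERIV_cong[OF DERIV_mult[OF DERIV_pow]]) (auto simp: algebra_simps)
    qed
    then have "((\<lambda>x. poisson_lik x z l) has_real_derivative poisson_lik x z l * (real (vsum z) / x - ?\<Lambda>)) (at x)"
      unfolding poisson_lik_eq by (rule DERIV_cong[OF DERIV_cmult_right]) simp
    then have "((\<lambda>x. poisson_lik x z l * ?L z x) has_real_derivative ?f' z x) (at x)"
      by (rule DERIV_cong[OF DERIV_mult[OF _ ln_deriv[OF x0]]]) (simp add: algebra_simps)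
    then show "((\<lambda>x. poisson_lik x z l * ?L z x) has_real_derivative ?f' z x) (at x within {a..b})"
      by (rule DERIV_subset) auto
    have "\<bar>(real (vsum z) / x - ?\<Lambda>) * ?L z x + log_deriv z x\<bar> \<le> ?R z"
    proof (rule order_trans[OF abs_triangle_ineq add_mono])
      have "\<bar>real (vsum z) / x - ?\<Lambda>\<bar> \<le> real (vsum z) / x + ?\<Lambda>"
        using \<Lambda> x0 by (intro abs_leI) (auto simp: field_simps)
      also have "real (vsum z) / x + ?\<Lambda> \<le> real (vsum z) / a + ?\<Lambda>"
        using x ab by (simp add: frac_le)
      finally show "\<bar>(real (vsum z) / x - ?\<Lambda>) * ?L z x\<bar>
          \<le> (real (vsum z) / a + ?\<Lambda>) * (B + real (vsum z) * (4 * real (vsum z) + 4 + real CARD('n)))"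
        unfolding abs_mult
        using order_trans[OF ln_bound[OF x0] add_right_mono[OF B[OF x]]] ab \<Lambda>
        by (intro mult_mono) auto
      have "(1 / x) * ((real (vsum z) + real CARD('n) / 2) * (4 * real (vsum z) + 5 + real CARD('n)))
          \<le> (1 / a) * ((real (vsum z) + real CARD('n) / 2) * (4 * real (vsum z) + 5 + real CARD('n)))"
        using x ab by (intro mult_right_mono) (auto simp: frac_le)
      then show "\<bar>log_deriv z x\<bar> \<le> (1 / a) * ((real (vsum z) + real CARD('n) / 2) * (4 * real (vsum z) + 5 + real CARD('n)))"
        using log_deriv_bound[OF x0, of z] by linarith
    qed
    moreover have "poisson_lik x z l \<le> exp (b * ?\<Lambda>) * poisson_lik b z l"
    proof -
      have "x ^ vsum z * exp (- x * ?\<Lambda>) \<le> b ^ vsum z * 1"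
        using x x0 \<Lambda> by (intro mult_mono power_mono) auto
      then have "(x ^ vsum z * exp (- x * ?\<Lambda>)) * (\<Prod>i\<in>UNIV. (l $ i) ^ (z $ i) / fact (z $ i))
          \<le> b ^ vsum z * 1 * (\<Prod>i\<in>UNIV. (l $ i) ^ (z $ i) / fact (z $ i))"
        using l by (intro mult_right_mono prod_nonneg) (auto simp: pos_orthant_def less_imp_le)
      also have "\<dots> = exp (b * ?\<Lambda>) * poisson_lik b z l"
        by (simp add: poisson_lik_eq exp_minus field_simps)
      finally show ?thesis by (simp add: poisson_lik_eq)
    qed
    ultimately show "\<bar>?f' z x\<bar> \<le> exp (b * ?\<Lambda>) * (poisson_lik b z l * ?R z)"
      unfolding abs_mult mult.assoc[symmetric]
      using poisson_lik_nonneg[OF less_imp_le[OF x0] l, of z] poisson_lik_nonneg[OF less_imp_le[OF ab(4)] l, of z]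
      by (intro mult_mono) auto
  next
    show "(\<lambda>z. exp (b * ?\<Lambda>) * (poisson_lik b z l * ?R z)) summable_on UNIV"
      unfolding divide_inverse
      using ab by (intro summable_on_cmult_right poisson_summable poly_growth_intros l) auto
  next
    fix x assume "x \<in> {a..b}"
    then show "(\<lambda>z. poisson_lik x z l * ?L z x) abs_summable_on UNIV"
      using ab by (intro poisson_abs_summable l poly_growth_ln) auto
  qed (use ab in auto)
  moreover have "(\<Sum>\<^sub>\<infinity>z. ?f' z t) = (1 / t) * poisson_mean t l (\<lambda>z. slack z t)"
  proof -
    let ?P = "\<lambda>z. poisson_lik t z l"
    note S = poisson_summable[OF less_imp_le[OF t] l]
    have pl: "poly_growth (\<lambda>z. ?L z t)" by (rule poly_growth_ln[OF t])
    have "(\<Sum>\<^sub>\<infinity>z. ?f' z t) = (\<Sum>\<^sub>\<infinity>z. ?P z * ((real (vsum z) / t) * ?L z t + log_deriv z t) - ?P z * (?\<Lambda> * ?L z t))"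
      by (rule infsum_cong) (simp add: algebra_simps)
    also have "\<dots> = (\<Sum>\<^sub>\<infinity>z. ?P z * ((real (vsum z) / t) * ?L z t + log_deriv z t)) - (\<Sum>\<^sub>\<infinity>z. ?P z * (?\<Lambda> * ?L z t))"
      unfolding divide_inverse
      by (intro infsum_diff S poly_growth_intros pl poly_growth_log_deriv t)
    also have "(\<Sum>\<^sub>\<infinity>z. ?P z * (?\<Lambda> * ?L z t)) = ?\<Lambda> * poisson_mean t l (\<lambda>z. ?L z t)"
      by (simp add: poisson_mean_def mult.left_commute[of _ ?\<Lambda>] infsum_cmult_right')
    also have "\<dots> = (1 / t) * (\<Sum>i\<in>UNIV. poisson_mean t l (\<lambda>z. real (z $ i) * ?L (z - axis i 1) t))"
      using t by (subst poisson_mean_size_bias[OF t l]) (simp add: sum_distrib_left sum_distrib_right)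
    also have "\<dots> = (1 / t) * (\<Sum>\<^sub>\<infinity>z. \<Sum>i\<in>UNIV. ?P z * (real (z $ i) * ?L (z - axis i 1) t))"
      unfolding poisson_mean_def
      by (subst infsum_sum_finite(2)) (rule S[OF poly_growth_pred_ln[OF t]], rule refl)
    also have "\<dots> = (\<Sum>\<^sub>\<infinity>z. ?P z * ((1 / t) * (\<Sum>i\<in>UNIV. (real (z $ i) * ?L (z - axis i 1) t))))"
      by (simp add: infsum_cmult_right'[symmetric] sum_distrib_left mult_ac)
    also have "(\<Sum>\<^sub>\<infinity>z. ?P z * ((real (vsum z) / t) * ?L z t + log_deriv z t)) - \<dots>
      = (\<Sum>\<^sub>\<infinity>z. ?P z * ((real (vsum z) / t) * ?L z t + log_deriv z t) - ?P z * ((1 / t) * (\<Sum>i\<in>UNIV. (real (z $ i) * ?L (z - axis i 1) t))))"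
      unfolding divide_inverse
      by (intro infsum_diff[symmetric] S poly_growth_intros pl poly_growth_log_deriv poly_growth_pred_ln t)
    also have "\<dots> = (\<Sum>\<^sub>\<infinity>z. (1 / t) * (?P z * slack z t))"
      using t by (intro infsum_cong)
        (simp add: slack_def vsum_def field_simps sum_subtractf sum_distrib_left sum_distrib_right)
    finally show ?thesis by (simp only: infsum_cmult_right' poisson_mean_def)
  qed
  ultimately show ?thesis
    by (simp add: mean_log_def[abs_def] poisson_mean_def)
qed

lemma mean_slack_nonneg:
  assumes "0 < t" "l \<in> pos_orthant"
  shows "0 \<le> poisson_mean t l (\<lambda>z. slack z t)"
  unfolding poisson_mean_def
  using assms by (intro infsum_nonneg mult_nonneg_nonneg poisson_lik_nonneg slack_nonneg) auto

lemma mean_log_mono: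
  assumes r: "0 < r" "r \<le> u" and l: "l \<in> pos_orthant"
  shows "mean_log l r \<le> mean_log l u"
proof (rule DERIV_nonneg_imp_nondecreasing[OF r(2)])
  fix x assume "r \<le> x" "x \<le> u"
  then show "\<exists>y. (mean_log l has_real_derivative y) (at x) \<and> 0 \<le> y"
    using r l by (intro exI[of _ "(1 / x) * poisson_mean x l (\<lambda>z. slack z x)"] conjI mean_log_deriv
        mult_nonneg_nonneg mean_slack_nonneg) auto
qed

lemma mean_log_strict_mono:
  assumes r: "0 < r" "r < u" and l: "l \<in> pos_orthant" and nc: "\<nexists>c. \<forall>z. \<Phi> z r = c"
  shows "mean_log l r < mean_log l u"
proof -
  have "\<exists>z i. \<Phi> (z + axis i 1) r \<noteq> \<Phi> z r"
  proof (rule ccontr)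
    assume *: "\<not> ?thesis"
    have "\<Phi> z r = \<Phi> 0 r" for z
      using * by (induction z rule: nat_vec_induct) auto
    with nc show False by blast
  qed
  then obtain z i where "\<Phi> (z + axis i 1) r \<noteq> \<Phi> z r" by blast
  then have sp: "0 < slack (z + axis i 1) r" by (rule slack_pos[OF r(1)])
  have "0 < poisson_lik r (z + axis i 1) l * slack (z + axis i 1) r"
    using sp poisson_lik_pos[OF r(1) l] by simp
  also have "\<dots> = (\<Sum>\<^sub>\<infinity>w\<in>{z + axis i 1}. poisson_lik r w l * slack w r)" by simp
  also have "\<dots> \<le> poisson_mean r l (\<lambda>z. slack z r)"
    unfolding poisson_mean_def
    using r l by (intro infsum_mono2 summable_on_finite poisson_summable poly_growth_slack)
      (auto intro!: mult_nonneg_nonneg poisson_lik_nonneg slack_nonneg)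
  finally have "0 < (1 / r) * poisson_mean r l (\<lambda>z. slack z r)" using r by simp
  then obtain e where e: "0 < e" "\<And>h. 0 < h \<Longrightarrow> h < e \<Longrightarrow> mean_log l r < mean_log l (r + h)"
    using DERIV_pos_inc_right[OF mean_log_deriv[OF r(1) l]] by blast
  define h where "h = min (e / 2) (u - r)"
  have "mean_log l r < mean_log l (r + h)" using e r by (intro e(2)) (auto simp: h_def)
  also have "\<dots> \<le> mean_log l u" using e r l by (intro mean_log_mono) (auto simp: h_def)
  finally show ?thesis .
qed

end

section \<open>The Kullback--Leibler risk as a Poisson expectation\<close>

lemma ext_sum_ereal:
  fixes g :: "'a \<Rightarrow> real"
  assumes "g abs_summable_on UNIV"
  shows "ext_sum (\<lambda>a. ereal (g a)) = ereal (infsum g UNIV)"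
proof -
  have int: "integrable (count_space UNIV) g"
    using assms[unfolded abs_summable_equivalent] by (simp only: Infinite_Set_Sum.abs_summable_on_def)
  have fin: "(\<integral>\<^sup>+a. ennreal (g a) \<partial>count_space UNIV) < \<infinity>" "(\<integral>\<^sup>+a. ennreal (- g a) \<partial>count_space UNIV) < \<infinity>"
    using integrableD(2)[OF int] integrableD(3)[OF int] by (auto simp: less_top)
  have "ext_sum (\<lambda>a. ereal (g a)) = enn2ereal (\<integral>\<^sup>+a. ennreal (g a) \<partial>count_space UNIV)
     - enn2ereal (\<integral>\<^sup>+a. ennreal (- g a) \<partial>count_space UNIV)"
    by (simp add: ext_sum_def e2ennreal_ereal)
  also have "\<dots> = ereal (integral\<^sup>L (count_space UNIV) g)"
    unfolding real_lebesgue_integral_def[OF int]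
    using fin[unfolded infinity_ennreal_def, THEN less_top_ennreal[THEN iffD1]]
    by (auto simp: enn2ereal_ennreal)
  also have "integral\<^sup>L (count_space UNIV) g = infsum g UNIV"
    using infsetsum_infsum[OF assms[unfolded abs_summable_equivalent]] by (simp add: infsetsum_def)
  finally show ?thesis .
qed

lemma poisson_mean_const:
  fixes l :: "real ^ 'n"
  shows "poisson_mean t l (\<lambda>_. c) = c"
proof -
  let ?e = "\<lambda>i n. (t * l $ i) ^ n / fact n * exp (- t * l $ i)"
  have 1: "((\<lambda>n. norm (?e i n)) summable_on UNIV)" for i
  proof -
    have "summable (\<lambda>n. norm ((t * l $ i) ^ n / fact n) * norm (exp (- t * l $ i)))"
      using summable_norm_exp[of "t * l $ i"]
      by (intro summable_mult2) (simp add: divide_inverse mult.commute)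
    then show ?thesis
      by (subst summable_on_UNIV_nonneg_real_iff) (auto simp: abs_mult)
  qed
  have 2: "infsum (?e i) UNIV = 1" for i
  proof -
    have "(\<lambda>n. (t * l $ i) ^ n /\<^sub>R fact n * exp (- t * l $ i)) sums (exp (t * l $ i) * exp (- t * l $ i))"
      by (intro sums_mult2 exp_converges)
    moreover have "(\<lambda>n. (t * l $ i) ^ n /\<^sub>R fact n * exp (- t * l $ i)) = ?e i"
      by (rule ext) (simp add: divide_inverse)
    moreover have "exp (t * l $ i) * exp (- t * l $ i) = 1" by (simp flip: exp_add)
    ultimately have "?e i sums 1" by metis
    moreover have "?e i sums infsum (?e i) UNIV"
      by (rule has_sum_imp_sums[OF has_sum_infsum[OF abs_summable_summable[OF 1]]])
    ultimately show ?thesis using sums_unique2 by blast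
  qed
  have "poisson_mean t l (\<lambda>_. c) = (\<Sum>\<^sub>\<infinity>z. \<Prod>i\<in>UNIV. ?e i (z $ i)) * c"
    by (simp add: poisson_mean_def poisson_lik_def infsum_cmult_left')
  also have "(\<Sum>\<^sub>\<infinity>z. \<Prod>i\<in>UNIV. ?e i (z $ i)) = (\<Sum>\<^sub>\<infinity>g\<in>PiE UNIV (\<lambda>_. UNIV). \<Prod>i\<in>UNIV. ?e i (g i))"
    using infsum_reindex_bij_betw[OF bij_betw_vec_lambda_PiE[of "\<lambda>_. UNIV"], of "\<lambda>z. \<Prod>i\<in>UNIV. ?e i (z $ i)"]
    by simp
  also have "\<dots> = (\<Prod>i\<in>UNIV. infsum (?e i) UNIV)"
    by (rule infsum_prod_PiE_abs) (simp_all only: finite 1)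
  finally show ?thesis by (simp only: 2 prod.neutral_const mult_1)
qed

lemma poisson_mean_add:
  assumes "0 \<le> t" "l \<in> pos_orthant" "poly_growth p" "poly_growth q"
  shows "poisson_mean t l (\<lambda>z. p z + q z) = poisson_mean t l p + poisson_mean t l q"
  unfolding poisson_mean_def distrib_left
  by (intro infsum_add poisson_summable assms)

lemma poisson_mean_diff:
  assumes "0 \<le> t" "l \<in> pos_orthant" "poly_growth p" "poly_growth q"
  shows "poisson_mean t l (\<lambda>z. p z - q z) = poisson_mean t l p - poisson_mean t l q"
  unfolding poisson_mean_def right_diff_distrib
  by (intro infsum_diff poisson_summable assms)

lemma KL_risk_split:
  fixes l :: "real ^ 'n"
  assumes r: "0 < r" and s: "0 < s" and l: "l \<in> pos_orthant"
    and ABC: "poly_growth A" "poly_growth B" "poly_growth C"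
    and q: "\<And>x y. 0 < q x y"
    and eq: "\<And>x y. ln (poisson_lik s y l / q x y) = A x + B y + C (x + y)"
  shows "KL_risk r s q l = ereal (poisson_mean r l A + poisson_mean s l B + poisson_mean (r + s) l C)"
proof -
  note rs = less_imp_le[OF r] less_imp_le[OF s]
  let ?C = "\<lambda>x. poisson_mean s l (\<lambda>y. C (x + y))"
  have Cs: "poly_growth (\<lambda>y. C (x + y))" for x
    using poly_growth_shift[OF ABC(3), of x] by (simp add: add.commute)
  have inner: "ext_sum (\<lambda>y. ereal (poisson_lik s y l) * log_ratio (poisson_lik s y l) (q x y))
     = ereal (A x + poisson_mean s l B + ?C x)" for x
  proof -
    have "ext_sum (\<lambda>y. ereal (poisson_lik s y l) * log_ratio (poisson_lik s y l) (q x y))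
      = ext_sum (\<lambda>y. ereal (poisson_lik s y l * (A x + B y + C (x + y))))"
      by (simp add: log_ratio_def not_le[THEN iffD2, OF q] eq)
    also have "\<dots> = ereal (poisson_mean s l (\<lambda>y. A x + B y + C (x + y)))"
      unfolding poisson_mean_def
      by (intro ext_sum_ereal poisson_abs_summable rs l poly_growth_add poly_growth_const ABC Cs)
    also have "poisson_mean s l (\<lambda>y. A x + B y + C (x + y)) = A x + poisson_mean s l B + ?C x"
      by (simp add: poisson_mean_add poisson_mean_const rs l poly_growth_add poly_growth_const ABC Cs)
    finally show ?thesis .
  qed
  have AB: "poly_growth (\<lambda>x. A x + poisson_mean s l B)"
    by (intro poly_growth_intros ABC)
  have S1: "(\<lambda>x. poisson_lik r x l * (A x + poisson_mean s l B)) abs_summable_on UNIV"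
    by (intro poisson_abs_summable rs l AB)
  have S2: "(\<lambda>x. poisson_lik r x l * ?C x) abs_summable_on UNIV"
    by (rule poisson_mean_poisson_mean(2)[OF r s l ABC(3)])
  have S: "(\<lambda>x. poisson_lik r x l * (A x + poisson_mean s l B + ?C x)) abs_summable_on UNIV"
  proof (rule Infinite_Sum.abs_summable_on_comparison_test')
    show "(\<lambda>x. norm (poisson_lik r x l * (A x + poisson_mean s l B)) + norm (poisson_lik r x l * ?C x)) summable_on UNIV"
      by (intro summable_on_add S1 S2)
    show "norm (poisson_lik r x l * (A x + poisson_mean s l B + ?C x))
        \<le> norm (poisson_lik r x l * (A x + poisson_mean s l B)) + norm (poisson_lik r x l * ?C x)" for x
      unfolding distrib_left[of _ "_ + _"] by (rule norm_triangle_ineq)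
  qed
  have "KL_risk r s q l = ext_sum (\<lambda>x. ereal (poisson_lik r x l * (A x + poisson_mean s l B + ?C x)))"
    by (simp add: KL_risk_def inner)
  also have "\<dots> = ereal (\<Sum>\<^sub>\<infinity>x. poisson_lik r x l * (A x + poisson_mean s l B + ?C x))"
    by (rule ext_sum_ereal[OF S])
  also have "(\<Sum>\<^sub>\<infinity>x. poisson_lik r x l * (A x + poisson_mean s l B + ?C x))
    = poisson_mean r l (\<lambda>x. A x + poisson_mean s l B) + poisson_mean r l ?C"
    unfolding poisson_mean_def[of r] distrib_left[of _ "_ + _"]
    by (intro infsum_add abs_summable_summable[OF S1] abs_summable_summable[OF S2])
  also have "poisson_mean r l ?C = poisson_mean (r + s) l C"
    by (rule poisson_mean_poisson_mean(1)[OF r s l ABC(3)])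
  also have "poisson_mean r l (\<lambda>x. A x + poisson_mean s l B) = poisson_mean r l A + poisson_mean s l B"
    by (simp add: poisson_mean_add poisson_mean_const rs l poly_growth_const ABC)
  finally show ?thesis .
qed

lemma poly_growth_increment:
  fixes h :: "nat \<Rightarrow> real" and i :: "'n::finite"
  assumes "\<And>n. \<bar>h (Suc n) - h n\<bar> \<le> real n + 1"
  shows "poly_growth (\<lambda>z. h (z $ i))"
proof (rule poly_growth_mono)
  have *: "\<bar>h n\<bar> \<le> \<bar>h 0\<bar> + real n * real n" for n
  proof (induction n)
    case (Suc n)
    have "\<bar>h (Suc n)\<bar> \<le> \<bar>h n\<bar> + (real n + 1)" using assms[of n] by linarith
    also have "\<dots> \<le> \<bar>h 0\<bar> + real (Suc n) * real (Suc n)" using Suc by (simp add: algebra_simps)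
    finally show ?case .
  qed simp
  show "poly_growth (\<lambda>z. \<bar>h 0\<bar> + real (z $ i) * real (z $ i))"
    by (intro poly_growth_intros)
  show "\<bar>h (z $ i)\<bar> \<le> \<bar>\<bar>h 0\<bar> + real (z $ i) * real (z $ i)\<bar>" for z :: "nat ^ 'n"
    using *[of "z $ i"] by linarith
qed

lemma abs_ln_le:
  fixes x :: real
  assumes "x = real n + 1 \<or> x = real n + 1 / 2"
  shows "\<bar>ln x\<bar> \<le> real n + 1"
proof -
  have x: "1 / 2 \<le> x" using assms by auto
  have "ln x \<le> x - 1" using x by (intro ln_le_minus_one) auto
  moreover have "ln (1 / x) \<le> 1 / x - 1" using x by (intro ln_le_minus_one) auto
  moreover have "1 / x \<le> 2" using x by (simp add: field_simps)
  ultimately show ?thesis using assms x by (auto simp: ln_div)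
qed

lemma poly_growth_ln_fact: "poly_growth (\<lambda>z. ln (fact (z $ i)))"
proof (rule poly_growth_increment[where h = "\<lambda>n. ln (fact n)"])
  fix n
  have "ln (fact (Suc n) :: real) = ln (real n + 1) + ln (fact n)"
    by (simp add: ln_mult add.commute)
  then show "\<bar>ln (fact (Suc n)) - ln (fact n :: real)\<bar> \<le> real n + 1"
    using abs_ln_le[of "real n + 1" n] by simp
qed

lemma poly_growth_ln_Gamma: "poly_growth (\<lambda>z. ln (Gamma (real (z $ i) + 1 / 2)))"
proof (rule poly_growth_increment[where h = "\<lambda>n. ln (Gamma (real n + 1 / 2))"])
  fix n
  have "Gamma (real (Suc n) + 1 / 2) = (real n + 1 / 2) * Gamma (real n + 1 / 2)"
    using Gamma_plus1[of "real n + 1 / 2"] by (simp add: add_ac nonpos_Ints_def)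
  moreover have "0 < Gamma (real n + 1 / 2)" by (rule Gamma_real_pos) auto
  moreover have "0 < real n + 1 / 2" by simp
  ultimately have "ln (Gamma (real (Suc n) + 1 / 2)) = ln (real n + 1 / 2) + ln (Gamma (real n + 1 / 2))"
    by (simp only: ln_mult_pos)
  then show "\<bar>ln (Gamma (real (Suc n) + 1 / 2)) - ln (Gamma (real n + 1 / 2))\<bar> \<le> real n + 1"
    using abs_ln_le[of "real n + 1 / 2" n] by simp
qed

section \<open>Laplace transforms and the square-root map\<close>

lemma exp_remainder_bound:
  fixes x :: real
  shows "0 \<le> exp x - 1 - x" "exp x - 1 - x \<le> x\<^sup>2 * exp \<bar>x\<bar>"
proof -
  show "0 \<le> exp x - 1 - x" using exp_ge_add_one_self[of x] by linarith
  have "exp x * (1 - x) \<le> exp x * exp (- x)"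
    using exp_ge_add_one_self[of "- x"] by (intro mult_left_mono) auto
  then have 1: "exp x - 1 \<le> x * exp x" by (simp add: algebra_simps exp_minus)
  show "exp x - 1 - x \<le> x\<^sup>2 * exp \<bar>x\<bar>"
  proof (cases "0 \<le> x")
    case True
    then have "x * (exp x - 1) \<le> x * (x * exp x)" using 1 by (rule mult_left_mono[rotated])
    then show ?thesis using 1 True by (simp add: power2_eq_square algebra_simps)
  next
    case False
    then have "(- x) * (1 - exp x) \<le> (- x) * (- x)"
      using exp_ge_add_one_self[of x] by (intro mult_left_mono) linarith+
    then have "exp x - 1 - x \<le> x\<^sup>2" using 1 by (simp add: power2_eq_square algebra_simps)
    also have "\<dots> \<le> x\<^sup>2 * exp \<bar>x\<bar>" by (simp add: mult_le_cancel_left1)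
    finally show ?thesis .
  qed
qed

lemma laplace_deriv:
  fixes b u :: "'a \<Rightarrow> real"
  assumes [measurable]: "b \<in> borel_measurable M" "u \<in> borel_measurable M"
    and b: "\<And>x. 0 \<le> b x" and u: "\<And>x. b x \<noteq> 0 \<Longrightarrow> 0 \<le> u x"
    and int: "\<And>t. 0 < t \<Longrightarrow> integrable M (\<lambda>x. b x * exp (- t * u x))"
    and t: "0 < t"
  shows "integrable M (\<lambda>x. b x * u x * exp (- t * u x))"
    and "((\<lambda>t. \<integral>x. b x * exp (- t * u x) \<partial>M) has_real_derivative
           - (\<integral>x. b x * u x * exp (- t * u x) \<partial>M)) (at t)"
proof -
  have u_exp: "u x ^ k * exp (- s * u x) \<le> fact k * (2 / s) ^ k * exp (- (s / 2) * u x)"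
    if "0 < s" "b x \<noteq> 0" for x k and s :: real
  proof -
    have "(s / 2 * u x) ^ k \<le> fact k * exp (s / 2 * u x)"
      using that u by (intro poly_le_exp) auto
    then have "(2 / s) ^ k * (s / 2 * u x) ^ k * exp (- s * u x)
        \<le> (2 / s) ^ k * (fact k * exp (s / 2 * u x)) * exp (- s * u x)"
      using that by (intro mult_right_mono mult_left_mono) auto
    also have "(2 / s) ^ k * (s / 2 * u x) ^ k = u x ^ k"
      using that by (simp flip: power_mult_distrib)
    also have "(2 / s) ^ k * (fact k * exp (s / 2 * u x)) * exp (- s * u x)
        = fact k * (2 / s) ^ k * exp (- (s / 2) * u x)"
      by (simp add: mult.assoc flip: exp_add)
    finally show ?thesis .
  qed
  show int1: "integrable M (\<lambda>x. b x * u x * exp (- t * u x))"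
  proof (rule Bochner_Integration.integrable_bound)
    show "integrable M (\<lambda>x. (2 / t) * (b x * exp (- (t / 2) * u x)))"
      using int[of "t / 2"] t by (intro integrable_mult_right) simp
    show "AE x in M. norm (b x * u x * exp (- t * u x)) \<le> norm ((2 / t) * (b x * exp (- (t / 2) * u x)))"
    proof (rule AE_I2)
      fix x
      have "b x * (u x * exp (- t * u x)) \<le> b x * ((2 / t) * exp (- (t / 2) * u x))"
        using u_exp[OF t, of x 1] b[of x] by (cases "b x = 0") (auto dest: mult_left_mono[where c = "b x"])
      then show "norm (b x * u x * exp (- t * u x)) \<le> norm ((2 / t) * (b x * exp (- (t / 2) * u x)))"
        using b[of x] u[of x] t by (cases "b x = 0") (auto simp: abs_mult algebra_simps)
    qed
  qed simp
  let ?I = "\<lambda>t. \<integral>x. b x * exp (- t * u x) \<partial>M"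
  let ?D = "\<integral>x. b x * u x * exp (- t * u x) \<partial>M"
  define K where "K = (\<integral>x. 2 * (4 / t)\<^sup>2 * (b x * exp (- (t / 4) * u x)) \<partial>M)"
  have bound: "\<bar>(?I (t + h) - ?I t) / h + ?D\<bar> \<le> \<bar>h\<bar> * K" if h: "h \<noteq> 0" "\<bar>h\<bar> < t / 2" for h
  proof -
    let ?g = "\<lambda>x. b x * exp (- (t + h) * u x) - b x * exp (- t * u x) + h * (b x * u x * exp (- t * u x))"
    have ih: "integrable M (\<lambda>x. b x * exp (- (t + h) * u x))"
      using h t by (intro int) linarith
    have ig: "integrable M ?g"
      by (intro Bochner_Integration.integrable_add Bochner_Integration.integrable_diff integrable_mult_right ih int t int1)
    have iK: "integrable M (\<lambda>x. h\<^sup>2 * (2 * (4 / t)\<^sup>2 * (b x * exp (- (t / 4) * u x))))"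
      using int[of "t / 4"] t by (intro integrable_mult_right) simp
    have le: "0 \<le> ?g x" "?g x \<le> h\<^sup>2 * (2 * (4 / t)\<^sup>2 * (b x * exp (- (t / 4) * u x)))" for x
    proof -
      have g: "?g x = b x * (exp (- t * u x) * (exp (- h * u x) - 1 - (- h * u x)))"
        by (simp add: algebra_simps flip: exp_add)
      show "0 \<le> ?g x" unfolding g
        by (intro mult_nonneg_nonneg b exp_remainder_bound(1)) simp
      have "?g x \<le> b x * (exp (- t * u x) * ((- h * u x)\<^sup>2 * exp \<bar>- h * u x\<bar>))"
        unfolding g by (intro mult_left_mono b exp_remainder_bound(2)) simp
      also have "\<dots> \<le> h\<^sup>2 * (2 * (4 / t)\<^sup>2 * (b x * exp (- (t / 4) * u x)))"
      proof (cases "b x = 0")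
        case False
        then have "\<bar>- h * u x\<bar> \<le> t / 2 * u x"
          using h u[OF False] mult_right_mono[of "\<bar>h\<bar>" "t / 2" "u x"] by (simp add: abs_mult)
        then have "exp (- t * u x) * exp \<bar>- h * u x\<bar> \<le> exp (- (t / 2) * u x)"
          by (simp flip: exp_add)
        then have "(u x)\<^sup>2 * (exp (- t * u x) * exp \<bar>- h * u x\<bar>) \<le> (u x)\<^sup>2 * exp (- (t / 2) * u x)"
          by (intro mult_left_mono) auto
        also have "\<dots> \<le> 2 * (4 / t)\<^sup>2 * exp (- (t / 4) * u x)"
          using u_exp[of "t / 2" x 2] t False by simp
        finally have "(b x * h\<^sup>2) * ((u x)\<^sup>2 * (exp (- t * u x) * exp \<bar>- h * u x\<bar>))
            \<le> (b x * h\<^sup>2) * (2 * (4 / t)\<^sup>2 * exp (- (t / 4) * u x))"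
          by (intro mult_left_mono mult_nonneg_nonneg b) auto
        then show ?thesis by (simp add: power_mult_distrib mult_ac)
      qed simp
      finally show "?g x \<le> h\<^sup>2 * (2 * (4 / t)\<^sup>2 * (b x * exp (- (t / 4) * u x)))" .
    qed
    have "?I (t + h) - ?I t + h * ?D = (\<integral>x. ?g x \<partial>M)"
      unfolding Bochner_Integration.integral_add[OF Bochner_Integration.integrable_diff[OF ih int[OF t]]
          integrable_mult_right[OF int1]]
        Bochner_Integration.integral_diff[OF ih int[OF t]] by simp
    moreover have "0 \<le> (\<integral>x. ?g x \<partial>M)" by (intro integral_nonneg_AE AE_I2 le(1))
    moreover have "(\<integral>x. ?g x \<partial>M) \<le> (\<integral>x. h\<^sup>2 * (2 * (4 / t)\<^sup>2 * (b x * exp (- (t / 4) * u x))) \<partial>M)"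
      by (intro integral_mono ig iK le(2))
    moreover have "\<dots> = h\<^sup>2 * K" unfolding K_def by (rule integral_mult_right_zero)
    ultimately have "\<bar>?I (t + h) - ?I t + h * ?D\<bar> \<le> h\<^sup>2 * K" by linarith
    then have "\<bar>?I (t + h) - ?I t + h * ?D\<bar> / \<bar>h\<bar> \<le> h\<^sup>2 * K / \<bar>h\<bar>" by (rule divide_right_mono) simp
    moreover have "\<bar>?I (t + h) - ?I t + h * ?D\<bar> / \<bar>h\<bar> = \<bar>(?I (t + h) - ?I t) / h + ?D\<bar>"
      using h by (simp add: add_divide_distrib flip: abs_divide)
    moreover have "h\<^sup>2 * K / \<bar>h\<bar> = \<bar>h\<bar> * K"
      using h by (simp add: power2_eq_square abs_if)
    ultimately show ?thesis by simp
  qed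
  have "((\<lambda>h. (?I (t + h) - ?I t) / h + ?D) \<longlongrightarrow> 0) (at 0)"
  proof (rule Lim_null_comparison)
    show "((\<lambda>h. \<bar>h\<bar> * K) \<longlongrightarrow> 0) (at 0)" by (auto intro!: tendsto_eq_intros)
    have "\<forall>\<^sub>F h in at 0. h \<noteq> 0 \<and> \<bar>h\<bar> < t / 2"
      unfolding eventually_at using t by (intro exI[of _ "t / 2"]) simp
    then show "\<forall>\<^sub>F h in at 0. norm ((?I (t + h) - ?I t) / h + ?D) \<le> \<bar>h\<bar> * K"
      by eventually_elim (use bound in auto)
  qed
  then show "(?I has_real_derivative - ?D) (at t)"
    unfolding DERIV_def by (subst LIM_zero_iff[symmetric]) simp
qed

lemma open_pos_orthant: "open (pos_orthant :: (real ^ 'n) set)"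
proof -
  have "pos_orthant = (\<Inter>i. {l::real^'n. 0 < l $ i})" by (auto simp: pos_orthant_def)
  also have "open \<dots>" by (intro open_INT ballI open_Collect_less continuous_intros) auto
  finally show ?thesis .
qed

lemma closed_nonneg_orthant: "closed (nonneg_orthant :: (real ^ 'n) set)"
proof -
  have "nonneg_orthant = (\<Inter>i. {l::real^'n. 0 \<le> l $ i})" by (auto simp: nonneg_orthant_def)
  also have "closed \<dots>" by (intro closed_INT ballI closed_Collect_le continuous_intros)
  finally show ?thesis .
qed

lemma sets_orthant [measurable, simp]:
  "pos_orthant \<in> sets borel" "nonneg_orthant \<in> sets borel"
  "pos_orthant \<in> sets lebesgue" "nonneg_orthant \<in> sets lebesgue"
  by (auto simp: borel_open borel_closed open_pos_orthant closed_nonneg_orthant)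

lemma pos_subset_nonneg: "pos_orthant \<subseteq> nonneg_orthant"
  by (auto simp: pos_orthant_def nonneg_orthant_def less_imp_le)

lemma negligible_nonneg_minus_pos: "negligible (nonneg_orthant - pos_orthant :: (real ^ 'n) set)"
proof (rule negligible_subset)
  show "negligible (\<Union>i. {l::real^'n. l $ i = 0})"
    by (rule negligible_Union) (auto intro: negligible_standard_hyperplane_cart)
  show "nonneg_orthant - pos_orthant \<subseteq> (\<Union>i. {l::real^'n. l $ i = 0})"
    by (auto simp: pos_orthant_def nonneg_orthant_def order_le_less)
qed

definition vsquare :: "real ^ 'n \<Rightarrow> real ^ 'n" where
  "vsquare v = (\<chi> i. (v $ i)\<^sup>2)"

lemma vsqrt_vsquare: "v \<in> nonneg_orthant \<Longrightarrow> vsqrt (vsquare v) = v"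
  by (simp add: vsqrt_def vsquare_def nonneg_orthant_def vec_eq_iff)

lemma vsquare_vsqrt: "v \<in> nonneg_orthant \<Longrightarrow> vsquare (vsqrt v) = v"
  by (simp add: vsqrt_def vsquare_def nonneg_orthant_def vec_eq_iff)

lemma vsqrt_pos: "v \<in> pos_orthant \<Longrightarrow> vsqrt v \<in> pos_orthant"
  and vsquare_pos: "v \<in> pos_orthant \<Longrightarrow> vsquare v \<in> pos_orthant"
  by (auto simp: vsqrt_def vsquare_def pos_orthant_def less_imp_neq[symmetric])

lemma vec_differentiable_on:
  fixes h :: "real ^ 'n \<Rightarrow> real ^ 'n"
  assumes "\<And>v i. v \<in> S \<Longrightarrow> \<exists>D. ((\<lambda>v. h v $ i) has_derivative D) (at v within S)"
  shows "h differentiable_on S"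
  unfolding differentiable_on_def
proof
  fix v assume "v \<in> S"
  then obtain D where D: "\<And>i. ((\<lambda>v. h v $ i) has_derivative D i) (at v within S)"
    using assms by metis
  have "(h has_derivative (\<lambda>w. \<chi> i. D i w)) (at v within S)"
    unfolding has_derivative_componentwise_within[of h]
  proof
    fix b :: "real ^ 'n" assume "b \<in> Basis"
    then obtain i where b: "b = axis i 1" by (auto simp: Basis_vec_def)
    then show "((\<lambda>x. h x \<bullet> b) has_derivative (\<lambda>x. (\<chi> i. D i x) \<bullet> b)) (at v within S)"
      using D[of i] by (simp add: inner_axis)
  qed
  then show "h differentiable at v within S" by (auto simp: differentiable_def)
qed

lemma vsquare_differentiable_on: "vsquare differentiable_on (S :: (real ^ 'n) set)"
proof (rule vec_differentiable_on)
  fix v :: "real ^ 'n" and i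
  show "\<exists>D. ((\<lambda>v. vsquare v $ i) has_derivative D) (at v within S)"
    unfolding vsquare_def
    by (auto intro!: exI has_derivative_power bounded_linear_imp_has_derivative bounded_linear_vec_nth)
qed

lemma vsqrt_differentiable_on: "vsqrt differentiable_on pos_orthant"
proof (rule vec_differentiable_on)
  fix v :: "real ^ 'n" and i assume "v \<in> pos_orthant"
  then have v: "0 < v $ i" by (auto simp: pos_orthant_def)
  have "((\<lambda>v. sqrt (v $ i)) has_derivative (\<lambda>w. w $ i * (inverse (sqrt (v $ i)) / 2))) (at v within pos_orthant)"
    by (rule DERIV_compose_FDERIV[where f = sqrt and g = "\<lambda>v. v $ i", OF DERIV_real_sqrt[OF v]])
       (intro bounded_linear_imp_has_derivative bounded_linear_vec_nth)
  then show "\<exists>D. ((\<lambda>v. vsqrt v $ i) has_derivative D) (at v within pos_orthant)"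
    unfolding vsqrt_def by auto
qed

lemma vsqrt_comp_measurable:
  fixes f :: "real ^ 'n \<Rightarrow> ennreal"
  assumes "f \<in> borel_measurable (lebesgue_on nonneg_orthant)"
  shows "(\<lambda>l. f (vsqrt l) * indicator pos_orthant l) \<in> borel_measurable lebesgue"
proof -
  have "(\<lambda>l. f (vsqrt l)) \<in> borel_measurable (lebesgue_on pos_orthant)"
  proof (rule measurableI)
    fix B :: "ennreal set" assume "B \<in> sets borel"
    then have "f -` B \<inter> nonneg_orthant \<in> sets (lebesgue_on nonneg_orthant)"
      using measurable_sets[OF assms] by (simp add: space_restrict_space)
    then have "f -` B \<inter> nonneg_orthant \<inter> pos_orthant \<in> sets lebesgue"
      by (auto simp: sets_restrict_space)
    then have "vsquare ` (f -` B \<inter> nonneg_orthant \<inter> pos_orthant) \<in> sets lebesgue"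
      by (intro differentiable_image_in_sets_lebesgue vsquare_differentiable_on) auto
    also have "vsquare ` (f -` B \<inter> nonneg_orthant \<inter> pos_orthant) = (\<lambda>l. f (vsqrt l)) -` B \<inter> pos_orthant"
    proof (intro equalityI subsetI)
      fix l assume l: "l \<in> (\<lambda>l. f (vsqrt l)) -` B \<inter> pos_orthant"
      then have "vsqrt l \<in> pos_orthant" "vsquare (vsqrt l) = l"
        using pos_subset_nonneg vsqrt_pos vsquare_vsqrt by blast+
      then show "l \<in> vsquare ` (f -` B \<inter> nonneg_orthant \<inter> pos_orthant)"
        using l pos_subset_nonneg by (intro image_eqI[of _ _ "vsqrt l"]) auto
    next
      fix l assume "l \<in> vsquare ` (f -` B \<inter> nonneg_orthant \<inter> pos_orthant)"
      then obtain v where v: "l = vsquare v" "f v \<in> B" "v \<in> nonneg_orthant" "v \<in> pos_orthant"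
        by blast
      then show "l \<in> (\<lambda>l. f (vsqrt l)) -` B \<inter> pos_orthant"
        using vsqrt_vsquare[OF v(3)] vsquare_pos[OF v(4)] by simp
    qed
    finally show "(\<lambda>l. f (vsqrt l)) -` B \<inter> space (lebesgue_on pos_orthant) \<in> sets (lebesgue_on pos_orthant)"
      by (simp add: space_restrict_space sets_restrict_space_iff)
  qed simp
  then show ?thesis
    by (simp add: borel_measurable_restrict_space_iff_ennreal)
qed

lemma AE_vsqrt_zero:
  fixes f :: "real ^ 'n \<Rightarrow> ennreal"
  assumes "AE l in lebesgue. l \<in> pos_orthant \<longrightarrow> f (vsqrt l) = 0"
  shows "AE v in lebesgue_on nonneg_orthant. f v = 0"
proof -
  obtain N where N: "N \<in> null_sets lebesgue"
    "{l \<in> space lebesgue. \<not> (l \<in> pos_orthant \<longrightarrow> f (vsqrt l) = 0)} \<subseteq> N"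
    using assms unfolding eventually_ae_filter by blast
  have "negligible {l \<in> pos_orthant. f (vsqrt l) \<noteq> 0}"
  proof (rule negligible_subset)
    show "negligible N" using N by (simp add: negligible_iff_null_sets)
    show "{l \<in> pos_orthant. f (vsqrt l) \<noteq> 0} \<subseteq> N" using N by auto
  qed
  then have "negligible (vsqrt ` {l \<in> pos_orthant. f (vsqrt l) \<noteq> 0})"
    by (rule negligible_differentiable_image_negligible[rotated, OF _ differentiable_on_subset[OF vsqrt_differentiable_on]]) auto
  then have "negligible (vsqrt ` {l \<in> pos_orthant. f (vsqrt l) \<noteq> 0} \<union> (nonneg_orthant - pos_orthant))"
    by (rule negligible_Un[OF _ negligible_nonneg_minus_pos])
  then have "AE v in lebesgue. v \<notin> vsqrt ` {l \<in> pos_orthant. f (vsqrt l) \<noteq> 0} \<union> (nonneg_orthant - pos_orthant)"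
    unfolding negligible_iff_null_sets by (rule AE_not_in)
  then have "AE v in lebesgue. v \<in> nonneg_orthant \<longrightarrow> f v = 0"
  proof (rule AE_mp, intro AE_I2 impI)
    fix v assume v: "v \<notin> vsqrt ` {l \<in> pos_orthant. f (vsqrt l) \<noteq> 0} \<union> (nonneg_orthant - pos_orthant)" "v \<in> nonneg_orthant"
    then have "v \<in> pos_orthant" by blast
    show "f v = 0"
    proof (rule ccontr)
      assume "f v \<noteq> 0"
      then have "v \<in> vsqrt ` {l \<in> pos_orthant. f (vsqrt l) \<noteq> 0}"
        using vsqrt_vsquare[OF v(2)] vsquare_pos[OF \<open>v \<in> pos_orthant\<close>]
        by (intro image_eqI[of _ _ "vsquare v"]) auto
      with v show False by blast
    qed
  qed
  then show ?thesis by (subst AE_restrict_space_iff) auto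
qed

lemma measurable_vec_nth [measurable]: "(\<lambda>v::real ^ 'n. v $ i) \<in> borel_measurable borel"
  by (intro borel_measurable_continuous_onI continuous_intros)

lemma nn_integral_lborel_vec:
  fixes f :: "'n::finite \<Rightarrow> real \<Rightarrow> ennreal"
  assumes "\<And>i. f i \<in> borel_measurable borel"
  shows "(\<integral>\<^sup>+v. (\<Prod>i\<in>UNIV. f i (v $ i)) \<partial>(lborel :: (real ^ 'n) measure)) = (\<Prod>i\<in>UNIV. \<integral>\<^sup>+u. f i u \<partial>lborel)"
proof -
  let ?B = "Basis :: (real ^ 'n) set"
  have B: "?B = (\<lambda>i. axis i 1) ` UNIV" by (auto simp: Basis_vec_def)
  have inj: "inj (\<lambda>i. axis i (1::real) :: real ^ 'n)" by (auto simp: inj_def axis_eq_axis)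
  have "(\<integral>\<^sup>+v. (\<Prod>b\<in>?B. f (axis_index b) (v \<bullet> b)) \<partial>lborel) = (\<Prod>b\<in>?B. \<integral>\<^sup>+u. f (axis_index b) u \<partial>lborel)"
    by (rule nn_integral_lborel_prod) (auto simp: assms)
  then show ?thesis
    unfolding B by (simp add: prod.reindex[OF inj] inner_axis)
qed

section \<open>Predictive distributions in terms of F\<close>

definition gamma_weight :: "real \<Rightarrow> nat ^ 'n \<Rightarrow> real ^ 'n \<Rightarrow> real" where
  "gamma_weight t z l = (\<Prod>i\<in>UNIV. t powr (real (z $ i) + 1 / 2) * (l $ i) powr (real (z $ i) - 1 / 2)
                           * exp (- t * l $ i) / Gamma (real (z $ i) + 1 / 2))"

lemma Gamma_half_pos: "0 < Gamma (real n + 1 / 2)"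
  by (rule Gamma_real_pos) auto

lemma gamma_weight_measurable [measurable]: "gamma_weight t z \<in> borel_measurable borel"
  unfolding gamma_weight_def[abs_def] by measurable

lemma gamma_weight_nonneg: "0 \<le> gamma_weight t z l"
  unfolding gamma_weight_def
  by (intro prod_nonneg ballI divide_nonneg_nonneg mult_nonneg_nonneg) (auto simp: less_imp_le[OF Gamma_half_pos])

lemma gamma_weight_pos: "0 < t \<Longrightarrow> l \<in> pos_orthant \<Longrightarrow> 0 < gamma_weight t z l"
  unfolding gamma_weight_def pos_orthant_def
  by (intro prod_pos ballI divide_pos_pos mult_pos_pos Gamma_half_pos) (auto simp: less_le)

lemma F_fun_eq:
  "F_fun f z t = (\<integral>\<^sup>+l. (f (vsqrt l) * indicator pos_orthant l) * ennreal (gamma_weight t z l) \<partial>lebesgue)"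
  unfolding F_fun_def gamma_weight_def by (intro nn_integral_cong) (simp add: mult_ac)

lemma F_fun_one:
  fixes z :: "nat ^ 'n"
  assumes t: "0 < t"
  shows "F_fun (\<lambda>_. 1) z t = 1"
proof -
  let ?g = "\<lambda>a u. t powr a * u powr (a - 1) * exp (- t * u) / Gamma a"
  have 1: "(\<integral>\<^sup>+u. ennreal (?g a u) * indicator {0<..} u \<partial>lborel) = 1" if a: "0 < a" for a
  proof -
    let ?h = "\<lambda>x. indicator {0..} x * x powr (a - 1) / exp x :: real"
    have "ennreal (Gamma a) = (\<integral>\<^sup>+x. ennreal (?h x) \<partial>lborel)"
      using Gamma_conv_nn_integral_real[OF a] by simp
    also have "\<dots> = ennreal \<bar>t\<bar> * (\<integral>\<^sup>+u. ennreal (?h (0 + t * u)) \<partial>lborel)"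
      using t by (intro nn_integral_real_affine) auto
    finally have G: "ennreal (Gamma a) = ennreal t * (\<integral>\<^sup>+u. ennreal (?h (t * u)) \<partial>lborel)"
      using t by simp
    have "(\<integral>\<^sup>+u. ennreal (?g a u) * indicator {0<..} u \<partial>lborel)
        = (\<integral>\<^sup>+u. ennreal (t / Gamma a) * ennreal (?h (t * u)) \<partial>lborel)"
    proof (rule nn_integral_cong)
      fix u
      have "?g a u = (t / Gamma a) * ?h (t * u)" if "0 < u"
      proof -
        have "t powr a = t * t powr (a - 1)" using t by (simp add: powr_diff)
        then show ?thesis using that t
          by (simp add: powr_mult exp_minus field_simps)
      qed
      moreover have "0 \<le> ?h (t * u)" by simp
      ultimately show "ennreal (?g a u) * indicator {0<..} u = ennreal (t / Gamma a) * ennreal (?h (t * u))"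
        using t Gamma_real_pos[OF a]
        by (cases "0 < u"; cases "u = 0") (auto simp: indicator_def ennreal_mult[symmetric] zero_le_mult_iff)
    qed
    also have "\<dots> = ennreal (1 / Gamma a) * (ennreal t * (\<integral>\<^sup>+u. ennreal (?h (t * u)) \<partial>lborel))"
      using t Gamma_real_pos[OF a] by (subst nn_integral_cmult) (auto simp: ennreal_mult[symmetric] mult.assoc[symmetric])
    also have "\<dots> = 1"
      using Gamma_real_pos[OF a] by (simp add: G[symmetric] ennreal_mult[symmetric])
    finally show ?thesis .
  qed
  have "F_fun (\<lambda>_. 1) z t = (\<integral>\<^sup>+l. (\<Prod>i\<in>UNIV. ennreal (?g (real (z $ i) + 1 / 2) (l $ i)) * indicator {0<..} (l $ i)) \<partial>lebesgue)"
    unfolding F_fun_eq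
  proof (rule nn_integral_cong)
    fix l :: "real ^ 'n"
    have "ennreal (gamma_weight t z l) = (\<Prod>i\<in>UNIV. ennreal (?g (real (z $ i) + 1 / 2) (l $ i)))"
      unfolding gamma_weight_def
      by (subst prod_ennreal) (auto simp: less_imp_le[OF Gamma_half_pos] intro!: prod.cong)
    moreover have "(indicator pos_orthant l :: ennreal) = (\<Prod>i\<in>UNIV. indicator {0<..} (l $ i))"
    proof (cases "l \<in> pos_orthant")
      case False
      then obtain i where "\<not> 0 < l $ i" by (auto simp: pos_orthant_def)
      then have "indicator {0<..} (l $ i) = (0 :: ennreal)" by simp
      then have "(\<Prod>i\<in>UNIV. indicator {0<..} (l $ i)) = (0 :: ennreal)"
        by (intro prod_zero bexI[of _ i]) auto
      then show ?thesis using False by simp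
    qed (auto simp: pos_orthant_def)
    ultimately show "1 * indicator pos_orthant l * ennreal (gamma_weight t z l)
        = (\<Prod>i\<in>UNIV. ennreal (?g (real (z $ i) + 1 / 2) (l $ i)) * indicator {0<..} (l $ i))"
      by (simp add: prod.distrib mult.commute)
  qed
  also have "\<dots> = (\<Prod>i\<in>UNIV. \<integral>\<^sup>+u. ennreal (?g (real (z $ i) + 1 / 2) u) * indicator {0<..} u \<partial>lborel)"
    unfolding nn_integral_completion by (rule nn_integral_lborel_vec) measurable
  also have "\<dots> = 1" by (simp only: 1 prod.neutral_const of_nat_0_le_iff add_nonneg_pos zero_less_divide_1_iff zero_less_numeral)
  finally show ?thesis .
qed

definition pred_coeff :: "real \<Rightarrow> nat ^ 'n \<Rightarrow> real" where
  "pred_coeff t z = (\<Prod>i\<in>UNIV. t ^ (z $ i) / fact (z $ i)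
      * (Gamma (real (z $ i) + 1 / 2) / t powr (real (z $ i) + 1 / 2)))"

definition merge_coeff :: "real \<Rightarrow> real \<Rightarrow> nat ^ 'n \<Rightarrow> nat ^ 'n \<Rightarrow> real" where
  "merge_coeff r s x y = (\<Prod>i\<in>UNIV. r ^ (x $ i) * s ^ (y $ i) * fact (x $ i + y $ i)
      / (fact (x $ i) * fact (y $ i) * (r + s) ^ (x $ i + y $ i)))"

definition jeffreys_pred :: "real \<Rightarrow> real \<Rightarrow> nat ^ 'n \<Rightarrow> nat ^ 'n \<Rightarrow> real" where
  "jeffreys_pred r s x y = merge_coeff r s x y * pred_coeff (r + s) (x + y) / pred_coeff r x"

lemma pred_coeff_pos: "0 < t \<Longrightarrow> 0 < pred_coeff t z"
  unfolding pred_coeff_def by (intro prod_pos ballI mult_pos_pos divide_pos_pos) (auto simp: Gamma_half_pos)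

lemma merge_coeff_pos: "0 < r \<Longrightarrow> 0 < s \<Longrightarrow> 0 < merge_coeff r s x y"
  unfolding merge_coeff_def by (intro prod_pos ballI mult_pos_pos divide_pos_pos) auto

lemma jeffreys_pred_pos: "0 < r \<Longrightarrow> 0 < s \<Longrightarrow> 0 < jeffreys_pred r s x y"
  by (simp add: jeffreys_pred_def pred_coeff_pos merge_coeff_pos)

lemma poisson_lik_jeffreys:
  assumes t: "0 < t" and l: "l \<in> pos_orthant"
  shows "poisson_lik t z l * (\<Prod>i\<in>UNIV. (l $ i) powr (- 1 / 2)) = pred_coeff t z * gamma_weight t z l"
  unfolding poisson_lik_def pred_coeff_def gamma_weight_def prod.distrib[symmetric]
proof (rule prod.cong)
  fix i
  have li: "0 < l $ i" using l by (auto simp: pos_orthant_def)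
  have "(l $ i) powr (real (z $ i) - 1 / 2) = (l $ i) powr real (z $ i) * (l $ i) powr (- 1 / 2)"
    by (simp flip: powr_add)
  also have "(l $ i) powr real (z $ i) = (l $ i) ^ (z $ i)" using li by (rule powr_realpow)
  finally have e: "(l $ i) powr (real (z $ i) - 1 / 2) = (l $ i) ^ (z $ i) * (l $ i) powr (- 1 / 2)" .
  show "(t * l $ i) ^ z $ i * exp (- t * l $ i) / fact (z $ i) * (l $ i) powr (- 1 / 2) =
    t ^ z $ i / fact (z $ i) * (Gamma (real (z $ i) + 1 / 2) / t powr (real (z $ i) + 1 / 2)) *
    (t powr (real (z $ i) + 1 / 2) * (l $ i) powr (real (z $ i) - 1 / 2) * exp (- t * l $ i) / Gamma (real (z $ i) + 1 / 2))"
    unfolding e using t less_imp_neq[OF Gamma_half_pos[of "z $ i"]] by (simp add: power_mult_distrib)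
qed simp

lemma poisson_lik_merge:
  assumes "0 < r" "0 < s"
  shows "poisson_lik r x l * poisson_lik s y l = merge_coeff r s x y * poisson_lik (r + s) (x + y) l"
  unfolding poisson_lik_def merge_coeff_def prod.distrib[symmetric]
proof (rule prod.cong)
  fix i
  have "exp (- r * l $ i) * exp (- s * l $ i) = exp (- (r + s) * l $ i)"
    by (simp add: algebra_simps flip: exp_add)
  then show "(r * l $ i) ^ x $ i * exp (- r * l $ i) / fact (x $ i) * ((s * l $ i) ^ y $ i * exp (- s * l $ i) / fact (y $ i))
    = r ^ x $ i * s ^ y $ i * fact (x $ i + y $ i) / (fact (x $ i) * fact (y $ i) * (r + s) ^ (x $ i + y $ i)) *
      (((r + s) * l $ i) ^ (x + y) $ i * exp (- (r + s) * l $ i) / fact ((x + y) $ i))"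
    using assms by (simp only: power_mult_distrib power_add vector_add_component) (simp add: field_simps)
qed simp

locale prior_factor =
  fixes f :: "real ^ 'n \<Rightarrow> ennreal"
  assumes f_measurable: "f \<in> borel_measurable (lebesgue_on nonneg_orthant)"
    and f_nonzero: "\<not> (AE v in lebesgue_on nonneg_orthant. f v = 0)"
    and f_finite: "\<And>z t. 0 < t \<Longrightarrow> F_fun f z t < \<infinity>"
begin

definition h :: "real ^ 'n \<Rightarrow> ennreal" where
  "h l = f (vsqrt l) * indicator pos_orthant l"

definition \<Phi> :: "nat ^ 'n \<Rightarrow> real \<Rightarrow> real" where
  "\<Phi> z t = enn2real (F_fun f z t)"

lemma h_measurable [measurable]: "h \<in> borel_measurable lebesgue"
  unfolding h_def[abs_def] by (rule vsqrt_comp_measurable[OF f_measurable])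

lemma borel_lebesgue [measurable (raw)]:
  "g \<in> borel_measurable borel \<Longrightarrow> g \<in> borel_measurable (lebesgue :: (real ^ 'n) measure)"
  by (rule measurable_completion) simp

lemma F_fun_h: "F_fun f z t = (\<integral>\<^sup>+l. h l * ennreal (gamma_weight t z l) \<partial>lebesgue)"
  by (simp add: F_fun_eq h_def)

lemma weighted_h_measurable: "(\<lambda>l. h l * ennreal (gamma_weight t z l)) \<in> borel_measurable lebesgue"
  by (intro borel_measurable_times_ennreal h_measurable measurable_compose[OF borel_lebesgue measurable_ennreal]
      gamma_weight_measurable)

lemma h_finite: "AE l in lebesgue. h l = ennreal (enn2real (h l))"
proof -
  have "AE l in lebesgue. h l * ennreal (gamma_weight 1 0 l) \<noteq> \<infinity>"
    using f_finite[of 1 0] by (intro nn_integral_noteq_infinite weighted_h_measurable) (simp add: F_fun_h)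
  then show ?thesis
  proof (rule AE_mp, intro AE_I2 impI)
    fix l assume *: "h l * ennreal (gamma_weight 1 0 l) \<noteq> \<infinity>"
    show "h l = ennreal (enn2real (h l))"
    proof (cases "l \<in> pos_orthant")
      case True
      then have "h l \<noteq> \<infinity>"
        using * gamma_weight_pos[of 1 l 0] by (auto simp: ennreal_top_mult)
      then show ?thesis by (simp add: less_top)
    qed (simp add: h_def)
  qed
qed

lemma \<Phi>_integral:
  assumes t: "0 < t"
  shows "integrable lebesgue (\<lambda>l. enn2real (h l) * gamma_weight t z l)"
    and "F_fun f z t = ennreal (\<Phi> z t)"
    and "\<Phi> z t = (\<integral>l. enn2real (h l) * gamma_weight t z l \<partial>lebesgue)"
proof -
  let ?g = "\<lambda>l. enn2real (h l) * gamma_weight t z l"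
  have meas: "?g \<in> borel_measurable lebesgue"
    by (intro borel_measurable_times borel_measurable_enn2real h_measurable borel_lebesgue gamma_weight_measurable)
  have "F_fun f z t = (\<integral>\<^sup>+l. ennreal (?g l) \<partial>lebesgue)"
    unfolding F_fun_h
  proof (rule nn_integral_cong_AE)
    show "AE l in lebesgue. h l * ennreal (gamma_weight t z l) = ennreal (?g l)"
      using h_finite by eventually_elim (metis ennreal_mult enn2real_nonneg gamma_weight_nonneg)
  qed
  then have F: "(\<integral>\<^sup>+l. ennreal (?g l) \<partial>lebesgue) = F_fun f z t" by simp
  have nn: "0 \<le> ?g l" for l by (simp add: gamma_weight_nonneg)
  show int: "integrable lebesgue ?g"
    by (rule integrableI_nonneg[OF meas]) (use nn F f_finite[OF t] in auto)
  have *: "F_fun f z t = ennreal (\<integral>l. ?g l \<partial>lebesgue)"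
    unfolding F[symmetric] by (rule nn_integral_eq_integral[OF int]) (use nn in auto)
  then show "\<Phi> z t = (\<integral>l. ?g l \<partial>lebesgue)"
    unfolding \<Phi>_def by (simp add: integral_nonneg_AE nn)
  with * show "F_fun f z t = ennreal (\<Phi> z t)" by simp
qed

lemma \<Phi>_pos:
  assumes t: "0 < t"
  shows "0 < \<Phi> z t"
proof -
  have "F_fun f z t \<noteq> 0"
  proof
    assume "F_fun f z t = 0"
    then have "AE l in lebesgue. h l * ennreal (gamma_weight t z l) = 0"
      unfolding F_fun_h by (subst (asm) nn_integral_0_iff_AE[OF weighted_h_measurable])
    then have "AE l in lebesgue. l \<in> pos_orthant \<longrightarrow> f (vsqrt l) = 0"
    proof (rule AE_mp, intro AE_I2 impI)
      fix l assume "h l * ennreal (gamma_weight t z l) = 0" "l \<in> pos_orthant"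
      then show "f (vsqrt l) = 0" using gamma_weight_pos[OF t, of l z] by (auto simp: h_def)
    qed
    then show False using AE_vsqrt_zero f_nonzero by blast
  qed
  then show ?thesis using \<Phi>_integral(2)[OF t, of z] by (metis ennreal_neg not_le)
qed

lemma \<Phi>_deriv:
  assumes t: "0 < t"
  shows "(\<Phi> z has_real_derivative
    (1 / t) * (\<Sum>i\<in>UNIV. (real (z $ i) + 1 / 2) * (\<Phi> z t - \<Phi> (z + axis i 1) t))) (at t)"
proof -
  let ?b = "\<lambda>z l. enn2real (h l) * (\<Prod>i\<in>UNIV. (l $ i) powr (real (z $ i) - 1 / 2))"
  let ?u = "\<lambda>l::real^'n. \<Sum>i\<in>UNIV. l $ i"
  let ?c = "\<lambda>z t. \<Prod>i\<in>UNIV. t powr (real (z $ i) + 1 / 2) / Gamma (real (z $ i) + 1 / 2)"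
  have c_pos: "0 < ?c z t" if "0 < t" for z :: "nat ^ 'n" and t
    using that by (intro prod_pos ballI divide_pos_pos) (auto simp: Gamma_half_pos)
  have gw: "gamma_weight t z l = ?c z t * (\<Prod>i\<in>UNIV. (l $ i) powr (real (z $ i) - 1 / 2)) * exp (- t * ?u l)"
    for z t l
    by (simp add: gamma_weight_def prod.distrib[symmetric] sum_distrib_left exp_sum sum_negf[symmetric] prod_dividef)
  have bm: "?b z \<in> borel_measurable lebesgue" for z
    by (intro borel_measurable_times borel_measurable_enn2real h_measurable borel_lebesgue) measurable
  have um: "?u \<in> borel_measurable lebesgue"
    by (intro borel_lebesgue) measurable
  have bint: "integrable lebesgue (\<lambda>l. ?b z l * exp (- t * ?u l))" if "0 < t" for z t
  proof -
    have "integrable lebesgue (\<lambda>l. (1 / ?c z t) * (enn2real (h l) * gamma_weight t z l))"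
      by (intro integrable_mult_right \<Phi>_integral(1) that)
    moreover have "(1 / c) * (k * (c * p * e)) = k * p * e" if "0 < c" for c k p e :: real
      using that by simp
    ultimately show ?thesis unfolding gw by (simp only: c_pos[OF that])
  qed
  let ?I = "\<lambda>z t. \<integral>l. ?b z l * exp (- t * ?u l) \<partial>lebesgue"
  have \<Phi>I: "\<Phi> z t = ?c z t * ?I z t" if "0 < t" for z t
    unfolding \<Phi>_integral(3)[OF that] gw
    by (subst integral_mult_right_zero[symmetric]) (simp add: mult_ac)
  have hz: "h l = 0" if "l \<notin> pos_orthant" for l using that by (simp add: h_def)
  have I': "(?I z has_real_derivative - (\<integral>l. ?b z l * ?u l * exp (- t * ?u l) \<partial>lebesgue)) (at t)"
  proof (rule laplace_deriv(2)[OF bm um _ _ bint t])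
    show "0 \<le> ?b z l" for l by (intro mult_nonneg_nonneg prod_nonneg) auto
    show "0 \<le> ?u l" if "?b z l \<noteq> 0" for l
      using that hz[of l] by (intro sum_nonneg) (force simp: pos_orthant_def less_imp_le)
  qed
  have shift: "?b (z + axis i 1) l = ?b z l * l $ i" for i l
  proof (cases "l \<in> pos_orthant")
    case True
    then have li: "0 < l $ i" by (auto simp: pos_orthant_def)
    have "(\<Prod>j\<in>UNIV. (l $ j) powr (real ((z + axis i 1) $ j) - 1 / 2))
       = (\<Prod>j\<in>UNIV. (l $ j) powr (real (z $ j) - 1 / 2) * (if j = i then l $ i else 1))"
    proof (rule prod.cong)
      fix j
      have "(l $ i) powr (real (z $ i) + 1 - 1 / 2) = (l $ i) powr (real (z $ i) - 1 / 2) * (l $ i) powr 1"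
        unfolding powr_add[symmetric] by (simp add: algebra_simps)
      then show "(l $ j) powr (real ((z + axis i 1) $ j) - 1 / 2) =
          (l $ j) powr (real (z $ j) - 1 / 2) * (if j = i then l $ i else 1)"
        using li by (auto simp: axis_def)
    qed simp
    then show ?thesis by (simp add: prod.distrib)
  qed (simp add: hz)
  have sum_I: "(\<integral>l. ?b z l * ?u l * exp (- t * ?u l) \<partial>lebesgue) = (\<Sum>i\<in>UNIV. ?I (z + axis i 1) t)"
  proof -
    have "(\<integral>l. ?b z l * ?u l * exp (- t * ?u l) \<partial>lebesgue)
       = (\<integral>l. (\<Sum>i\<in>UNIV. ?b (z + axis i 1) l * exp (- t * ?u l)) \<partial>lebesgue)"
      unfolding shift by (rule Bochner_Integration.integral_cong) (simp_all only: sum_distrib_left sum_distrib_right)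
    also have "\<dots> = (\<Sum>i\<in>UNIV. ?I (z + axis i 1) t)"
      by (intro Bochner_Integration.integral_sum bint t)
    finally show ?thesis .
  qed
  have c_shift: "?c z t * ?I (z + axis i 1) t = (real (z $ i) + 1 / 2) / t * \<Phi> (z + axis i 1) t" for i
  proof -
    have "?c (z + axis i 1) t = (\<Prod>j\<in>UNIV. (t powr (real (z $ j) + 1 / 2) / Gamma (real (z $ j) + 1 / 2))
        * (if j = i then t / (real (z $ i) + 1 / 2) else 1))"
    proof (rule prod.cong)
      fix j
      have "Gamma (real (z $ i) + 1 / 2 + 1) = (real (z $ i) + 1 / 2) * Gamma (real (z $ i) + 1 / 2)"
        by (rule Gamma_plus1) (auto simp: nonpos_Ints_def)
      moreover have "t powr (real (z $ i) + 1 / 2 + 1) = t powr (real (z $ i) + 1 / 2) * t"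
        unfolding powr_add[of t "_ + _" 1] using t by simp
      ultimately show "t powr (real ((z + axis i 1) $ j) + 1 / 2) / Gamma (real ((z + axis i 1) $ j) + 1 / 2)
        = (t powr (real (z $ j) + 1 / 2) / Gamma (real (z $ j) + 1 / 2)) * (if j = i then t / (real (z $ i) + 1 / 2) else 1)"
        by (cases "j = i") (simp_all add: axis_def add_ac)
    qed simp
    then have c1: "?c (z + axis i 1) t = ?c z t * (t / (real (z $ i) + 1 / 2))"
      unfolding prod.distrib[of "\<lambda>j. _ j / _ j"] by simp
    have aux: "c * k = a / t * (c * (t / a) * k)" if "0 < a" for a c k :: real
      using that t by simp
    show ?thesis unfolding \<Phi>I[OF t] c1 by (rule aux) simp
  qed
  have c_eq: "?c z t = t powr (real (vsum z) + real CARD('n) / 2) / (\<Prod>i\<in>UNIV. Gamma (real (z $ i) + 1 / 2))"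
    if "0 < t" for t
  proof -
    have "(\<Prod>i\<in>UNIV. t powr (real (z $ i) + 1 / 2)) = t powr (\<Sum>i\<in>UNIV. real (z $ i) + 1 / 2)"
      using that by (subst powr_sum) auto
    then show ?thesis by (simp add: prod_dividef sum.distrib vsum_def)
  qed
  let ?m = "real (vsum z) + real CARD('n) / 2"
  let ?G = "\<Prod>i\<in>UNIV. Gamma (real (z $ i) + 1 / 2)"
  have "((\<lambda>t. t powr ?m / ?G * ?I z t) has_real_derivative
      (?m * t powr (?m - 1) / ?G * ?I z t + (t powr ?m / ?G) * (- (\<Sum>i\<in>UNIV. ?I (z + axis i 1) t)))) (at t)"
    using t by (intro DERIV_cong[OF DERIV_mult[OF DERIV_cdivide[OF has_real_derivative_powr] I'[unfolded sum_I]]]) auto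
  also have "?m * t powr (?m - 1) / ?G * ?I z t + (t powr ?m / ?G) * (- (\<Sum>i\<in>UNIV. ?I (z + axis i 1) t))
    = ?m / t * \<Phi> z t - (\<Sum>i\<in>UNIV. ?c z t * ?I (z + axis i 1) t)"
    using t by (simp add: \<Phi>I c_eq powr_diff sum_distrib_left)
  also have "\<dots> = (1 / t) * (\<Sum>i\<in>UNIV. (real (z $ i) + 1 / 2) * (\<Phi> z t - \<Phi> (z + axis i 1) t))"
  proof -
    have "(\<Sum>i\<in>UNIV. (real (z $ i) + 1 / 2) * \<Phi> z t) = ?m * \<Phi> z t"
      by (simp add: vsum_def sum_distrib_right[symmetric] sum.distrib)
    then show ?thesis unfolding c_shift
      by (simp add: right_diff_distrib sum_subtractf sum_distrib_left)
  qed
  finally have D: "((\<lambda>t. t powr ?m / ?G * ?I z t) has_real_derivative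
     (1 / t) * (\<Sum>i\<in>UNIV. (real (z $ i) + 1 / 2) * (\<Phi> z t - \<Phi> (z + axis i 1) t))) (at t)" .
  show ?thesis
  proof (rule DERIV_cong_ev[OF refl _ refl, THEN iffD1, OF _ D])
    show "\<forall>\<^sub>F x in nhds t. x powr ?m / ?G * ?I z x = \<Phi> z x"
      using eventually_nhds_in_open[of "{0<..}" t] t
      by (auto elim!: eventually_mono simp: \<Phi>I c_eq)
  qed
qed

lemma pred_eq:
  assumes r: "0 < r" and s: "0 < s"
  shows "pred_fJ f r s x y = jeffreys_pred r s x y * \<Phi> (x + y) (r + s) / \<Phi> x r"
proof -
  have J: "ennreal (poisson_lik t z l) * f_jeffreys_prior f l * indicator pos_orthant l
      = ennreal (pred_coeff t z) * (h l * ennreal (gamma_weight t z l))" if "0 < t" for t z l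
  proof (cases "l \<in> pos_orthant")
    case True
    have "ennreal (poisson_lik t z l) * ennreal (\<Prod>i\<in>UNIV. (l $ i) powr (- 1 / 2))
        = ennreal (pred_coeff t z) * ennreal (gamma_weight t z l)"
      using poisson_lik_jeffreys[OF that True, of z] poisson_lik_pos[OF that True, of z]
        pred_coeff_pos[OF that, of z]
      by (simp add: ennreal_mult[symmetric] prod_nonneg gamma_weight_nonneg)
    then show ?thesis using True
      by (simp add: f_jeffreys_prior_def jeffreys_prior_def h_def mult_ac)
  qed (simp add: h_def)
  have D: "(\<integral>\<^sup>+l\<in>pos_orthant. ennreal (poisson_lik r x l) * f_jeffreys_prior f l \<partial>lebesgue)
      = ennreal (pred_coeff r x * \<Phi> x r)"
    unfolding J[OF r]
    using pred_coeff_pos[OF r, of x] \<Phi>_pos[OF r, of x]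
    by (simp add: nn_integral_cmult[OF weighted_h_measurable] F_fun_h[symmetric] \<Phi>_integral(2)[OF r] ennreal_mult)
  have rs: "0 < r + s" using r s by simp
  have N: "(\<integral>\<^sup>+l\<in>pos_orthant. ennreal (poisson_lik r x l) * ennreal (poisson_lik s y l) * f_jeffreys_prior f l \<partial>lebesgue)
      = ennreal (merge_coeff r s x y * pred_coeff (r + s) (x + y) * \<Phi> (x + y) (r + s))"
  proof -
    have "ennreal (poisson_lik r x l) * ennreal (poisson_lik s y l) * f_jeffreys_prior f l * indicator pos_orthant l
       = ennreal (merge_coeff r s x y * pred_coeff (r + s) (x + y)) * (h l * ennreal (gamma_weight (r + s) (x + y) l))" for l
    proof (cases "l \<in> pos_orthant")
      case True
      have "ennreal (poisson_lik r x l) * ennreal (poisson_lik s y l)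
          = ennreal (merge_coeff r s x y) * ennreal (poisson_lik (r + s) (x + y) l)"
        using poisson_lik_merge[OF r s] poisson_lik_pos[OF r True] poisson_lik_pos[OF s True]
          poisson_lik_pos[OF rs True] merge_coeff_pos[OF r s]
        by (metis ennreal_mult less_imp_le)
      then have "ennreal (poisson_lik r x l) * ennreal (poisson_lik s y l) * f_jeffreys_prior f l * indicator pos_orthant l
         = ennreal (merge_coeff r s x y) * (ennreal (poisson_lik (r + s) (x + y) l) * f_jeffreys_prior f l * indicator pos_orthant l)"
        by (simp add: mult_ac)
      then show ?thesis unfolding J[OF rs]
        using less_imp_le[OF pred_coeff_pos[OF rs, of "x + y"]] less_imp_le[OF merge_coeff_pos[OF r s, of x y]]
        by (simp only: ennreal_mult mult.assoc)
    qed (simp add: h_def)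
    then show ?thesis
      using pred_coeff_pos[OF rs, of "x + y"] merge_coeff_pos[OF r s, of x y] \<Phi>_pos[OF rs, of "x + y"]
      by (simp add: nn_integral_cmult[OF weighted_h_measurable] F_fun_h[symmetric] \<Phi>_integral(2)[OF rs] ennreal_mult)
  qed
  show ?thesis
    unfolding pred_fJ_def bayes_pred_def N D
    using pred_coeff_pos[OF rs, of "x + y"] merge_coeff_pos[OF r s, of x y] \<Phi>_pos[OF rs, of "x + y"]
      pred_coeff_pos[OF r, of x] \<Phi>_pos[OF r, of x]
    by (simp add: divide_ennreal jeffreys_pred_def)
qed

end

lemma prior_factor_one: "prior_factor (\<lambda>_::real ^ 'n. 1)"
proof
  show "\<not> (AE v in lebesgue_on (nonneg_orthant :: (real ^ 'n) set). (1::ennreal) = 0)"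
  proof
    assume "AE v in lebesgue_on (nonneg_orthant :: (real ^ 'n) set). (1::ennreal) = 0"
    then have "F_fun (\<lambda>_::real^'n. 1) 0 1 = 0"
    proof -
      assume "AE v in lebesgue_on (nonneg_orthant :: (real ^ 'n) set). (1::ennreal) = 0"
      then have "AE v in lebesgue. v \<in> (nonneg_orthant :: (real ^ 'n) set) \<longrightarrow> (1::ennreal) = 0"
        by (subst (asm) AE_restrict_space_iff) auto
      then have "AE l in lebesgue. (1 * indicator pos_orthant l) * ennreal (gamma_weight 1 0 (l :: real ^ 'n)) = 0"
        by (rule AE_mp) (use pos_subset_nonneg in \<open>auto intro!: AE_I2 simp: indicator_def\<close>)
      then have "(\<integral>\<^sup>+l. (1 * indicator pos_orthant l) * ennreal (gamma_weight 1 0 (l :: real ^ 'n)) \<partial>lebesgue) = (\<integral>\<^sup>+l. 0 \<partial>(lebesgue :: (real ^ 'n) measure))"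
        by (rule nn_integral_cong_AE)
      then show ?thesis by (simp add: F_fun_eq)
    qed
    then show False by (simp add: F_fun_one)
  qed
qed (auto simp: F_fun_one)

lemma pred_J_eq:
  fixes x y :: "nat ^ 'n"
  assumes r: "0 < r" and s: "0 < s"
  shows "pred_J r s x y = jeffreys_pred r s x y"
proof -
  interpret prior_factor "\<lambda>_::real ^ 'n. 1" by (rule prior_factor_one)
  have "f_jeffreys_prior (\<lambda>_. 1) = (jeffreys_prior :: real ^ 'n \<Rightarrow> ennreal)"
    by (simp add: fun_eq_iff f_jeffreys_prior_def)
  then have "pred_fJ (\<lambda>_. 1) r s x y = pred_J r s x y"
    by (simp only: pred_fJ_def pred_J_def)
  then show ?thesis
    using pred_eq[OF r s, of x y] r s by (simp add: \<Phi>_def F_fun_one)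
qed

lemma ln_mult_div_pos: "0 < a \<Longrightarrow> 0 < b \<Longrightarrow> 0 < c \<Longrightarrow> ln (a * b / c) = ln a + ln b - ln (c::real)"
  by (simp add: ln_div ln_mult)

lemma poly_growth_ln_prod:
  fixes a :: "'n::finite \<Rightarrow> nat ^ 'n \<Rightarrow> real"
  assumes "\<And>i z. 0 < a i z" "\<And>i. poly_growth (\<lambda>z. ln (a i z))"
  shows "poly_growth (\<lambda>z. ln (\<Prod>i\<in>UNIV. a i z))"
  using assms by (simp add: ln_prod less_imp_neq[symmetric] poly_growth_sum)

lemma poly_growth_ln_pow_fact: "0 < t \<Longrightarrow> poly_growth (\<lambda>z. ln (\<Prod>i\<in>UNIV. t ^ (z $ i) / fact (z $ i)))"
  by (intro poly_growth_ln_prod)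
     (auto simp: ln_div ln_realpow intro!: poly_growth_intros poly_growth_ln_fact)

lemma poly_growth_ln_pred_coeff:
  assumes t: "0 < t"
  shows "poly_growth (\<lambda>z :: nat ^ 'n. ln (pred_coeff t z))"
  unfolding pred_coeff_def
proof (rule poly_growth_ln_prod)
  fix i and z :: "nat ^ 'n"
  show "0 < t ^ z $ i / fact (z $ i) * (Gamma (real (z $ i) + 1 / 2) / t powr (real (z $ i) + 1 / 2))"
    using t Gamma_half_pos by (intro mult_pos_pos divide_pos_pos) auto
next
  fix i :: 'n
  have "ln (t ^ z $ i / fact (z $ i) * (Gamma (real (z $ i) + 1 / 2) / t powr (real (z $ i) + 1 / 2)))
    = real (z $ i) * ln t - ln (fact (z $ i)) + (ln (Gamma (real (z $ i) + 1 / 2)) - (real (z $ i) + 1 / 2) * ln t)"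
    for z :: "nat ^ 'n"
    using t Gamma_half_pos[of "z $ i"]
    by (subst ln_mult_pos, simp, simp) (simp add: ln_divide_pos ln_realpow ln_powr)
  then show "poly_growth (\<lambda>z. ln (t ^ z $ i / fact (z $ i) * (Gamma (real (z $ i) + 1 / 2) / t powr (real (z $ i) + 1 / 2))))"
    by (simp only:) (intro poly_growth_intros poly_growth_ln_fact poly_growth_ln_Gamma)
qed

lemma poly_growth_ln_poisson:
  fixes l :: "real ^ 'n"
  assumes t: "0 < t" and l: "l \<in> pos_orthant"
  shows "poly_growth (\<lambda>z. ln (poisson_lik t z l))"
  unfolding poisson_lik_def
proof (rule poly_growth_ln_prod)
  fix i and z :: "nat ^ 'n"
  have li: "0 < l $ i" for i using l by (auto simp: pos_orthant_def)
  show "0 < (t * l $ i) ^ z $ i * exp (- t * l $ i) / fact (z $ i)"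
    using t li by (intro mult_pos_pos divide_pos_pos) auto
next
  fix i :: 'n
  have li: "0 < l $ i" for i using l by (auto simp: pos_orthant_def)
  have "ln ((t * l $ i) ^ z $ i * exp (- t * l $ i) / fact (z $ i))
    = real (z $ i) * ln (t * l $ i) + (- t * l $ i) - ln (fact (z $ i))" for z :: "nat ^ 'n"
    using t li[of i] by (simp add: ln_mult_pos ln_div ln_realpow)
  then show "poly_growth (\<lambda>z. ln ((t * l $ i) ^ z $ i * exp (- t * l $ i) / fact (z $ i)))"
    by (simp only:) (intro poly_growth_intros poly_growth_ln_fact)
qed

lemma merge_coeff_eq:
  assumes "0 < r" "0 < s"
  shows "merge_coeff r s x y = (\<Prod>i\<in>UNIV. r ^ (x $ i) / fact (x $ i)) * (\<Prod>i\<in>UNIV. s ^ (y $ i) / fact (y $ i))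
    / (\<Prod>i\<in>UNIV. (r + s) ^ ((x + y) $ i) / fact ((x + y) $ i))"
  unfolding merge_coeff_def prod.distrib[symmetric] prod_dividef[symmetric]
  using assms by (intro prod.cong) (auto simp: field_simps)

context prior_factor
begin

lemma star_family_\<Phi>:
  assumes "star_condition f"
  shows "star_family \<Phi>"
proof
  fix t :: real and z :: "nat ^ 'n" assume t: "0 < t"
  have eq: "real (z $ i) * (enn2real (F_fun f z t) - enn2real (F_minus f z i t)) = real (z $ i) * (\<Phi> z t - \<Phi> (z - axis i 1) t)" for i
    by (cases "z $ i = 0") (simp_all add: F_minus_def \<Phi>_def)
  show "0 \<le> (\<Sum>i\<in>UNIV. real (z $ i) * (\<Phi> z t - \<Phi> (z - axis i 1) t))
      + (\<Sum>i\<in>UNIV. (real (z $ i) + 1 / 2) * (\<Phi> z t - \<Phi> (z + axis i 1) t))"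
    using assms[unfolded star_condition_def, rule_format, OF t, of z] unfolding eq by (simp only: \<Phi>_def)
qed (fact \<Phi>_pos \<Phi>_deriv)+

lemma KL_risk_compare:
  assumes r: "0 < r" and s: "0 < s" and star: "star_condition f" and l: "l \<in> pos_orthant"
  shows "\<exists>K. KL_risk r s (pred_J r s) l = ereal K \<and>
    KL_risk r s (pred_fJ f r s) l
      = ereal (K - (poisson_mean (r + s) l (\<lambda>z. ln (\<Phi> z (r + s))) - poisson_mean r l (\<lambda>z. ln (\<Phi> z r))))"
proof -
  interpret sf: star_family \<Phi> by (rule star_family_\<Phi>[OF star])
  have rs: "0 < r + s" using r s by simp
  let ?e = "\<lambda>t z. ln (\<Prod>i\<in>UNIV. t ^ (z $ i) / fact (z $ i)) :: real"
  let ?A = "\<lambda>x. ln (pred_coeff r x) - ?e r x"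
  let ?B = "\<lambda>y. ln (poisson_lik s y l) - ?e s y"
  let ?C = "\<lambda>z. ?e (r + s) z - ln (pred_coeff (r + s) z)"
  have epos: "0 < (\<Prod>i\<in>UNIV. t ^ (z $ i) / fact (z $ i))" if "0 < t" for t :: real and z :: "nat ^ 'n"
    using that by (intro prod_pos) auto
  have ABC: "poly_growth ?A" "poly_growth ?B" "poly_growth ?C"
    by (intro poly_growth_diff poly_growth_ln_pred_coeff poly_growth_ln_pow_fact poly_growth_ln_poisson r s rs l)+
  have L: "poly_growth (\<lambda>z. ln (\<Phi> z t))" if "0 < t" for t
    by (rule sf.poly_growth_ln[OF that])
  have eqJ: "ln (poisson_lik s y l / jeffreys_pred r s x y) = ?A x + ?B y + ?C (x + y)" for x y
  proof -
    have "ln (merge_coeff r s x y) = ?e r x + ?e s y - ?e (r + s) (x + y)"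
      unfolding merge_coeff_eq[OF r s] using epos[OF r, of x] epos[OF s, of y] epos[OF rs, of "x + y"]
      by (simp only: ln_mult_div_pos)
    moreover have "ln (jeffreys_pred r s x y) = ln (merge_coeff r s x y) + ln (pred_coeff (r + s) (x + y)) - ln (pred_coeff r x)"
      unfolding jeffreys_pred_def
      using merge_coeff_pos[OF r s, of x y] pred_coeff_pos[OF rs, of "x + y"] pred_coeff_pos[OF r, of x]
      by (simp only: ln_mult_div_pos)
    moreover have "ln (poisson_lik s y l / jeffreys_pred r s x y) = ln (poisson_lik s y l) - ln (jeffreys_pred r s x y)"
      by (rule ln_divide_pos[OF poisson_lik_pos[OF s l] jeffreys_pred_pos[OF r s]])
    ultimately show ?thesis by simp
  qed
  have J: "KL_risk r s (pred_J r s) l = ereal (poisson_mean r l ?A + poisson_mean s l ?B + poisson_mean (r + s) l ?C)"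
    by (rule KL_risk_split[OF r s l ABC]) (simp_all add: pred_J_eq r s jeffreys_pred_pos eqJ)
  have "KL_risk r s (pred_fJ f r s) l = ereal (poisson_mean r l (\<lambda>x. ?A x + ln (\<Phi> x r)) + poisson_mean s l ?B
      + poisson_mean (r + s) l (\<lambda>z. ?C z - ln (\<Phi> z (r + s))))"
  proof (rule KL_risk_split[OF r s l])
    fix x y
    show pp: "0 < pred_fJ f r s x y"
      by (simp add: pred_eq r s jeffreys_pred_pos \<Phi>_pos rs)
    have "ln (poisson_lik s y l / pred_fJ f r s x y) = ln (poisson_lik s y l) - ln (pred_fJ f r s x y)"
      by (rule ln_divide_pos[OF poisson_lik_pos[OF s l] pp])
    also have "ln (pred_fJ f r s x y) = ln (jeffreys_pred r s x y) + ln (\<Phi> (x + y) (r + s)) - ln (\<Phi> x r)"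
      unfolding pred_eq[OF r s]
      using jeffreys_pred_pos[OF r s, of x y] \<Phi>_pos[OF rs, of "x + y"] \<Phi>_pos[OF r, of x]
      by (simp only: ln_mult_div_pos)
    also have "ln (jeffreys_pred r s x y) = ln (poisson_lik s y l) - ln (poisson_lik s y l / jeffreys_pred r s x y)"
      by (simp only: ln_divide_pos[OF poisson_lik_pos[OF s l] jeffreys_pred_pos[OF r s]])
    finally show "ln (poisson_lik s y l / pred_fJ f r s x y)
        = (?A x + ln (\<Phi> x r)) + ?B y + (?C (x + y) - ln (\<Phi> (x + y) (r + s)))"
      unfolding eqJ by simp
  qed (intro poly_growth_add poly_growth_diff[of "\<lambda>z. ?C z"] ABC L r rs)+
  also have "poisson_mean r l (\<lambda>x. ?A x + ln (\<Phi> x r)) = poisson_mean r l ?A + poisson_mean r l (\<lambda>z. ln (\<Phi> z r))"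
    by (rule poisson_mean_add[OF less_imp_le[OF r] l ABC(1) L[OF r]])
  also have "poisson_mean (r + s) l (\<lambda>z. ?C z - ln (\<Phi> z (r + s)))
      = poisson_mean (r + s) l ?C - poisson_mean (r + s) l (\<lambda>z. ln (\<Phi> z (r + s)))"
    by (rule poisson_mean_diff[OF less_imp_le[OF rs] l ABC(3) L[OF rs]])
  finally show ?thesis using J
    by (intro exI[of _ "poisson_mean r l ?A + poisson_mean s l ?B + poisson_mean (r + s) l ?C"] conjI)
       (simp_all add: algebra_simps)
qed

lemma star_weakly_dominates:
  assumes r: "0 < r" and s: "0 < s" and star: "star_condition f"
  shows "weakly_dominates r s (pred_fJ f r s) (pred_J r s)"
  unfolding weakly_dominates_def
proof
  fix l :: "real ^ 'n" assume l: "l \<in> pos_orthant"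
  interpret sf: star_family \<Phi> by (rule star_family_\<Phi>[OF star])
  show "KL_risk r s (pred_fJ f r s) l \<le> KL_risk r s (pred_J r s) l"
    using KL_risk_compare[OF r s star l] sf.mean_log_mono[OF r _ l, of "r + s"] s
    unfolding sf.mean_log_def by auto
qed

lemma star_dominates:
  assumes r: "0 < r" and s: "0 < s" and star: "star_condition f" and nc: "\<nexists>c. \<forall>z. F_fun f z r = c"
  shows "dominates r s (pred_fJ f r s) (pred_J r s)"
  unfolding dominates_def
proof
  interpret sf: star_family \<Phi> by (rule star_family_\<Phi>[OF star])
  show "weakly_dominates r s (pred_fJ f r s) (pred_J r s)" by (rule star_weakly_dominates[OF r s star])
  define l :: "real ^ 'n" where "l = (\<chi> i. 1)"
  have l: "l \<in> pos_orthant" by (simp add: l_def pos_orthant_def)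
  have "\<nexists>c. \<forall>z. \<Phi> z r = c"
    using nc \<Phi>_integral(2)[OF r] by metis
  then have "sf.mean_log l r < sf.mean_log l (r + s)"
    using s by (intro sf.mean_log_strict_mono[OF r _ l]) auto
  then have "KL_risk r s (pred_fJ f r s) l < KL_risk r s (pred_J r s) l"
    using KL_risk_compare[OF r s star l] unfolding sf.mean_log_def by auto
  then show "\<exists>l\<in>pos_orthant. KL_risk r s (pred_fJ f r s) l < KL_risk r s (pred_J r s) l"
    using l by blast
qed

end

section \<open>A divergence inequality on the orthant\<close>

lemma half_line_divergence:
  fixes H W :: "real \<Rightarrow> real"
  assumes deriv: "\<And>x. a \<le> x \<Longrightarrow> (H has_vector_derivative W x) (at x within {a..})"
    and cont: "continuous_on {a..} W" and Ha: "0 \<le> H a"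
    and iH: "integrable lborel (\<lambda>x. indicator {a..} x * H x)"
    and iW: "integrable lborel (\<lambda>x. indicator {a..} x * W x)"
  shows "(\<integral>x. indicator {a..} x * W x \<partial>lborel) \<le> 0"
proof (rule ccontr)
  let ?L = "\<integral>x. indicator {a..} x * W x \<partial>lborel"
  assume "\<not> ?L \<le> 0"
  then have L: "0 < ?L" by simp
  have FTC: "(\<integral>x. indicator {..b} x *\<^sub>R (indicator {a..} x * W x) \<partial>lborel) = H b - H a" if "a \<le> b" for b
  proof -
    have "(\<integral>x. indicator {..b} x *\<^sub>R (indicator {a..} x * W x) \<partial>lborel) = (\<integral>x. indicator {a..b} x *\<^sub>R W x \<partial>lborel)"
      by (rule Bochner_Integration.integral_cong) (auto simp: indicator_def)
    also have "\<dots> = H b - H a"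
      using that by (intro integral_FTC_Icc has_vector_derivative_within_subset[OF deriv]
          continuous_on_subset[OF cont]) auto
    finally show ?thesis .
  qed
  have "((\<lambda>b. \<integral>x. indicator {..b} x *\<^sub>R (indicator {a..} x * W x) \<partial>lborel) \<longlongrightarrow> ?L) at_top"
    by (rule tendsto_integral_at_top[OF _ iW]) simp
  then have "eventually (\<lambda>b. ?L / 2 < (\<integral>x. indicator {..b} x *\<^sub>R (indicator {a..} x * W x) \<partial>lborel)) at_top"
    using L by (intro order_tendstoD(1)) auto
  then obtain b0 where b0: "\<And>b. b0 \<le> b \<Longrightarrow> ?L / 2 < (\<integral>x. indicator {..b} x *\<^sub>R (indicator {a..} x * W x) \<partial>lborel)"
    unfolding eventually_at_top_linorder by blast
  define b where "b = max a b0"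
  have Hb: "?L / 2 < H x" if "b \<le> x" for x
    using b0[of x] FTC[of x] Ha that by (simp add: b_def)
  have iabs: "integrable lborel (\<lambda>x. \<bar>indicator {a..} x * H x\<bar>)" using iH by (rule integrable_abs)
  have bound: "?L / 2 * real n \<le> (\<integral>x. \<bar>indicator {a..} x * H x\<bar> \<partial>lborel)" for n
  proof -
    have "?L / 2 * real n = (\<integral>x. ?L / 2 * indicator {b..b + real n} x \<partial>lborel)"
      by (simp add: measure_lborel_Icc)
    also have "\<dots> \<le> (\<integral>x. \<bar>indicator {a..} x * H x\<bar> \<partial>lborel)"
    proof (intro integral_mono iabs)
      fix x show "?L / 2 * indicator {b..b + real n} x \<le> \<bar>indicator {a..} x * H x\<bar>"
        using Hb[of x] by (auto simp: indicator_def b_def)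
    qed (simp add: emeasure_lborel_Icc_eq)
    finally show ?thesis .
  qed
  obtain n where "(\<integral>x. \<bar>indicator {a..} x * H x\<bar> \<partial>lborel) / (?L / 2) < real n"
    using reals_Archimedean2 by blast
  then have "(\<integral>x. \<bar>indicator {a..} x * H x\<bar> \<partial>lborel) < ?L / 2 * real n"
    using L by (simp add: pos_divide_less_eq mult.commute)
  with bound[of n] show False by simp
qed

text \<open>Integration along the lines in direction i without splitting the index type: lines are
  parametrised redundantly by all starting points in a slab of width one.\<close>

lemma nn_integral_lines:
  fixes \<psi> :: "real ^ 'n \<Rightarrow> ennreal"
  assumes [measurable]: "\<psi> \<in> borel_measurable borel"
  shows "(\<integral>\<^sup>+x. \<integral>\<^sup>+v. indicator {0..1} (x $ i) * \<psi> (x + v *\<^sub>R axis i 1) \<partial>lborel \<partial>lborel) = (\<integral>\<^sup>+x. \<psi> x \<partial>lborel)"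
proof -
  have "(\<integral>\<^sup>+x. \<integral>\<^sup>+v. indicator {0..1} (x $ i) * \<psi> (x + v *\<^sub>R axis i 1) \<partial>lborel \<partial>lborel)
      = (\<integral>\<^sup>+v. \<integral>\<^sup>+x. indicator {0..1} (x $ i) * \<psi> (x + v *\<^sub>R axis i 1) \<partial>lborel \<partial>lborel)"
    by (rule lborel_pair.Fubini'[symmetric]) measurable
  also have "\<dots> = (\<integral>\<^sup>+v. \<integral>\<^sup>+x. indicator {0..1} (x $ i - v) * \<psi> x \<partial>lborel \<partial>lborel)"
  proof (rule nn_integral_cong)
    fix v :: real
    let ?c = "v *\<^sub>R axis i 1 :: real ^ 'n"
    have "(\<integral>\<^sup>+x. indicator {0..1} (x $ i - v) * \<psi> x \<partial>lborel)
        = (\<integral>\<^sup>+x. indicator {0..1} (x $ i - v) * \<psi> x \<partial>distr lborel borel ((+) ?c))"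
      by (simp add: lborel_distr_plus)
    also have "\<dots> = (\<integral>\<^sup>+x. indicator {0..1} (x $ i) * \<psi> (x + ?c) \<partial>lborel)"
      by (subst nn_integral_distr) (auto simp: axis_def add.commute)
    finally show "(\<integral>\<^sup>+x. indicator {0..1} (x $ i) * \<psi> (x + ?c) \<partial>lborel)
      = (\<integral>\<^sup>+x. indicator {0..1} (x $ i - v) * \<psi> x \<partial>lborel)" ..
  qed
  also have "\<dots> = (\<integral>\<^sup>+x. \<integral>\<^sup>+v. indicator {0..1} (x $ i - v) * \<psi> x \<partial>lborel \<partial>lborel)"
    by (rule lborel_pair.Fubini') measurable
  also have "\<dots> = (\<integral>\<^sup>+x. \<psi> x \<partial>lborel)"
  proof (rule nn_integral_cong)
    fix x :: "real ^ 'n"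
    have "(\<integral>\<^sup>+v. indicator {0..1} (x $ i - v) * \<psi> x \<partial>lborel) = (\<integral>\<^sup>+v. \<psi> x * indicator {x $ i - 1..x $ i} v \<partial>lborel)"
      by (rule nn_integral_cong) (auto simp: indicator_def)
    also have "\<dots> = \<psi> x" by (subst nn_integral_cmult_indicator) auto
    finally show "(\<integral>\<^sup>+v. indicator {0..1} (x $ i - v) * \<psi> x \<partial>lborel) = \<psi> x" .
  qed
  finally show ?thesis .
qed

lemma orthant_divergence:
  fixes H W :: "real ^ 'n \<Rightarrow> real"
  assumes cH: "continuous_on nonneg_orthant H" and cW: "continuous_on nonneg_orthant W"
    and deriv: "\<And>v. v \<in> nonneg_orthant \<Longrightarrow>
      ((\<lambda>h. H (v + h *\<^sub>R axis i 1)) has_vector_derivative W v) (at 0 within orthant_line i v)"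
    and bd: "\<And>v. v \<in> nonneg_orthant \<Longrightarrow> v $ i = 0 \<Longrightarrow> 0 \<le> H v"
    and iH: "integrable lborel (\<lambda>v. indicator nonneg_orthant v * H v)"
    and iW: "integrable lborel (\<lambda>v. indicator nonneg_orthant v * W v)"
  shows "(\<integral>v. indicator nonneg_orthant v * W v \<partial>lborel) \<le> 0"
proof -
  let ?N = "nonneg_orthant :: (real ^ 'n) set"
  let ?e = "axis i 1 :: real ^ 'n"
  define w where "w v = indicator ?N v * W v" for v
  define k where "k v = indicator ?N v * H v" for v
  have wm [measurable]: "w \<in> borel_measurable borel" and km [measurable]: "k \<in> borel_measurable borel"
    unfolding w_def[abs_def] k_def[abs_def]
    using borel_measurable_continuous_on_indicator[OF _ cW] borel_measurable_continuous_on_indicator[OF _ cH]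
    by (simp_all add: scaleR_conv_of_real)
  have fin_lines: "AE x in lborel. (\<integral>\<^sup>+v. indicator {0..1} (x $ i) * ennreal \<bar>p (x + v *\<^sub>R ?e)\<bar> \<partial>lborel) \<noteq> \<infinity>"
    if [measurable]: "p \<in> borel_measurable borel" and p: "integrable lborel p" for p
  proof (rule nn_integral_noteq_infinite)
    have "(\<integral>\<^sup>+x. \<integral>\<^sup>+v. indicator {0..1} (x $ i) * ennreal \<bar>p (x + v *\<^sub>R ?e)\<bar> \<partial>lborel \<partial>lborel) = (\<integral>\<^sup>+x. ennreal \<bar>p x\<bar> \<partial>lborel)"
      by (rule nn_integral_lines[where \<psi> = "\<lambda>x. ennreal \<bar>p x\<bar>"]) measurable
    also have "\<dots> < \<infinity>" using p by (simp add: integrable_iff_bounded)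
    finally show "(\<integral>\<^sup>+x. \<integral>\<^sup>+v. indicator {0..1} (x $ i) * ennreal \<bar>p (x + v *\<^sub>R ?e)\<bar> \<partial>lborel \<partial>lborel) \<noteq> \<infinity>"
      by simp
  qed measurable
  have line: "(\<integral>\<^sup>+v. ennreal (w (x + v *\<^sub>R ?e)) \<partial>lborel) \<le> (\<integral>\<^sup>+v. ennreal (- w (x + v *\<^sub>R ?e)) \<partial>lborel)"
    if fw: "(\<integral>\<^sup>+v. ennreal \<bar>w (x + v *\<^sub>R ?e)\<bar> \<partial>lborel) \<noteq> \<infinity>"
      and fk: "(\<integral>\<^sup>+v. ennreal \<bar>k (x + v *\<^sub>R ?e)\<bar> \<partial>lborel) \<noteq> \<infinity>" for x
  proof (cases "\<forall>j. j \<noteq> i \<longrightarrow> 0 \<le> x $ j")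
    case False
    then have "w (x + v *\<^sub>R ?e) = 0" for v
      by (auto simp: w_def nonneg_orthant_def axis_def indicator_def)
    then show ?thesis by simp
  next
    case True
    define a where "a = - x $ i"
    have mem: "x + v *\<^sub>R ?e \<in> ?N \<longleftrightarrow> a \<le> v" for v
      using True by (auto simp: nonneg_orthant_def axis_def a_def)
    have ind: "indicator ?N (x + v *\<^sub>R ?e) = (indicator {a..} v :: real)" for v
      by (simp add: indicator_def mem)
    have iw: "integrable lborel (\<lambda>v. w (x + v *\<^sub>R ?e))" and ik: "integrable lborel (\<lambda>v. k (x + v *\<^sub>R ?e))"
      using fw fk by (auto simp: integrable_iff_bounded less_top)
    have "(\<integral>v. indicator {a..} v * W (x + v *\<^sub>R ?e) \<partial>lborel) \<le> 0"
    proof (rule half_line_divergence)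
      show "integrable lborel (\<lambda>v. indicator {a..} v * H (x + v *\<^sub>R ?e))"
        using ik by (simp add: k_def ind)
      show "integrable lborel (\<lambda>v. indicator {a..} v * W (x + v *\<^sub>R ?e))"
        using iw by (simp add: w_def ind)
      show "continuous_on {a..} (\<lambda>v. W (x + v *\<^sub>R ?e))"
        by (rule continuous_on_compose2[OF cW]) (auto intro!: continuous_intros simp: mem)
      show "0 \<le> H (x + a *\<^sub>R ?e)"
        using mem[of a] by (intro bd) (simp_all add: a_def)
      fix u assume u: "a \<le> u"
      let ?v = "x + u *\<^sub>R ?e"
      have "((\<lambda>h. H (?v + h *\<^sub>R ?e)) has_vector_derivative W ?v) (at 0 within orthant_line i ?v)"
        using u by (intro deriv) (simp add: mem)
      moreover have "orthant_line i ?v = (\<lambda>y. y - u) ` {a..}"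
      proof -
        have "?v + h *\<^sub>R ?e = x + (u + h) *\<^sub>R ?e" for h by (simp add: algebra_simps)
        then have "orthant_line i ?v = {h. a \<le> u + h}"
          unfolding orthant_line_def by (simp only: mem)
        also have "\<dots> = (\<lambda>y. y - u) ` {a..}"
        proof (intro equalityI subsetI)
          fix h assume "h \<in> {h. a \<le> u + h}"
          then show "h \<in> (\<lambda>y. y - u) ` {a..}" by (intro image_eqI[of _ _ "u + h"]) auto
        qed auto
        finally show ?thesis .
      qed
      ultimately have "((\<lambda>h. H (?v + h *\<^sub>R ?e)) has_vector_derivative W ?v) (at (u - u) within (\<lambda>y. y - u) ` {a..})"
        by simp
      then have "((\<lambda>h. H (?v + h *\<^sub>R ?e)) \<circ> (\<lambda>y. y - u) has_vector_derivative (1 *\<^sub>R W ?v)) (at u within {a..})"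
        by (intro vector_diff_chain_within) (auto intro!: derivative_eq_intros)
      then show "((\<lambda>v. H (x + v *\<^sub>R ?e)) has_vector_derivative W ?v) (at u within {a..})"
        by (simp add: o_def algebra_simps)
    qed
    then have "(\<integral>v. w (x + v *\<^sub>R ?e) \<partial>lborel) \<le> 0" by (simp add: w_def ind)
    then have "enn2real (\<integral>\<^sup>+v. ennreal (w (x + v *\<^sub>R ?e)) \<partial>lborel) \<le> enn2real (\<integral>\<^sup>+v. ennreal (- w (x + v *\<^sub>R ?e)) \<partial>lborel)"
      by (simp add: real_lebesgue_integral_def[OF iw])
    then show ?thesis
      using integrableD(2,3)[OF iw] by (metis enn2real_mono enn2real_nonneg ennreal_enn2real ennreal_leI infinity_ennreal_def less_top)
  qed
  have lines_w: "(\<integral>\<^sup>+x. ennreal (p x) \<partial>lborel) = (\<integral>\<^sup>+x. \<integral>\<^sup>+v. indicator {0..1} (x $ i) * ennreal (p (x + v *\<^sub>R ?e)) \<partial>lborel \<partial>lborel)"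
    if [measurable]: "p \<in> borel_measurable borel" for p
    by (rule nn_integral_lines[symmetric, where \<psi> = "\<lambda>x. ennreal (p x)"]) measurable
  have iw: "integrable lborel w" using iW by (simp add: w_def[abs_def])
  have ik: "integrable lborel k" using iH by (simp add: k_def[abs_def])
  have "(\<integral>\<^sup>+x. ennreal (w x) \<partial>lborel) \<le> (\<integral>\<^sup>+x. ennreal (- w x) \<partial>lborel)"
    unfolding lines_w[OF wm] lines_w[OF borel_measurable_uminus[OF wm]]
  proof (rule nn_integral_mono_AE)
    show "AE x in lborel. (\<integral>\<^sup>+v. indicator {0..1} (x $ i) * ennreal (w (x + v *\<^sub>R ?e)) \<partial>lborel)
        \<le> (\<integral>\<^sup>+v. indicator {0..1} (x $ i) * ennreal (- w (x + v *\<^sub>R ?e)) \<partial>lborel)"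
      using fin_lines[OF wm iw] fin_lines[OF km ik]
    proof (eventually_elim)
      case (elim x)
      show ?case
      proof (cases "x $ i \<in> {0..1}")
        case True
        then show ?thesis using line[of x] elim by simp
      qed simp
    qed
  qed
  then have "(\<integral>v. w v \<partial>lborel) \<le> 0"
    unfolding real_lebesgue_integral_def[OF iw]
    using integrableD(2,3)[OF iw] by (simp add: enn2real_mono less_top)
  then show ?thesis by (simp add: w_def)
qed

section \<open>The substitution of squares\<close>

lemma DERIV_signed_square: "((\<lambda>u::real. u * \<bar>u\<bar>) has_real_derivative 2 * \<bar>u\<bar>) (at u)"
proof (cases "u = 0")
  case True
  have "((\<lambda>h::real. \<bar>h\<bar>) \<longlongrightarrow> 0) (at 0)" by (auto intro!: tendsto_eq_intros)
  then have "((\<lambda>h::real. ((0 + h) * \<bar>0 + h\<bar> - 0 * \<bar>0\<bar>) / h) \<longlongrightarrow> 0) (at 0)"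
    by (rule Lim_transform_eventually) (auto simp: eventually_at_filter)
  then show ?thesis using True by (simp add: DERIV_def)
next
  case False
  then have "u < 0 \<or> 0 < u" by auto
  then show ?thesis
  proof
    assume u: "0 < u"
    have "((\<lambda>u. u * u) has_real_derivative 2 * \<bar>u\<bar>) (at u)"
      using u by (auto intro!: derivative_eq_intros)
    then show ?thesis
      by (rule has_field_derivative_transform_within_open[where S = "{0<..}"]) (use u in auto)
  next
    assume u: "u < 0"
    have "((\<lambda>u. - (u * u)) has_real_derivative 2 * \<bar>u\<bar>) (at u)"
      using u by (auto intro!: derivative_eq_intros)
    then show ?thesis
      by (rule has_field_derivative_transform_within_open[where S = "{..<0}"]) (use u in auto)
  qed
qed

lemma nn_integral_signed_square:
  fixes a b :: real
  assumes "a \<le> b"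
  shows "(\<integral>\<^sup>+u. ennreal (2 * \<bar>u\<bar>) * indicator {a<..<b} (u * \<bar>u\<bar>) \<partial>lborel) = ennreal (b - a)"
proof -
  define \<sigma> where "\<sigma> x = sgn x * sqrt \<bar>x\<bar>" for x :: real
  have \<sigma>: "\<sigma> x * \<bar>\<sigma> x\<bar> = x" for x
    by (auto simp: \<sigma>_def abs_mult sgn_if)
  have mono: "u * \<bar>u\<bar> < v * \<bar>v\<bar> \<longleftrightarrow> u < v" for u v :: real
  proof -
    have *: "u * \<bar>u\<bar> < v * \<bar>v\<bar>" if "u < v" for u v :: real
    proof (cases "0 \<le> u")
      case True
      then show ?thesis using that by (simp add: mult_strict_mono')
    next
      case False
      then have u: "u * \<bar>u\<bar> < 0" using mult_neg_pos[of u "\<bar>u\<bar>"] by simp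
      show ?thesis
      proof (cases "0 \<le> v")
        case True
        then show ?thesis using u by (meson less_le_trans mult_nonneg_nonneg abs_ge_zero)
      next
        case False
        then have "(- v) * (- v) < (- u) * (- u)" using that by (intro mult_strict_mono') auto
        then show ?thesis using False \<open>\<not> 0 \<le> u\<close> by (simp add: abs_if)
      qed
    qed
    show ?thesis using *[of u v] *[of v u] by (cases u v rule: linorder_cases) auto
  qed
  have iff: "u * \<bar>u\<bar> \<in> {a<..<b} \<longleftrightarrow> u \<in> {\<sigma> a<..<\<sigma> b}" for u
    using mono[of "\<sigma> a" u] mono[of u "\<sigma> b"] by (simp add: \<sigma>)
  have le: "\<sigma> a \<le> \<sigma> b" using mono[of "\<sigma> b" "\<sigma> a"] assms by (auto simp: \<sigma> not_less)
  have "(\<integral>\<^sup>+u. ennreal (2 * \<bar>u\<bar>) * indicator {a<..<b} (u * \<bar>u\<bar>) \<partial>lborel)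
      = (\<integral>\<^sup>+u. ennreal (2 * \<bar>u\<bar>) * indicator {\<sigma> a..\<sigma> b} u \<partial>lborel)"
  proof (rule nn_integral_cong_AE)
    show "AE u in lborel. ennreal (2 * \<bar>u\<bar>) * indicator {a<..<b} (u * \<bar>u\<bar>)
        = ennreal (2 * \<bar>u\<bar>) * indicator {\<sigma> a..\<sigma> b} u"
      using AE_lborel_singleton[of "\<sigma> a"] AE_lborel_singleton[of "\<sigma> b"]
    proof eventually_elim
      case (elim u)
      then have "u \<in> {\<sigma> a<..<\<sigma> b} \<longleftrightarrow> u \<in> {\<sigma> a..\<sigma> b}" by auto
      then show ?case using iff[of u] by (simp add: indicator_def)
    qed
  qed
  also have "\<dots> = \<sigma> b * \<bar>\<sigma> b\<bar> - \<sigma> a * \<bar>\<sigma> a\<bar>"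
    by (rule nn_integral_FTC_Icc[where F = "\<lambda>u. u * \<bar>u\<bar>"]) (auto intro: DERIV_signed_square le)
  finally show ?thesis by (simp add: \<sigma>)
qed

definition signed_square :: "real ^ 'n \<Rightarrow> real ^ 'n" where
  "signed_square v = (\<chi> i. v $ i * \<bar>v $ i\<bar>)"

lemma signed_square_measurable [measurable]: "signed_square \<in> borel \<rightarrow>\<^sub>M borel"
proof -
  have "continuous_on UNIV (signed_square :: real ^ 'n \<Rightarrow> _)"
    unfolding signed_square_def by (intro continuous_intros)
  then show ?thesis by (rule borel_measurable_continuous_onI)
qed

text \<open>Extending the substitution of squares to an odd bijection of the whole space makes it a
  statement about boxes; the change of variables theorem of the library is not available here,
  since it needs a well-ordered index type.\<close>

lemma lborel_signed_square:
  "distr (density lborel (\<lambda>v. ennreal (\<Prod>i\<in>UNIV. 2 * \<bar>v $ i\<bar>))) borel signed_square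
     = (lborel :: (real ^ 'n) measure)"
proof (rule lborel_eqI[symmetric])
  let ?D = "density lborel (\<lambda>v :: real ^ 'n. ennreal (\<Prod>i\<in>UNIV. 2 * \<bar>v $ i\<bar>))"
  fix l u :: "real ^ 'n"
  assume le: "\<And>b. b \<in> Basis \<Longrightarrow> l \<bullet> b \<le> u \<bullet> b"
  have le': "l $ i \<le> u $ i" for i
    using le[of "axis i 1"] by (simp add: inner_axis axis_in_Basis_iff)
  have "emeasure (distr ?D borel signed_square) (box l u) = emeasure ?D (signed_square -` box l u)"
    by (subst emeasure_distr) auto
  also have "\<dots> = (\<integral>\<^sup>+v. ennreal (\<Prod>i\<in>UNIV. 2 * \<bar>v $ i\<bar>) * indicator (signed_square -` box l u) v \<partial>lborel)"
    by (rule emeasure_density) (auto intro!: measurable_sets_borel[OF signed_square_measurable])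
  also have "\<dots> = (\<integral>\<^sup>+v. (\<Prod>i\<in>UNIV. ennreal (2 * \<bar>v $ i\<bar>) * indicator {l $ i<..<u $ i} (v $ i * \<bar>v $ i\<bar>)) \<partial>lborel)"
  proof (rule nn_integral_cong)
    fix v :: "real ^ 'n"
    have "(indicator (signed_square -` box l u) v :: ennreal) = (\<Prod>i\<in>UNIV. indicator {l $ i<..<u $ i} (v $ i * \<bar>v $ i\<bar>))"
    proof (cases "signed_square v \<in> box l u")
      case True
      then show ?thesis by (simp add: mem_box_cart signed_square_def)
    next
      case False
      then obtain i where "\<not> (l $ i < v $ i * \<bar>v $ i\<bar> \<and> v $ i * \<bar>v $ i\<bar> < u $ i)"
        by (auto simp: mem_box_cart signed_square_def)
      then have "indicator {l $ i<..<u $ i} (v $ i * \<bar>v $ i\<bar>) = (0::ennreal)" by simp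
      then have "(\<Prod>i\<in>UNIV. indicator {l $ i<..<u $ i} (v $ i * \<bar>v $ i\<bar>)) = (0::ennreal)"
        by (intro prod_zero bexI[of _ i]) auto
      then show ?thesis using False by simp
    qed
    moreover have "ennreal (\<Prod>i\<in>UNIV. 2 * \<bar>v $ i\<bar>) = (\<Prod>i\<in>UNIV. ennreal (2 * \<bar>v $ i\<bar>))"
      by (rule prod_ennreal[symmetric]) auto
    ultimately show "ennreal (\<Prod>i\<in>UNIV. 2 * \<bar>v $ i\<bar>) * indicator (signed_square -` box l u) v
       = (\<Prod>i\<in>UNIV. ennreal (2 * \<bar>v $ i\<bar>) * indicator {l $ i<..<u $ i} (v $ i * \<bar>v $ i\<bar>))"
      by (simp only: prod.distrib)
  qed
  also have "\<dots> = (\<Prod>i\<in>UNIV. \<integral>\<^sup>+x. ennreal (2 * \<bar>x\<bar>) * indicator {l $ i<..<u $ i} (x * \<bar>x\<bar>) \<partial>lborel)"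
    by (rule nn_integral_lborel_vec) measurable
  also have "\<dots> = (\<Prod>i\<in>UNIV. ennreal (u $ i - l $ i))"
    by (simp only: nn_integral_signed_square[OF le'])
  also have "\<dots> = ennreal (\<Prod>i\<in>UNIV. u $ i - l $ i)"
    by (rule prod_ennreal) (simp add: le')
  also have "(\<Prod>i\<in>UNIV. u $ i - l $ i) = (\<Prod>b\<in>Basis. (u - l) \<bullet> b)"
  proof -
    have B: "(Basis :: (real ^ 'n) set) = (\<lambda>i. axis i 1) ` UNIV" by (auto simp: Basis_vec_def)
    have inj: "inj (\<lambda>i. axis i (1::real) :: real ^ 'n)" by (auto simp: inj_def axis_eq_axis)
    show ?thesis unfolding B by (simp add: prod.reindex[OF inj] inner_axis)
  qed
  finally show "emeasure (distr ?D borel signed_square) (box l u) = ennreal (\<Prod>b\<in>Basis. (u - l) \<bullet> b)" .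
qed simp

lemma nn_integral_signed_square_vec:
  fixes \<phi> :: "real ^ 'n \<Rightarrow> ennreal"
  assumes [measurable]: "\<phi> \<in> borel_measurable borel"
  shows "(\<integral>\<^sup>+l. \<phi> l \<partial>lborel) = (\<integral>\<^sup>+v. ennreal (\<Prod>i\<in>UNIV. 2 * \<bar>v $ i\<bar>) * \<phi> (signed_square v) \<partial>lborel)"
  by (subst lborel_signed_square[symmetric])
     (simp add: nn_integral_distr nn_integral_density)

section \<open>Weights in the square-root coordinates\<close>

definition theta_weight :: "real \<Rightarrow> nat \<Rightarrow> real \<Rightarrow> real" where
  "theta_weight t k u = 2 * t powr (real k + 1 / 2) / Gamma (real k + 1 / 2) * (u ^ (2 * k) * exp (- t * u\<^sup>2))"

definition theta_weight1 :: "real \<Rightarrow> nat \<Rightarrow> real \<Rightarrow> real" where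
  "theta_weight1 t k u = 2 * t powr (real k + 1 / 2) / Gamma (real k + 1 / 2)
     * ((2 * real k * u ^ (2 * k - 1) - 2 * t * u ^ (2 * k + 1)) * exp (- t * u\<^sup>2))"

definition theta_weight2 :: "real \<Rightarrow> nat \<Rightarrow> real \<Rightarrow> real" where
  "theta_weight2 t k u = - 4 * t * (real k * (theta_weight t k u - theta_weight t (k - 1) u)
     + (real k + 1 / 2) * (theta_weight t k u - theta_weight t (k + 1) u))"

lemma DERIV_theta_weight: "(theta_weight t k has_real_derivative theta_weight1 t k u) (at u)"
proof -
  have "((\<lambda>u. u ^ (2 * k) * exp (- t * u\<^sup>2)) has_real_derivative
      (2 * real k * u ^ (2 * k - 1) - 2 * t * u ^ (2 * k + 1)) * exp (- t * u\<^sup>2)) (at u)"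
    by (auto intro!: derivative_eq_intros simp: algebra_simps)
  then show ?thesis
    unfolding theta_weight_def[abs_def] theta_weight1_def by (rule DERIV_cmult)
qed

lemma theta_coeff_Suc:
  assumes t: "0 < t"
  shows "2 * t powr (real (Suc k) + 1 / 2) / Gamma (real (Suc k) + 1 / 2)
    = 2 * t powr (real k + 1 / 2) / Gamma (real k + 1 / 2) * (t / (real k + 1 / 2))"
proof -
  have "Gamma (real k + 1 / 2 + 1) = (real k + 1 / 2) * Gamma (real k + 1 / 2)"
    by (rule Gamma_plus1) (auto simp: nonpos_Ints_def)
  moreover have "t powr (real k + 1 / 2 + 1) = t powr (real k + 1 / 2) * t"
    unfolding powr_add[of t "_ + _" 1] using t by simp
  moreover have "real (Suc k) + 1 / 2 = real k + 1 / 2 + 1" by simp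
  ultimately show ?thesis by (simp only:) (simp add: mult_ac)
qed

lemma DERIV_theta_weight1:
  assumes t: "0 < t"
  shows "(theta_weight1 t k has_real_derivative theta_weight2 t k u) (at u)"
proof -
  define c where "c k = 2 * t powr (real k + 1 / 2) / Gamma (real k + 1 / 2)" for k
  have cS: "c (Suc k) = c k * (t / (real k + 1 / 2))" for k
    unfolding c_def by (rule theta_coeff_Suc[OF t])
  let ?E = "exp (- t * u\<^sup>2)"
  have D: "(theta_weight1 t k has_real_derivative
      c k * ((2 * real k * (real (2 * k - 1) * u ^ (2 * k - 1 - 1)) - 2 * t * (real (2 * k + 1) * u ^ (2 * k))) * ?E
        + (2 * real k * u ^ (2 * k - 1) - 2 * t * u ^ (2 * k + 1)) * (?E * (- t * (2 * u))))) (at u)"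
    unfolding theta_weight1_def[abs_def] c_def[symmetric]
    by (rule DERIV_cmult) (auto intro!: derivative_eq_intros, cases k, auto simp: algebra_simps)
  show ?thesis
  proof (rule DERIV_cong[OF D])
    show "c k * ((2 * real k * (real (2 * k - 1) * u ^ (2 * k - 1 - 1)) - 2 * t * (real (2 * k + 1) * u ^ (2 * k))) * ?E
        + (2 * real k * u ^ (2 * k - 1) - 2 * t * u ^ (2 * k + 1)) * (?E * (- t * (2 * u)))) = theta_weight2 t k u"
    proof (cases k)
      case 0
      have "c (Suc 0) = c 0 * (t / (1 / 2))" using cS[of 0] by simp
      then have "c (Suc 0) = t * (c 0 * 2)" by simp
      then show ?thesis
        unfolding theta_weight2_def theta_weight_def c_def[symmetric] 0
        by (simp add: algebra_simps power2_eq_square)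
    next
      case (Suc j)
      have 1: "c j * t = c k * (real j + 1 / 2)"
        using cS[of j] t unfolding Suc by (simp add: field_simps)
      have 2: "c (k + 1) * (real k + 1 / 2) = c k * t"
        using cS[of k] by (simp add: field_simps)
      have eq: "theta_weight2 t k u = - 4 * (real k * (t * c k * (u ^ (2 * k) * ?E) - (c j * t) * (u ^ (2 * j) * ?E))
         + t * ((real k + 1 / 2) * c k * (u ^ (2 * k) * ?E) - (c (k + 1) * (real k + 1 / 2)) * (u ^ (2 * (k + 1)) * ?E)))"
        unfolding theta_weight2_def theta_weight_def c_def[symmetric] by (simp add: Suc algebra_simps)
      show ?thesis unfolding eq[unfolded 1 2]
        by (simp add: Suc field_simps power2_eq_square)
    qed
  qed
qed

section \<open>Superharmonic factors\<close>

definition monomial_weight :: "real \<Rightarrow> nat ^ 'n \<Rightarrow> real ^ 'n \<Rightarrow> real" where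
  "monomial_weight t z v = (\<Prod>j\<in>UNIV. (v $ j) ^ (2 * z $ j) * exp (- t * (v $ j)\<^sup>2))"

definition rest_weight :: "real \<Rightarrow> 'n \<Rightarrow> nat ^ 'n \<Rightarrow> real ^ 'n \<Rightarrow> real" where
  "rest_weight t i z v = (\<Prod>j\<in>UNIV - {i}. (v $ j) ^ (2 * z $ j) * exp (- t * (v $ j)\<^sup>2))"

lemma indicator_mult_measurable:
  fixes p :: "real ^ 'n \<Rightarrow> real"
  assumes "continuous_on nonneg_orthant p"
  shows "(\<lambda>v. indicator nonneg_orthant v * p v) \<in> borel_measurable borel"
  using borel_measurable_continuous_on_indicator[OF _ assms] by simp

lemma continuous_on_monomial_weight: "continuous_on S (monomial_weight t z)"
  unfolding monomial_weight_def by (intro continuous_intros)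

lemma continuous_on_rest_weight: "continuous_on S (rest_weight t i z)"
  unfolding rest_weight_def by (intro continuous_intros)

lemma integrable_monomial_weight:
  assumes p: "continuous_on nonneg_orthant p" and fin: "weighted_integral p z t < \<infinity>"
  shows "integrable lborel (\<lambda>v. indicator nonneg_orthant v * (p v * monomial_weight t z v))"
proof (rule integrableI_bounded)
  show "(\<lambda>v. indicator nonneg_orthant v * (p v * monomial_weight t z v)) \<in> borel_measurable lborel"
    using indicator_mult_measurable[OF continuous_on_mult[OF p continuous_on_monomial_weight]] by simp
  have "(\<integral>\<^sup>+v. ennreal (norm (indicator nonneg_orthant v * (p v * monomial_weight t z v))) \<partial>lborel) = weighted_integral p z t"
    unfolding weighted_integral_def nn_integral_completion
  proof (rule nn_integral_cong)
    fix v :: "real ^ 'a"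
    have "0 \<le> monomial_weight t z v" if "v \<in> nonneg_orthant"
      using that unfolding monomial_weight_def nonneg_orthant_def by (intro prod_nonneg) auto
    then show "ennreal (norm (indicator nonneg_orthant v * (p v * monomial_weight t z v)))
      = ennreal (\<bar>p v\<bar> * (\<Prod>j\<in>UNIV. v $ j ^ (2 * z $ j) * exp (- t * (v $ j)\<^sup>2))) * indicator nonneg_orthant v"
      unfolding monomial_weight_def[symmetric] by (cases "v \<in> nonneg_orthant") (simp_all add: abs_mult)
  qed
  then show "(\<integral>\<^sup>+v. ennreal (norm (indicator nonneg_orthant v * (p v * monomial_weight t z v))) \<partial>lborel) < \<infinity>"
    using fin by simp
qed

lemma monomial_weight_update:
  "monomial_weight t (\<chi> j. if j = i then k else z $ j) v = (v $ i) ^ (2 * k) * exp (- t * (v $ i)\<^sup>2) * rest_weight t i z v"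
  unfolding monomial_weight_def rest_weight_def by (subst prod.remove[of _ i]) (auto intro!: prod.cong)

lemma integrable_odd_weight:
  assumes p: "continuous_on nonneg_orthant p" and fin: "\<And>z. weighted_integral p z t < \<infinity>"
  shows "integrable lborel (\<lambda>v. indicator nonneg_orthant v
    * (p v * ((v $ i) ^ m * exp (- t * (v $ i)\<^sup>2) * rest_weight t i z v)))"
proof (rule Bochner_Integration.integrable_bound)
  let ?M = "\<lambda>k. monomial_weight t (\<chi> j. if j = i then k else z $ j)"
  let ?N = "nonneg_orthant"
  show "integrable lborel (\<lambda>v. \<bar>indicator ?N v * (p v * ?M 0 v)\<bar> + \<bar>indicator ?N v * (p v * ?M m v)\<bar>)"
    by (intro Bochner_Integration.integrable_add integrable_abs integrable_monomial_weight p fin)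
  show "(\<lambda>v. indicator ?N v * (p v * ((v $ i) ^ m * exp (- t * (v $ i)\<^sup>2) * rest_weight t i z v))) \<in> borel_measurable lborel"
    unfolding measurable_lborel2
    by (intro indicator_mult_measurable continuous_on_mult p continuous_on_rest_weight continuous_intros)
  show "AE v in lborel. norm (indicator ?N v * (p v * ((v $ i) ^ m * exp (- t * (v $ i)\<^sup>2) * rest_weight t i z v)))
     \<le> norm (\<bar>indicator ?N v * (p v * ?M 0 v)\<bar> + \<bar>indicator ?N v * (p v * ?M m v)\<bar>)"
  proof (rule AE_I2)
    fix v :: "real ^ 'a"
    have "(v $ i) ^ m * k \<le> k + (v $ i) ^ (2 * m) * k" if "0 \<le> k" for k
    proof -
      have "0 \<le> ((v $ i) ^ m - 1)\<^sup>2" by simp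
      then have "2 * (v $ i) ^ m \<le> 1 + (v $ i) ^ (2 * m)"
        by (simp add: power2_eq_square algebra_simps power_mult power_mult_distrib)
      moreover have "0 \<le> 1 + (v $ i) ^ (2 * m)" by (simp add: power_mult)
      ultimately have "(v $ i) ^ m \<le> 1 + (v $ i) ^ (2 * m)" by linarith
      from mult_right_mono[OF this that] show ?thesis by (simp add: distrib_right)
    qed
    note * = this[of "\<bar>p v\<bar> * (exp (- t * (v $ i)\<^sup>2) * \<bar>rest_weight t i z v\<bar>)"]
    show "norm (indicator ?N v * (p v * ((v $ i) ^ m * exp (- t * (v $ i)\<^sup>2) * rest_weight t i z v)))
     \<le> norm (\<bar>indicator ?N v * (p v * ?M 0 v)\<bar> + \<bar>indicator ?N v * (p v * ?M m v)\<bar>)"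
    proof (cases "v \<in> ?N")
      case True
      then have "0 \<le> v $ i" by (simp add: nonneg_orthant_def)
      then show ?thesis using True * unfolding monomial_weight_update
        by (simp add: abs_mult mult_ac)
    qed simp
  qed
qed

definition theta_prod :: "real \<Rightarrow> nat ^ 'n \<Rightarrow> real ^ 'n \<Rightarrow> real" where
  "theta_prod t z v = (\<Prod>j\<in>UNIV. theta_weight t (z $ j) (v $ j))"

definition theta_rest :: "real \<Rightarrow> 'n \<Rightarrow> nat ^ 'n \<Rightarrow> real ^ 'n \<Rightarrow> real" where
  "theta_rest t i z v = (\<Prod>j\<in>UNIV - {i}. theta_weight t (z $ j) (v $ j))"

abbreviation theta_coeff :: "real \<Rightarrow> nat \<Rightarrow> real" where
  "theta_coeff t k \<equiv> 2 * t powr (real k + 1 / 2) / Gamma (real k + 1 / 2)"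

lemma theta_prod_monomial:
  "theta_prod t z v = (\<Prod>j\<in>UNIV. theta_coeff t (z $ j)) * monomial_weight t z v"
  unfolding theta_prod_def theta_weight_def monomial_weight_def by (rule prod.distrib)

lemma theta_rest_monomial:
  "theta_rest t i z v = (\<Prod>j\<in>UNIV - {i}. theta_coeff t (z $ j)) * rest_weight t i z v"
  unfolding theta_rest_def theta_weight_def rest_weight_def by (rule prod.distrib)

lemma theta_prod_split:
  assumes "\<And>j. j \<noteq> i \<Longrightarrow> w $ j = z $ j"
  shows "theta_prod t w v = theta_weight t (w $ i) (v $ i) * theta_rest t i z v"
  unfolding theta_prod_def theta_rest_def using assms by (subst prod.remove[of _ i]) (auto intro!: prod.cong)

lemma theta_weight_nonneg: "0 \<le> u \<Longrightarrow> 0 \<le> theta_weight t k u"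
  unfolding theta_weight_def by (simp add: less_imp_le[OF Gamma_half_pos])

lemma theta_prod_nonneg: "v \<in> nonneg_orthant \<Longrightarrow> 0 \<le> theta_prod t z v"
  and theta_rest_nonneg: "v \<in> nonneg_orthant \<Longrightarrow> 0 \<le> theta_rest t i z v"
  unfolding theta_prod_def theta_rest_def nonneg_orthant_def
  by (auto intro!: prod_nonneg theta_weight_nonneg)

lemma integrable_theta_prod:
  assumes p: "continuous_on nonneg_orthant p" and fin: "weighted_integral p z t < \<infinity>"
  shows "integrable lborel (\<lambda>v. indicator nonneg_orthant v * (p v * theta_prod t z v))"
proof -
  have "integrable lborel (\<lambda>v. (\<Prod>j\<in>UNIV. theta_coeff t (z $ j)) * (indicator nonneg_orthant v * (p v * monomial_weight t z v)))"
    by (intro integrable_mult_right integrable_monomial_weight p fin)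
  then show ?thesis by (simp only: theta_prod_monomial mult_ac)
qed

lemma has_pderiv_at_partial_deriv:
  assumes "has_pderiv_at p i v"
  shows "((\<lambda>h. p (v + h *\<^sub>R axis i 1)) has_vector_derivative partial_deriv i p v) (at 0 within orthant_line i v)"
  using assms unfolding has_pderiv_at_def partial_deriv_def by (rule vector_derivative_works[THEN iffD1])

lemma F_fun_theta:
  fixes f :: "real ^ 'n \<Rightarrow> ennreal"
  assumes t: "0 < t" and fg: "\<And>v. v \<in> nonneg_orthant \<Longrightarrow> f v \<noteq> \<infinity> \<and> g v = enn2real (f v)"
    and g: "continuous_on nonneg_orthant g" and fin: "weighted_integral g z t < \<infinity>"
  shows "enn2real (F_fun f z t) = (\<integral>v. indicator nonneg_orthant v * (g v * theta_prod t z v) \<partial>lborel)"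
proof -
  let ?P = "pos_orthant :: (real ^ 'n) set"
  have fg': "f v = ennreal (g v)" if "v \<in> nonneg_orthant" for v
    using fg[OF that] by (simp add: less_top)
  have g0: "0 \<le> g v" if "v \<in> nonneg_orthant" for v
    using fg[OF that] by simp
  let ?\<phi> = "\<lambda>l. ennreal (indicator ?P l * (g (vsqrt l) * gamma_weight t z l))"
  have "continuous_on ?P (\<lambda>l. g (vsqrt l))"
  proof (rule continuous_on_compose2[OF g])
    show "continuous_on ?P vsqrt" unfolding vsqrt_def by (intro continuous_intros)
    show "vsqrt ` ?P \<subseteq> nonneg_orthant" using vsqrt_pos pos_subset_nonneg by auto
  qed
  then have m: "(\<lambda>l. indicator ?P l * g (vsqrt l)) \<in> borel_measurable borel"
    using borel_measurable_continuous_on_indicator[of ?P "\<lambda>l. g (vsqrt l)"] by simp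
  have \<phi>m: "?\<phi> \<in> borel_measurable borel"
    unfolding mult.assoc[symmetric]
    by (intro measurable_compose[OF borel_measurable_times[OF m gamma_weight_measurable] measurable_ennreal])
  have "F_fun f z t = (\<integral>\<^sup>+l. ?\<phi> l \<partial>lborel)"
    unfolding F_fun_eq nn_integral_completion
  proof (rule nn_integral_cong)
    fix l :: "real ^ 'n"
    show "f (vsqrt l) * indicator ?P l * ennreal (gamma_weight t z l) = ?\<phi> l"
    proof (cases "l \<in> ?P")
      case True
      then have "vsqrt l \<in> nonneg_orthant" using vsqrt_pos pos_subset_nonneg by auto
      then show ?thesis using True by (simp add: fg' ennreal_mult g0 gamma_weight_nonneg)
    qed simp
  qed
  also have "\<dots> = (\<integral>\<^sup>+v. ennreal (\<Prod>i\<in>UNIV. 2 * \<bar>v $ i\<bar>) * ?\<phi> (signed_square v) \<partial>lborel)"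
    by (rule nn_integral_signed_square_vec[OF \<phi>m])
  also have "\<dots> = (\<integral>\<^sup>+v. ennreal (indicator nonneg_orthant v * (g v * theta_prod t z v)) \<partial>lborel)"
  proof (rule nn_integral_cong_AE)
    have "AE v in lebesgue. v \<notin> nonneg_orthant - ?P"
      using negligible_nonneg_minus_pos unfolding negligible_iff_null_sets by (rule AE_not_in)
    then have "AE v in lborel. v \<notin> nonneg_orthant - ?P"
      by (rule AE_completion_iff[THEN iffD1, rotated])
    then show "AE v in lborel. ennreal (\<Prod>i\<in>UNIV. 2 * \<bar>v $ i\<bar>) * ?\<phi> (signed_square v)
        = ennreal (indicator nonneg_orthant v * (g v * theta_prod t z v))"
    proof (eventually_elim)
      case (elim v)
      have "0 < u * \<bar>u\<bar> \<longleftrightarrow> 0 < u" for u :: real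
        by (cases "0 < u") (auto simp: zero_less_mult_iff)
      then have iff: "signed_square v \<in> ?P \<longleftrightarrow> v \<in> ?P"
        by (simp add: signed_square_def pos_orthant_def)
      show ?case
      proof (cases "v \<in> ?P")
        case False
        then show ?thesis using elim iff by (auto simp: indicator_def)
      next
        case True
        then have v: "0 < v $ i" for i by (simp add: pos_orthant_def)
        have sq: "signed_square v = vsquare v"
          by (simp add: signed_square_def vsquare_def vec_eq_iff abs_of_pos[OF v] power2_eq_square)
        have vN: "v \<in> nonneg_orthant" using True pos_subset_nonneg by auto
        have "(\<Prod>i\<in>UNIV. 2 * \<bar>v $ i\<bar>) * gamma_weight t z (vsquare v) = theta_prod t z v"
          unfolding gamma_weight_def theta_prod_def prod.distrib[symmetric]
        proof (rule prod.cong)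
          fix i
          have "((v $ i)\<^sup>2) powr (real (z $ i) - 1 / 2) = v $ i powr (2 * (real (z $ i) - 1 / 2))"
            using v[of i] powr_powr[of "v $ i" 2 "real (z $ i) - 1 / 2"] by simp
          also have "\<dots> * v $ i = v $ i powr (2 * (real (z $ i) - 1 / 2) + 1)"
            unfolding powr_add using v[of i] by simp
          also have "2 * (real (z $ i) - 1 / 2) + 1 = real (2 * z $ i)" by simp
          also have "v $ i powr real (2 * z $ i) = v $ i ^ (2 * z $ i)"
            using v[of i] by (rule powr_realpow)
          finally have e: "((v $ i)\<^sup>2) powr (real (z $ i) - 1 / 2) * v $ i = v $ i ^ (2 * z $ i)" .
          show "2 * \<bar>v $ i\<bar> * (t powr (real (z $ i) + 1 / 2) * vsquare v $ i powr (real (z $ i) - 1 / 2) *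
              exp (- t * vsquare v $ i) / Gamma (real (z $ i) + 1 / 2)) = theta_weight t (z $ i) (v $ i)"
            unfolding theta_weight_def e[symmetric] using v[of i] by (simp add: vsquare_def mult_ac)
        qed simp
        then show ?thesis
          using True vN vsqrt_vsquare[OF vN] iff
          by (simp add: sq g0 ennreal_mult[symmetric] prod_nonneg gamma_weight_nonneg mult.left_commute)
      qed
    qed
  qed
  also have "\<dots> = ennreal (\<integral>v. indicator nonneg_orthant v * (g v * theta_prod t z v) \<partial>lborel)"
    by (rule nn_integral_eq_integral[OF integrable_theta_prod[OF g fin]])
       (auto simp: indicator_def g0 theta_prod_nonneg)
  finally show ?thesis
    by (simp add: integral_nonneg_AE indicator_def g0 theta_prod_nonneg)
qed

lemma superharmonic_star:
  fixes f :: "real ^ 'n \<Rightarrow> ennreal"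
  assumes fg: "\<And>v. v \<in> nonneg_orthant \<Longrightarrow> f v \<noteq> \<infinity> \<and> g v = enn2real (f v)"
    and C2: "Ck_orthant 2 g" and reg: "regularity_conditions g"
    and lap: "\<And>v. v \<in> nonneg_orthant \<Longrightarrow> (\<Sum>i\<in>UNIV. partial_deriv i (partial_deriv i g) v) \<le> 0"
    and bd: "\<And>i v. v \<in> nonneg_orthant \<Longrightarrow> v $ i = 0 \<Longrightarrow> partial_deriv i g v \<le> 0"
  shows "star_condition f"
  unfolding star_condition_def
proof (intro allI impI)
  fix z :: "nat ^ 'n" and t :: real assume t: "0 < t"
  let ?N = "nonneg_orthant :: (real ^ 'n) set"
  let ?g1 = "\<lambda>i. partial_deriv i g" and ?g2 = "\<lambda>i. partial_deriv i (partial_deriv i g)"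
  have c: "continuous_on ?N g" "continuous_on ?N (?g1 i)" "continuous_on ?N (?g2 i)"
    and pd: "\<And>v. v \<in> ?N \<Longrightarrow> has_pderiv_at g i v" "\<And>v. v \<in> ?N \<Longrightarrow> has_pderiv_at (?g1 i) i v" for i
    using C2 by (auto simp: numeral_2_eq_2)
  have fin: "weighted_integral g w t < \<infinity>" "weighted_integral (?g1 i) w t < \<infinity>" "weighted_integral (?g2 i) w t < \<infinity>" for i w
    using reg t unfolding regularity_conditions_def by blast+
  define I where "I w = (\<integral>v. indicator ?N v * (g v * theta_prod t w v) \<partial>lborel)" for w
  define J where "J i = (\<integral>v. indicator ?N v * (?g2 i v * theta_prod t z v) \<partial>lborel)" for i
  have F: "enn2real (F_fun f w t) = I w" for w
    unfolding I_def by (rule F_fun_theta[OF t fg c(1) fin(1)])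
  have ig: "integrable lborel (\<lambda>v. indicator ?N v * (g v * theta_prod t w v))" for w
    by (rule integrable_theta_prod[OF c(1) fin(1)])
  have ig1: "integrable lborel (\<lambda>v. indicator ?N v * (?g1 i v * theta_prod t z v))" for i
    by (rule integrable_theta_prod[OF c(2) fin(2)])
  have ig2: "integrable lborel (\<lambda>v. indicator ?N v * (?g2 i v * theta_prod t z v))" for i
    by (rule integrable_theta_prod[OF c(3) fin(3)])
  have key: "- 4 * t * (real (z $ i) * (I z - I (z - axis i 1)) + (real (z $ i) + 1 / 2) * (I z - I (z + axis i 1))) \<le> J i" for i
  proof -
    let ?R = "theta_rest t i z"
    let ?k = "z $ i"
    define H where "H v = g v * (theta_weight1 t ?k (v $ i) * ?R v) - ?g1 i v * (theta_weight t ?k (v $ i) * ?R v)" for v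
    define W where "W v = g v * (theta_weight2 t ?k (v $ i) * ?R v) - ?g2 i v * (theta_weight t ?k (v $ i) * ?R v)" for v
    have tz: "theta_prod t z v = theta_weight t ?k (v $ i) * ?R v" for v
      by (rule theta_prod_split) simp
    have tm: "theta_prod t (z - axis i 1) v = theta_weight t (?k - 1) (v $ i) * ?R v" for v
      using theta_prod_split[of i "z - axis i 1" z t v] by (simp add: axis_def)
    have tp: "theta_prod t (z + axis i 1) v = theta_weight t (?k + 1) (v $ i) * ?R v" for v
      using theta_prod_split[of i "z + axis i 1" z t v] by (simp add: axis_def)
    have Weq: "indicator ?N v * W v
      = - 4 * t * (real ?k * (indicator ?N v * (g v * theta_prod t z v) - indicator ?N v * (g v * theta_prod t (z - axis i 1) v))
          + (real ?k + 1 / 2) * (indicator ?N v * (g v * theta_prod t z v) - indicator ?N v * (g v * theta_prod t (z + axis i 1) v)))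
        - indicator ?N v * (?g2 i v * theta_prod t z v)" for v
      unfolding W_def tz tm tp theta_weight2_def by (simp add: algebra_simps)
    have cR: "continuous_on ?N ?R"
      unfolding theta_rest_def theta_weight_def by (intro continuous_intros)
    have cw: "continuous_on ?N (\<lambda>v. theta_weight t m (v $ i))" for m
      unfolding theta_weight_def by (intro continuous_intros)
    have cw1: "continuous_on ?N (\<lambda>v. theta_weight1 t m (v $ i))" for m
      unfolding theta_weight1_def by (intro continuous_intros)
    have cw2: "continuous_on ?N (\<lambda>v. theta_weight2 t m (v $ i))" for m
      unfolding theta_weight2_def by (intro continuous_intros cw)
    have "(\<integral>v. indicator ?N v * W v \<partial>lborel) \<le> 0"
    proof (rule orthant_divergence)
      show "continuous_on ?N H" unfolding H_def[abs_def]
        by (intro continuous_on_diff continuous_on_mult c cR cw cw1)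
      show "continuous_on ?N W" unfolding W_def[abs_def]
        by (intro continuous_on_diff continuous_on_mult c cR cw cw2)
      show "integrable lborel (\<lambda>v. indicator ?N v * W v)"
        unfolding Weq by (intro Bochner_Integration.integrable_diff Bochner_Integration.integrable_add integrable_mult_right ig ig2)
      show "integrable lborel (\<lambda>v. indicator ?N v * H v)"
      proof -
        let ?C = "theta_coeff t ?k * (\<Prod>j\<in>UNIV - {i}. theta_coeff t (z $ j))"
        let ?o = "\<lambda>m v. indicator ?N v * (g v * ((v $ i) ^ m * exp (- t * (v $ i)\<^sup>2) * rest_weight t i z v))"
        have "indicator ?N v * H v = ?C * (2 * real ?k) * ?o (2 * ?k - 1) v - ?C * (2 * t) * ?o (2 * ?k + 1) v
            - indicator ?N v * (?g1 i v * theta_prod t z v)" for v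
          unfolding H_def tz theta_weight1_def theta_rest_monomial by (simp add: algebra_simps)
        then show ?thesis
          by (simp only:) (intro Bochner_Integration.integrable_diff integrable_mult_right integrable_odd_weight ig1 c fin)
      qed
      show "0 \<le> H v" if v: "v \<in> ?N" "v $ i = 0" for v
      proof -
        have "theta_weight1 t ?k (v $ i) = 0"
          unfolding theta_weight1_def v(2) by (cases ?k) auto
        moreover have "?g1 i v * (theta_weight t ?k (v $ i) * ?R v) \<le> 0"
          using bd[OF v] v by (intro mult_nonpos_nonneg mult_nonneg_nonneg theta_weight_nonneg theta_rest_nonneg) auto
        ultimately show ?thesis by (simp add: H_def)
      qed
      fix v assume v: "v \<in> ?N"
      let ?S = "at 0 within orthant_line i v"
      have R0: "?R (v + h *\<^sub>R axis i 1) = ?R v" for h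
        unfolding theta_rest_def by (rule prod.cong) (auto simp: axis_def)
      have vi: "(v + h *\<^sub>R axis i 1) $ i = v $ i + h" for h by simp
      have dw: "((\<lambda>h. q (v $ i + h)) has_real_derivative q') ?S" if "(q has_real_derivative q') (at (v $ i))" for q q'
      proof -
        have "(q has_real_derivative q') (at (v $ i + 0))" using that by simp
        then have "((\<lambda>h. q (h + v $ i)) has_real_derivative q') (at 0)"
          by (subst (asm) add.commute, subst (asm) DERIV_shift)
        then show ?thesis
          unfolding add.commute[of "v $ i"] by (rule has_field_derivative_at_within)
      qed
      have "((\<lambda>h. H (v + h *\<^sub>R axis i 1)) has_real_derivative
        (?g1 i v * (theta_weight1 t ?k (v $ i) * ?R v) + theta_weight2 t ?k (v $ i) * ?R v * g v)
          - (?g2 i v * (theta_weight t ?k (v $ i) * ?R v) + theta_weight1 t ?k (v $ i) * ?R v * ?g1 i v)) ?S"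
        unfolding H_def R0 vi
        using has_pderiv_at_partial_deriv[OF pd(1)[OF v], of i] has_pderiv_at_partial_deriv[OF pd(2)[OF v], of i]
        unfolding has_real_derivative_iff_has_vector_derivative[symmetric]
        by (intro DERIV_diff DERIV_cong[OF DERIV_mult[OF _ DERIV_cmult_right[OF dw]]]) (auto intro: DERIV_theta_weight DERIV_theta_weight1 t)
      then show "((\<lambda>h. H (v + h *\<^sub>R axis i 1)) has_vector_derivative W v) ?S"
        unfolding has_real_derivative_iff_has_vector_derivative[symmetric]
        by (rule DERIV_cong) (simp add: W_def algebra_simps)
    qed
    also have "(\<integral>v. indicator ?N v * W v \<partial>lborel)
      = - 4 * t * (real ?k * (I z - I (z - axis i 1)) + (real ?k + 1 / 2) * (I z - I (z + axis i 1))) - J i"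
      unfolding Weq I_def J_def
      by (simp only: Bochner_Integration.integral_diff Bochner_Integration.integral_add integral_mult_right_zero
          Bochner_Integration.integrable_diff Bochner_Integration.integrable_add integrable_mult_right ig ig2)
    finally show ?thesis by simp
  qed
  have "(\<Sum>i\<in>UNIV. J i) = (\<integral>v. (\<Sum>i\<in>UNIV. indicator ?N v * (?g2 i v * theta_prod t z v)) \<partial>lborel)"
    unfolding J_def by (rule Bochner_Integration.integral_sum[symmetric]) (rule ig2)
  also have "\<dots> = (\<integral>v. indicator ?N v * ((\<Sum>i\<in>UNIV. ?g2 i v) * theta_prod t z v) \<partial>lborel)"
    by (simp add: sum_distrib_left sum_distrib_right)
  also have "\<dots> \<le> 0"
  proof -
    have "0 \<le> (\<integral>v. - (indicator ?N v * ((\<Sum>i\<in>UNIV. ?g2 i v) * theta_prod t z v)) \<partial>lborel)"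
      by (intro integral_nonneg_AE AE_I2) (auto simp: indicator_def intro!: mult_nonpos_nonneg lap theta_prod_nonneg)
    then show ?thesis by simp
  qed
  finally have J0: "(\<Sum>i\<in>UNIV. J i) \<le> 0" .
  have "- 4 * t * (\<Sum>i\<in>UNIV. real (z $ i) * (I z - I (z - axis i 1)) + (real (z $ i) + 1 / 2) * (I z - I (z + axis i 1))) \<le> (\<Sum>i\<in>UNIV. J i)"
    unfolding sum_distrib_left by (rule sum_mono) (rule key)
  then have "- 4 * t * (\<Sum>i\<in>UNIV. real (z $ i) * (I z - I (z - axis i 1)) + (real (z $ i) + 1 / 2) * (I z - I (z + axis i 1))) \<le> 0"
    using J0 by linarith
  then have S: "0 \<le> (\<Sum>i\<in>UNIV. real (z $ i) * (I z - I (z - axis i 1))) + (\<Sum>i\<in>UNIV. (real (z $ i) + 1 / 2) * (I z - I (z + axis i 1)))"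
    using t by (simp add: sum.distrib mult_le_0_iff zero_le_mult_iff)
  have "real (z $ i) * (enn2real (F_fun f z t) - enn2real (F_minus f z i t)) = real (z $ i) * (I z - I (z - axis i 1))" for i
    by (cases "z $ i = 0") (simp_all add: F_minus_def F)
  with S show "0 \<le> (\<Sum>i\<in>UNIV. real (z $ i) * (enn2real (F_fun f z t) - enn2real (F_minus f z i t))) +
         (\<Sum>i\<in>UNIV. (real (z $ i) + 1 / 2) * (enn2real (F_fun f z t) - enn2real (F_fun f (z + axis i 1) t)))"
    by (simp only: F)
qed

theorem theorem1:
  fixes f :: "real ^ 'n \<Rightarrow> ennreal" and r s :: real
  assumes "0 < r" and "0 < s"
    and "f \<in> borel_measurable (lebesgue_on nonneg_orthant)"
    and "\<not> (AE v in lebesgue_on nonneg_orthant. f v = 0)"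
    and "\<And>z t. 0 < t \<Longrightarrow> F_fun f z t < \<infinity>"
  shows
    "(star_condition f \<longrightarrow>
        weakly_dominates r s (pred_fJ f r s) (pred_J r s) \<and>
        ((\<not> (\<exists>c. \<forall>z. F_fun f z r = c)) \<longrightarrow>
          dominates r s (pred_fJ f r s) (pred_J r s)))
     \<and>
     (\<forall>g. (\<forall>v\<in>nonneg_orthant. f v \<noteq> \<infinity> \<and> g v = enn2real (f v)) \<and>
        Ck_orthant 2 g \<and>
        regularity_conditions g \<and>
        (\<forall>v\<in>nonneg_orthant. (\<Sum>i\<in>UNIV. partial_deriv i (partial_deriv i g) v) \<le> 0) \<and>
        (\<forall>i. \<forall>v\<in>nonneg_orthant. v $ i = 0 \<longrightarrow> partial_deriv i g v \<le> 0)
        \<longrightarrow> star_condition f)"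
proof (intro conjI impI allI)
  interpret prior_factor f
    using assms(3-5) by unfold_locales auto
  assume star: "star_condition f"
  show "weakly_dominates r s (pred_fJ f r s) (pred_J r s)"
    by (rule star_weakly_dominates[OF assms(1,2) star])
  show "dominates r s (pred_fJ f r s) (pred_J r s)" if "\<not> (\<exists>c. \<forall>z. F_fun f z r = c)"
    using star_dominates[OF assms(1,2) star] that by auto
next
  fix g
  assume "(\<forall>v\<in>nonneg_orthant. f v \<noteq> \<infinity> \<and> g v = enn2real (f v)) \<and>
        Ck_orthant 2 g \<and>
        regularity_conditions g \<and>
        (\<forall>v\<in>nonneg_orthant. (\<Sum>i\<in>UNIV. partial_deriv i (partial_deriv i g) v) \<le> 0) \<and>
        (\<forall>i. \<forall>v\<in>nonneg_orthant. v $ i = 0 \<longrightarrow> partial_deriv i g v \<le> 0)"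
  then show "star_condition f"
    by (intro superharmonic_star[of f g]) auto
qed

end
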